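(* (1) The inclusion functor $\iota_{K(\mathrm{Pers}(\mathbb{R}^n))}:K(\mathrm{Pers}(\mathbb{R}^n))\to D(\mathrm{Pers}(\mathbb{R}^n))$ is interleaving preserving: for all complexes $X,Y$ of persistence modules over $\mathbb{R}^n$ and all $\varepsilon\ge 0$, if $X$ and $Y$ are $\varepsilon$-interleaved in $K(\mathrm{Pers}(\mathbb{R}^n))$, then their images are $\varepsilon$-interleaved in $D(\mathrm{Pers}(\mathbb{R}^n))$. (2) The localization functor $\iota_{\mathrm{Pers}(\mathbb{R}^n)}:\mathrm{Pers}(\mathbb{R}^n)\to D(\mathrm{Pers}(\mathbb{R}^n))$ is interleaving preserving: for all persistence modules $M,N$ over $\mathbb{R}^n$ and all $\varepsilon\ge0$, if $M$ and $N$ are $\varepsilon$-interleaved in $\mathrm{Pers}(\mathbb{R}^n)$, then their images are $\varepsilon$-interleaved in $D(\mathrm{Pers}(\mathbb{R}^n))$.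
   Context: Fix a field $\mathbf{k}$ and an integer $n>0$; $\mathbb{R}^n$ carries the product partial order, viewed as a poset category. A persistence module over $\mathbb{R}^n$ is a functor $(\mathbb{R}^n,\le)\to\mathrm{Mod}(\mathbf{k})$ (the category of $\mathbf{k}$-vector spaces); with natural transformations these form the abelian category $\mathrm{Pers}(\mathbb{R}^n)$, which has enough projectives. Shift and smoothing. For $\varepsilon\in\mathbb{R}$, $M[\varepsilon]$ is defined by $M[\varepsilon](s)=M(s+(\varepsilon,\dots,\varepsilon))$ and $M[\varepsilon](s\le t)=M(s+(\varepsilon,\dots,\varepsilon)\le t+(\varepsilon,\dots,\varepsilon))$; this is an exact endofunctor. For $\varepsilon\ge 0$, $s_\varepsilon^M:M\to M[\varepsilon]$ is the morphism with components $M(t\le t+(\varepsilon,\dots,\varepsilon))$. $M,N$ are $\varepsilon$-interleaved ($\varepsilon\ge0$) if there are $f:M\to N[\varepsilon]$, $g:N\to M[\varepsilon]$ with $g[\varepsilon]\circ f=s_{2\varepsilon}^M$ and $f[\varepsilon]\circ g=s_{2\varepsilon}^N$. Homotopy interleavings. $K(\mathrm{Pers}(\mathbb{R}^n))$ has as objects cochain complexes of persistence modules and as morphisms chain maps modulo chain homotopy. For a complex $X$, $X[\varepsilon]$ denotes $[\varepsilon]$ applied degreewise (NOT the homological degree shift); this induces an endofunctor of $K(\mathrm{Pers}(\mathbb{R}^n))$. $[s_\varepsilon^X]$ is the homotopy class of the chain map $X\to X[\varepsilon]$ equal to $s_\varepsilon^{X^i}$ in degree $i$. $X,Y$ are $\varepsilon$-interleaved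 in $K(\mathrm{Pers}(\mathbb{R}^n))$ if there are morphisms $f:X\to Y[\varepsilon]$, $g:Y\to X[\varepsilon]$ of $K(\mathrm{Pers}(\mathbb{R}^n))$ with $g[\varepsilon]\circ f=[s_{2\varepsilon}^X]$ and $f[\varepsilon]\circ g=[s_{2\varepsilon}^Y]$. Derived interleavings. $D(\mathrm{Pers}(\mathbb{R}^n))$ is the derived category (localization of complexes at quasi-isomorphisms; same objects, morphisms are equivalence classes of roofs). $\iota_{K(\mathrm{Pers}(\mathbb{R}^n))}$ is the identity on objects and sends $[f]$ to the class of the roof $f\cdot\mathrm{id}^{-1}$. $\iota_{\mathrm{Pers}(\mathbb{R}^n)}$ sends a module to the complex concentrated in degree $0$ and $f$ to the class of $f\cdot \mathrm{id}^{-1}$. Since $[\varepsilon]$ is exact, applying it degreewise induces an endofunctor $[\varepsilon]$ of $D(\mathrm{Pers}(\mathbb{R}^n))$. Put $\{s_\varepsilon^X\}=\iota_{K(\mathrm{Pers}(\mathbb{R}^n))}([s_\varepsilon^X])$. $X,Y$ are $\varepsilon$-interleaved in $D(\mathrm{Pers}(\mathbb{R}^n))$ if there are morphisms $f:X\to Y[\varepsilon]$, $g:Y\to X[\varepsilon]$ of $D(\mathrm{Pers}(\mathbb{R}^n))$ with $g[\varepsilon]\circ f=\{s_{2\varepsilon}^X\}$ and $f[\varepsilon]\circ g=\{s_{2\varepsilon}^Y\}$. *)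

theory Defs
  imports "HOL-Analysis.Analysis" "HOL-Algebra.AbelCoset" "HOL-Algebra.Module"
    "HOL-Library.FuncSet" "HOL-Library.Infinite_Typeclass"
begin

text \<open>
  Vector spaces over a field \<open>K\<close> are modules over \<open>K\<close> in the sense of HOL-Algebra, whose carrier is a
  subset of a fixed type \<open>'v\<close>; the type \<open>'v\<close> plays the role of the universe. The \<open>mult\<close> and \<open>one\<close>
  fields of a module record carry no information. The name \<open>module\<close> is qualified because
  \<^theory>\<open>HOL.Modules\<close> has a locale of the same name.

  Morphisms are extensional functions (\<open>undefined\<close> off the carrier), so that equality of morphisms is
  HOL equality; \<^const>\<open>compose\<close> is the corresponding composition.
\<close>

section \<open>Persistence modules\<close>

definition lin_hom :: "('k,'m) ring_scheme \<Rightarrow> ('k,'v) module \<Rightarrow> ('k,'w) module \<Rightarrow> ('v \<Rightarrow> 'w) set" where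
  "lin_hom K V W = {f \<in> carrier V \<rightarrow>\<^sub>E carrier W.
     (\<forall>x\<in>carrier V. \<forall>y\<in>carrier V. f (x \<oplus>\<^bsub>V\<^esub> y) = f x \<oplus>\<^bsub>W\<^esub> f y) \<and>
     (\<forall>a\<in>carrier K. \<forall>x\<in>carrier V. f (a \<odot>\<^bsub>V\<^esub> x) = a \<odot>\<^bsub>W\<^esub> f x)}"

text \<open>
  \<open>sp M t\<close> is \<open>M(t)\<close> and \<open>mp M s t\<close> is \<open>M(s \<le> t)\<close>, which is meaningful for \<open>s \<le> t\<close> only. The order on
  \<open>real ^ 'n\<close> is the componentwise one.
\<close>

record ('n, 'k, 'v) pmod =
  sp :: "real ^ 'n \<Rightarrow> ('k,'v) module"
  mp :: "real ^ 'n \<Rightarrow> real ^ 'n \<Rightarrow> 'v \<Rightarrow> 'v"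

definition persistence_module ::
    "('k,'m) ring_scheme \<Rightarrow> ('n::finite,'k,'v) pmod \<Rightarrow> bool" where
  "persistence_module K M \<longleftrightarrow>
     (\<forall>t. Module.module K (sp M t)) \<and>
     (\<forall>s t. s \<le> t \<longrightarrow> mp M s t \<in> lin_hom K (sp M s) (sp M t)) \<and>
     (\<forall>t. mp M t t = (\<lambda>x\<in>carrier (sp M t). x)) \<and>
     (\<forall>s t u. s \<le> t \<longrightarrow> t \<le> u \<longrightarrow>
        mp M s u = compose (carrier (sp M s)) (mp M t u) (mp M s t))"

type_synonym ('n, 'v, 'w) pmap = "real ^ 'n \<Rightarrow> 'v \<Rightarrow> 'w"

definition pers_hom ::
    "('k,'m) ring_scheme \<Rightarrow> ('n::finite,'k,'v) pmod \<Rightarrow> ('n,'k,'w) pmod \<Rightarrow> ('n,'v,'w) pmap set" where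
  "pers_hom K M N = {\<phi>.
     (\<forall>t. \<phi> t \<in> lin_hom K (sp M t) (sp N t)) \<and>
     (\<forall>s t. s \<le> t \<longrightarrow>
        compose (carrier (sp M s)) (\<phi> t) (mp M s t) = compose (carrier (sp M s)) (mp N s t) (\<phi> s))}"

definition pers_id :: "('n::finite,'k,'v) pmod \<Rightarrow> ('n,'v,'v) pmap" where
  "pers_id M = (\<lambda>t. \<lambda>x\<in>carrier (sp M t). x)"

text \<open>In \<open>pers_comp M \<psi> \<phi>\<close>, the module \<open>M\<close> is the source of \<open>\<phi>\<close>.\<close>

definition pers_comp ::
    "('n::finite,'k,'u) pmod \<Rightarrow> ('n,'v,'w) pmap \<Rightarrow> ('n,'u,'v) pmap \<Rightarrow> ('n,'u,'w) pmap" where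
  "pers_comp M \<psi> \<phi> = (\<lambda>t. compose (carrier (sp M t)) (\<psi> t) (\<phi> t))"

definition pers_zero :: "('n::finite,'k,'v) pmod \<Rightarrow> ('n,'k,'w) pmod \<Rightarrow> ('n,'v,'w) pmap" where
  "pers_zero M N = (\<lambda>t. \<lambda>x\<in>carrier (sp M t). \<zero>\<^bsub>sp N t\<^esub>)"

definition pers_iso ::
    "('k,'m) ring_scheme \<Rightarrow> ('n::finite,'k,'v) pmod \<Rightarrow> ('n,'k,'w) pmod \<Rightarrow> ('n,'v,'w) pmap \<Rightarrow> bool" where
  "pers_iso K M N \<phi> \<longleftrightarrow> \<phi> \<in> pers_hom K M N \<and>
     (\<exists>\<psi>\<in>pers_hom K N M. pers_comp M \<psi> \<phi> = pers_id M \<and> pers_comp N \<phi> \<psi> = pers_id N)"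

definition diag :: "real \<Rightarrow> real ^ 'n::finite" where
  "diag \<epsilon> = (\<chi> i. \<epsilon>)"

definition pers_shift :: "real \<Rightarrow> ('n::finite,'k,'v) pmod \<Rightarrow> ('n,'k,'v) pmod" where
  "pers_shift \<epsilon> M = \<lparr>sp = (\<lambda>s. sp M (s + diag \<epsilon>)), mp = (\<lambda>s t. mp M (s + diag \<epsilon>) (t + diag \<epsilon>))\<rparr>"

definition pers_shift_map :: "real \<Rightarrow> ('n::finite,'v,'w) pmap \<Rightarrow> ('n,'v,'w) pmap" where
  "pers_shift_map \<epsilon> \<phi> = (\<lambda>t. \<phi> (t + diag \<epsilon>))"

definition smoothing :: "real \<Rightarrow> ('n::finite,'k,'v) pmod \<Rightarrow> ('n,'v,'v) pmap" where
  "smoothing \<epsilon> M = (\<lambda>t. mp M t (t + diag \<epsilon>))"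

definition interleaved_Pers ::
    "('k,'m) ring_scheme \<Rightarrow> real \<Rightarrow> ('n::finite,'k,'v) pmod \<Rightarrow> ('n,'k,'v) pmod \<Rightarrow> bool" where
  "interleaved_Pers K \<epsilon> M N \<longleftrightarrow>
     (\<exists>f\<in>pers_hom K M (pers_shift \<epsilon> N). \<exists>g\<in>pers_hom K N (pers_shift \<epsilon> M).
        pers_comp M (pers_shift_map \<epsilon> g) f = smoothing (2 * \<epsilon>) M \<and>
        pers_comp N (pers_shift_map \<epsilon> f) g = smoothing (2 * \<epsilon>) N)"


section \<open>The homotopy category of cochain complexes\<close>

text \<open>\<open>df X i\<close> is the differential from degree \<open>i\<close> to degree \<open>i + 1\<close>.\<close>

record ('n, 'k, 'v) cpx =
  ob :: "int \<Rightarrow> ('n,'k,'v) pmod"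
  df :: "int \<Rightarrow> ('n,'v,'v) pmap"

type_synonym ('n, 'v) cmap = "int \<Rightarrow> ('n,'v,'v) pmap"

definition cochain_complex :: "('k,'m) ring_scheme \<Rightarrow> ('n::finite,'k,'v) cpx \<Rightarrow> bool" where
  "cochain_complex K X \<longleftrightarrow>
     (\<forall>i. persistence_module K (ob X i)) \<and>
     (\<forall>i. df X i \<in> pers_hom K (ob X i) (ob X (i + 1))) \<and>
     (\<forall>i. pers_comp (ob X i) (df X (i + 1)) (df X i) = pers_zero (ob X i) (ob X (i + 2)))"

definition chain_maps ::
    "('k,'m) ring_scheme \<Rightarrow> ('n::finite,'k,'v) cpx \<Rightarrow> ('n,'k,'v) cpx \<Rightarrow> ('n,'v) cmap set" where
  "chain_maps K X Y = {f.
     (\<forall>i. f i \<in> pers_hom K (ob X i) (ob Y i)) \<and>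
     (\<forall>i. pers_comp (ob X i) (f (i + 1)) (df X i) = pers_comp (ob X i) (df Y i) (f i))}"

definition chain_id :: "('n::finite,'k,'v) cpx \<Rightarrow> ('n,'v) cmap" where
  "chain_id X = (\<lambda>i. pers_id (ob X i))"

definition chain_comp ::
    "('n::finite,'k,'v) cpx \<Rightarrow> ('n,'v) cmap \<Rightarrow> ('n,'v) cmap \<Rightarrow> ('n,'v) cmap" where
  "chain_comp X g f = (\<lambda>i. pers_comp (ob X i) (g i) (f i))"

definition homotopy ::
    "('k,'m) ring_scheme \<Rightarrow> ('n::finite,'k,'v) cpx \<Rightarrow> ('n,'k,'v) cpx \<Rightarrow>
     (('n,'v) cmap \<times> ('n,'v) cmap) set" where
  "homotopy K X Y = {(f, g). f \<in> chain_maps K X Y \<and> g \<in> chain_maps K X Y \<and>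
     (\<exists>h. (\<forall>i. h i \<in> pers_hom K (ob X i) (ob Y (i - 1))) \<and>
          (\<forall>i t. \<forall>x\<in>carrier (sp (ob X i) t).
             f i t x \<ominus>\<^bsub>sp (ob Y i) t\<^esub> g i t x =
             df Y (i - 1) t (h i t x) \<oplus>\<^bsub>sp (ob Y i) t\<^esub> h (i + 1) t (df X i t x)))}"

definition K_hom ::
    "('k,'m) ring_scheme \<Rightarrow> ('n::finite,'k,'v) cpx \<Rightarrow> ('n,'k,'v) cpx \<Rightarrow> ('n,'v) cmap set set" where
  "K_hom K X Y = chain_maps K X Y // homotopy K X Y"

definition K_class ::
    "('k,'m) ring_scheme \<Rightarrow> ('n::finite,'k,'v) cpx \<Rightarrow> ('n,'k,'v) cpx \<Rightarrow> ('n,'v) cmap \<Rightarrow> ('n,'v) cmap set" where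
  "K_class K X Y f = homotopy K X Y `` {f}"

text \<open>
  Operations on classes are unions of the classes of the results over all representatives, the
  usual way of lifting an operation that respects an equivalence relation.
\<close>

definition K_id :: "('k,'m) ring_scheme \<Rightarrow> ('n::finite,'k,'v) cpx \<Rightarrow> ('n,'v) cmap set" where
  "K_id K X = K_class K X X (chain_id X)"

text \<open>Composition \<open>G \<circ> F\<close> for \<open>F : X \<rightarrow> Y\<close> and \<open>G : Y \<rightarrow> Z\<close>; only \<open>X\<close> and \<open>Z\<close> are needed.\<close>

definition K_comp ::
    "('k,'m) ring_scheme \<Rightarrow> ('n::finite,'k,'v) cpx \<Rightarrow> ('n,'k,'v) cpx \<Rightarrow>
     ('n,'v) cmap set \<Rightarrow> ('n,'v) cmap set \<Rightarrow> ('n,'v) cmap set" where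
  "K_comp K X Z G F = (\<Union>g\<in>G. \<Union>f\<in>F. K_class K X Z (chain_comp X g f))"

definition cpx_shift :: "real \<Rightarrow> ('n::finite,'k,'v) cpx \<Rightarrow> ('n,'k,'v) cpx" where
  "cpx_shift \<epsilon> X = \<lparr>ob = (\<lambda>i. pers_shift \<epsilon> (ob X i)), df = (\<lambda>i. pers_shift_map \<epsilon> (df X i))\<rparr>"

definition chain_shift :: "real \<Rightarrow> ('n::finite,'v) cmap \<Rightarrow> ('n,'v) cmap" where
  "chain_shift \<epsilon> f = (\<lambda>i. pers_shift_map \<epsilon> (f i))"

definition K_shift ::
    "('k,'m) ring_scheme \<Rightarrow> real \<Rightarrow> ('n::finite,'k,'v) cpx \<Rightarrow> ('n,'k,'v) cpx \<Rightarrow>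
     ('n,'v) cmap set \<Rightarrow> ('n,'v) cmap set" where
  "K_shift K \<epsilon> X Y F = (\<Union>f\<in>F. K_class K (cpx_shift \<epsilon> X) (cpx_shift \<epsilon> Y) (chain_shift \<epsilon> f))"

definition K_smoothing ::
    "('k,'m) ring_scheme \<Rightarrow> real \<Rightarrow> ('n::finite,'k,'v) cpx \<Rightarrow> ('n,'v) cmap set" where
  "K_smoothing K \<epsilon> X = K_class K X (cpx_shift \<epsilon> X) (\<lambda>i. smoothing \<epsilon> (ob X i))"

definition interleaved_K ::
    "('k,'m) ring_scheme \<Rightarrow> real \<Rightarrow> ('n::finite,'k,'v) cpx \<Rightarrow> ('n,'k,'v) cpx \<Rightarrow> bool" where
  "interleaved_K K \<epsilon> X Y \<longleftrightarrow>
     (\<exists>F\<in>K_hom K X (cpx_shift \<epsilon> Y). \<exists>G\<in>K_hom K Y (cpx_shift \<epsilon> X).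
        K_comp K X (cpx_shift \<epsilon> (cpx_shift \<epsilon> X)) (K_shift K \<epsilon> Y (cpx_shift \<epsilon> X) G) F
          = K_smoothing K (2 * \<epsilon>) X \<and>
        K_comp K Y (cpx_shift \<epsilon> (cpx_shift \<epsilon> Y)) (K_shift K \<epsilon> X (cpx_shift \<epsilon> Y) F) G
          = K_smoothing K (2 * \<epsilon>) Y)"


section \<open>Cohomology and quasi-isomorphisms\<close>

definition cocycles :: "('n::finite,'k,'v) cpx \<Rightarrow> int \<Rightarrow> real ^ 'n \<Rightarrow> 'v set" where
  "cocycles X i t = {x \<in> carrier (sp (ob X i) t). df X i t x = \<zero>\<^bsub>sp (ob X (i + 1)) t\<^esub>}"

definition coboundaries :: "('n::finite,'k,'v) cpx \<Rightarrow> int \<Rightarrow> real ^ 'n \<Rightarrow> 'v set" where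
  "coboundaries X i t = df X (i - 1) t ` carrier (sp (ob X (i - 1)) t)"

text \<open>
  The quotient vector space of cosets \<open>B + z\<close> with \<open>z \<in> Z\<close>, for subspaces \<open>B \<subseteq> Z\<close> of \<open>V\<close>.
  HOL-Algebra has quotients of the additive group only.
\<close>

definition subquotient :: "('k,'v) module \<Rightarrow> 'v set \<Rightarrow> 'v set \<Rightarrow> ('k, 'v set) module" where
  "subquotient V Z B =
     \<lparr>carrier = {B +>\<^bsub>V\<^esub> z | z. z \<in> Z}, mult = undefined, one = undefined,
      zero = B, add = (<+>\<^bsub>V\<^esub>), smult = (\<lambda>a C. \<Union>x\<in>C. B +>\<^bsub>V\<^esub> (a \<odot>\<^bsub>V\<^esub> x))\<rparr>"

definition cohom_space :: "('n::finite,'k,'v) cpx \<Rightarrow> int \<Rightarrow> real ^ 'n \<Rightarrow> ('k, 'v set) module" where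
  "cohom_space X i t = subquotient (sp (ob X i) t) (cocycles X i t) (coboundaries X i t)"

definition cohomology :: "('n::finite,'k,'v) cpx \<Rightarrow> int \<Rightarrow> ('n,'k,'v set) pmod" where
  "cohomology X i =
     \<lparr>sp = cohom_space X i,
      mp = (\<lambda>s t. \<lambda>C\<in>carrier (cohom_space X i s).
              \<Union>x\<in>C. coboundaries X i t +>\<^bsub>sp (ob X i) t\<^esub> mp (ob X i) s t x)\<rparr>"

definition cohom_map ::
    "('n::finite,'k,'v) cpx \<Rightarrow> ('n,'k,'v) cpx \<Rightarrow> ('n,'v) cmap \<Rightarrow> int \<Rightarrow> ('n,'v set,'v set) pmap" where
  "cohom_map X Y f i =
     (\<lambda>t. \<lambda>C\<in>carrier (cohom_space X i t).
        \<Union>x\<in>C. coboundaries Y i t +>\<^bsub>sp (ob Y i) t\<^esub> f i t x)"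

definition quasi_iso ::
    "('k,'m) ring_scheme \<Rightarrow> ('n::finite,'k,'v) cpx \<Rightarrow> ('n,'k,'v) cpx \<Rightarrow> ('n,'v) cmap \<Rightarrow> bool" where
  "quasi_iso K X Y f \<longleftrightarrow> f \<in> chain_maps K X Y \<and>
     (\<forall>i. pers_iso K (cohomology X i) (cohomology Y i) (cohom_map X Y f i))"

text \<open>Cohomology is homotopy invariant, so it does not matter which representative is tested.\<close>

definition K_quasi_isos ::
    "('k,'m) ring_scheme \<Rightarrow> ('n::finite,'k,'v) cpx \<Rightarrow> ('n,'k,'v) cpx \<Rightarrow> ('n,'v) cmap set set" where
  "K_quasi_isos K X Y = {F \<in> K_hom K X Y. \<exists>f\<in>F. quasi_iso K X Y f}"


section \<open>The derived category\<close>

text \<open>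
  The triple \<open>(Z, S, F)\<close> stands for the roof \<open>F \<cdot> S\<^sup>-\<^sup>1\<close>, that is \<open>X \<leftarrow> Z \<rightarrow> Y\<close> with \<open>S : Z \<rightarrow> X\<close> a
  quasi-isomorphism and \<open>F : Z \<rightarrow> Y\<close>, both morphisms of the homotopy category.
\<close>

type_synonym ('n, 'k, 'v) roof = "('n,'k,'v) cpx \<times> ('n,'v) cmap set \<times> ('n,'v) cmap set"

definition roofs ::
    "('k,'m) ring_scheme \<Rightarrow> ('n::finite,'k,'v) cpx \<Rightarrow> ('n,'k,'v) cpx \<Rightarrow> ('n,'k,'v) roof set" where
  "roofs K X Y = {(Z, S, F). cochain_complex K Z \<and> S \<in> K_quasi_isos K Z X \<and> F \<in> K_hom K Z Y}"

definition roof_equiv ::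
    "('k,'m) ring_scheme \<Rightarrow> ('n::finite,'k,'v) cpx \<Rightarrow> ('n,'k,'v) cpx \<Rightarrow>
     (('n,'k,'v) roof \<times> ('n,'k,'v) roof) set" where
  "roof_equiv K X Y = {((Z, S, F), (Z', S', F')).
     (Z, S, F) \<in> roofs K X Y \<and> (Z', S', F') \<in> roofs K X Y \<and>
     (\<exists>W. cochain_complex K W \<and> (\<exists>U\<in>K_hom K W Z. \<exists>U'\<in>K_hom K W Z'.
        K_comp K W X S U = K_comp K W X S' U' \<and>
        K_comp K W X S U \<in> K_quasi_isos K W X \<and>
        K_comp K W Y F U = K_comp K W Y F' U'))}"

definition D_hom ::
    "('k,'m) ring_scheme \<Rightarrow> ('n::finite,'k,'v) cpx \<Rightarrow> ('n,'k,'v) cpx \<Rightarrow> ('n,'k,'v) roof set set" where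
  "D_hom K X Y = roofs K X Y // roof_equiv K X Y"

definition D_class ::
    "('k,'m) ring_scheme \<Rightarrow> ('n::finite,'k,'v) cpx \<Rightarrow> ('n,'k,'v) cpx \<Rightarrow>
     ('n,'k,'v) roof \<Rightarrow> ('n,'k,'v) roof set" where
  "D_class K X Y \<rho> = roof_equiv K X Y `` {\<rho>}"

text \<open>
  The composites \<open>(G \<circ> V) \<cdot> (S \<circ> U)\<^sup>-\<^sup>1\<close> of the roofs \<open>F \<cdot> S\<^sup>-\<^sup>1 : X \<rightarrow> Y\<close> and \<open>G \<cdot> T\<^sup>-\<^sup>1 : Y \<rightarrow> E\<close>, with one
  composite for each commutative square \<open>F \<circ> U = T \<circ> V\<close> in which \<open>U\<close> is a quasi-isomorphism. All of
  them are equivalent.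
\<close>

definition roof_comps ::
    "('k,'m) ring_scheme \<Rightarrow> ('n::finite,'k,'v) cpx \<Rightarrow> ('n,'k,'v) cpx \<Rightarrow> ('n,'k,'v) cpx \<Rightarrow>
     ('n,'k,'v) roof \<Rightarrow> ('n,'k,'v) roof \<Rightarrow> ('n,'k,'v) roof set" where
  "roof_comps K X Y E = (\<lambda>(W, T, G) (Z, S, F).
     {(P, K_comp K P X S U, K_comp K P E G V) | P U V.
        cochain_complex K P \<and> U \<in> K_quasi_isos K P Z \<and> V \<in> K_hom K P W \<and>
        K_comp K P Y F U = K_comp K P Y T V})"

text \<open>Composition \<open>\<B> \<circ> \<A>\<close> for \<open>\<A> : X \<rightarrow> Y\<close> and \<open>\<B> : Y \<rightarrow> E\<close>.\<close>

definition D_comp ::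
    "('k,'m) ring_scheme \<Rightarrow> ('n::finite,'k,'v) cpx \<Rightarrow> ('n,'k,'v) cpx \<Rightarrow> ('n,'k,'v) cpx \<Rightarrow>
     ('n,'k,'v) roof set \<Rightarrow> ('n,'k,'v) roof set \<Rightarrow> ('n,'k,'v) roof set" where
  "D_comp K X Y E \<B> \<A> =
     (\<Union>\<sigma>\<in>\<B>. \<Union>\<rho>\<in>\<A>. \<Union>\<tau>\<in>roof_comps K X Y E \<sigma> \<rho>. D_class K X E \<tau>)"

definition roof_shift ::
    "('k,'m) ring_scheme \<Rightarrow> real \<Rightarrow> ('n::finite,'k,'v) cpx \<Rightarrow> ('n,'k,'v) cpx \<Rightarrow>
     ('n,'k,'v) roof \<Rightarrow> ('n,'k,'v) roof" where
  "roof_shift K \<epsilon> X Y = (\<lambda>(Z, S, F). (cpx_shift \<epsilon> Z, K_shift K \<epsilon> Z X S, K_shift K \<epsilon> Z Y F))"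

definition D_shift ::
    "('k,'m) ring_scheme \<Rightarrow> real \<Rightarrow> ('n::finite,'k,'v) cpx \<Rightarrow> ('n,'k,'v) cpx \<Rightarrow>
     ('n,'k,'v) roof set \<Rightarrow> ('n,'k,'v) roof set" where
  "D_shift K \<epsilon> X Y \<A> =
     (\<Union>\<rho>\<in>\<A>. D_class K (cpx_shift \<epsilon> X) (cpx_shift \<epsilon> Y) (roof_shift K \<epsilon> X Y \<rho>))"

text \<open>The functor from the homotopy category on morphisms \<open>X \<rightarrow> Y\<close>; on objects it is the identity.\<close>

definition iota_K ::
    "('k,'m) ring_scheme \<Rightarrow> ('n::finite,'k,'v) cpx \<Rightarrow> ('n,'k,'v) cpx \<Rightarrow>
     ('n,'v) cmap set \<Rightarrow> ('n,'k,'v) roof set" where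
  "iota_K K X Y F = D_class K X Y (X, K_id K X, F)"

definition D_smoothing ::
    "('k,'m) ring_scheme \<Rightarrow> real \<Rightarrow> ('n::finite,'k,'v) cpx \<Rightarrow> ('n,'k,'v) roof set" where
  "D_smoothing K \<epsilon> X = iota_K K X (cpx_shift \<epsilon> X) (K_smoothing K \<epsilon> X)"

definition interleaved_D ::
    "('k,'m) ring_scheme \<Rightarrow> real \<Rightarrow> ('n::finite,'k,'v) cpx \<Rightarrow> ('n,'k,'v) cpx \<Rightarrow> bool" where
  "interleaved_D K \<epsilon> X Y \<longleftrightarrow>
     (\<exists>\<A>\<in>D_hom K X (cpx_shift \<epsilon> Y). \<exists>\<B>\<in>D_hom K Y (cpx_shift \<epsilon> X).
        D_comp K X (cpx_shift \<epsilon> Y) (cpx_shift \<epsilon> (cpx_shift \<epsilon> X))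
            (D_shift K \<epsilon> Y (cpx_shift \<epsilon> X) \<B>) \<A>
          = D_smoothing K (2 * \<epsilon>) X \<and>
        D_comp K Y (cpx_shift \<epsilon> X) (cpx_shift \<epsilon> (cpx_shift \<epsilon> Y))
            (D_shift K \<epsilon> X (cpx_shift \<epsilon> Y) \<A>) \<B>
          = D_smoothing K (2 * \<epsilon>) Y)"

definition zero_pmod :: "('n::finite,'k,'v) pmod" where
  "zero_pmod =
     \<lparr>sp = (\<lambda>_. \<lparr>carrier = {undefined}, mult = undefined, one = undefined, zero = undefined,
                 add = (\<lambda>_ _. undefined), smult = (\<lambda>_ _. undefined)\<rparr>),
      mp = (\<lambda>_ _. \<lambda>x\<in>{undefined}. x)\<rparr>"

text \<open>
  The functor from persistence modules to the derived category on objects: the complex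
  concentrated in degree 0.
\<close>

definition iota_Pers :: "('n::finite,'k,'v) pmod \<Rightarrow> ('n,'k,'v) cpx" where
  "iota_Pers M =
     (let X = (\<lambda>i. if i = 0 then M else zero_pmod)
      in \<lparr>ob = X, df = (\<lambda>i. pers_zero (X i) (X (i + 1)))\<rparr>)"

end

theory Submission
  imports Defs
begin

text \<open>
  The functor from the homotopy category to the derived category commutes with the shifts and carries
  \<open>[s]\<close> to \<open>{s}\<close> by definition, so (1) amounts to its compatibility with composition. A morphism of the
  derived category is here a class of roofs, and composites range over all representatives and all
  commutative squares. That they agree rests on the Ore condition for quasi-isomorphisms, which is
  obtained from the homotopy pullback \<open>A\<^sup>i \<oplus> B\<^sup>i \<oplus> C\<^sup>i\<^sup>-\<^sup>1\<close> of a chain map \<open>f : A \<rightarrow> C\<close> and a quasi-isomorphism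
  \<open>s : B \<rightarrow> C\<close>. A roof \<open>(Z, S, G)\<close> lies in the class of \<open>F \<cdot> id\<^sup>-\<^sup>1\<close> iff \<open>G\<close> and \<open>F \<circ> S\<close> become equal after
  precomposition with some quasi-isomorphism.

  For (2), an interleaving of modules gives one in the homotopy category of the complexes
  concentrated in degree 0, and (1) applies.
\<close>

section \<open>Persistence modules and complexes elementwise\<close>

text \<open>Composition and shift in the derived category are unions over all representatives, so
  such a union is a single class only once all its terms have been shown to agree. This is done for
  classes coming from the homotopy category, where membership of a roof is an equation that holds
  after precomposition with a quasi-isomorphism. Equations of this kind survive composition and
  shifts, and two of them can be combined over a common refinement of their sources, which is what
  the Ore condition supplies. The degreewise pullback of f and s would not do: its projection to A
  need not be a quasi-isomorphism when s is not surjective. The extra summand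
  \<open>C\<^sup>i\<^sup>-\<^sup>1\<close> stores a homotopy between the two images in C, so that
  the square commutes in the homotopy category for every quasi-isomorphism s. Roofs range over
  complexes on the same type \<open>'v\<close> as X and Y, so the new apex has to be encoded inside
  \<open>'v\<close>; this is where the class \<open>infinite\<close> comes from.\<close>

lemma pmod_module: "persistence_module K M \<Longrightarrow> Module.module K (sp M t)"
  unfolding persistence_module_def by blast

lemmas pmod_group = Module.module.axioms(2)[OF pmod_module]

lemma lin_hom_zero:
  assumes "f \<in> lin_hom K V W" "abelian_group V" "abelian_group W"
  shows "f \<zero>\<^bsub>V\<^esub> = \<zero>\<^bsub>W\<^esub>"
proof -
  interpret V: abelian_group V by fact
  interpret W: abelian_group W by fact
  have "f \<zero>\<^bsub>V\<^esub> \<in> carrier W"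
    using assms(1) unfolding lin_hom_def by auto
  moreover have "f (\<zero>\<^bsub>V\<^esub> \<oplus>\<^bsub>V\<^esub> \<zero>\<^bsub>V\<^esub>) = f \<zero>\<^bsub>V\<^esub> \<oplus>\<^bsub>W\<^esub> f \<zero>\<^bsub>V\<^esub>"
    using assms(1) V.zero_closed unfolding lin_hom_def by blast
  ultimately show ?thesis by (metis V.r_zero V.zero_closed W.add.l_cancel_one')
qed

lemma lin_hom_a_inv:
  assumes "f \<in> lin_hom K V W" "abelian_group V" "abelian_group W" "x \<in> carrier V"
  shows "f (\<ominus>\<^bsub>V\<^esub> x) = \<ominus>\<^bsub>W\<^esub> f x"
proof -
  interpret V: abelian_group V by fact
  interpret W: abelian_group W by fact
  have "f (\<ominus>\<^bsub>V\<^esub> x \<oplus>\<^bsub>V\<^esub> x) = f (\<ominus>\<^bsub>V\<^esub> x) \<oplus>\<^bsub>W\<^esub> f x" "f (\<ominus>\<^bsub>V\<^esub> x) \<in> carrier W" "f x \<in> carrier W"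
    using assms(1,4) unfolding lin_hom_def by auto
  then show ?thesis
    by (metis V.l_neg W.minus_equality assms lin_hom_zero)
qed

text \<open>Elementwise form of linearity and naturality, so that later proofs compare values
  instead of restricted composites.\<close>

lemma pers_homI:
  assumes "\<And>t x. x \<in> carrier (sp M t) \<Longrightarrow> \<phi> t x \<in> carrier (sp N t)"
    and "\<And>t x. x \<notin> carrier (sp M t) \<Longrightarrow> \<phi> t x = undefined"
    and "\<And>t x y. x \<in> carrier (sp M t) \<Longrightarrow> y \<in> carrier (sp M t) \<Longrightarrow>
           \<phi> t (x \<oplus>\<^bsub>sp M t\<^esub> y) = \<phi> t x \<oplus>\<^bsub>sp N t\<^esub> \<phi> t y"
    and "\<And>t a x. a \<in> carrier K \<Longrightarrow> x \<in> carrier (sp M t) \<Longrightarrow>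
           \<phi> t (a \<odot>\<^bsub>sp M t\<^esub> x) = a \<odot>\<^bsub>sp N t\<^esub> \<phi> t x"
    and "\<And>s t x. s \<le> t \<Longrightarrow> x \<in> carrier (sp M s) \<Longrightarrow> \<phi> t (mp M s t x) = mp N s t (\<phi> s x)"
  shows "\<phi> \<in> pers_hom K M N"
  unfolding pers_hom_def lin_hom_def using assms
  by (auto simp: compose_def fun_eq_iff PiE_def extensional_def)

lemma pers_homD:
  assumes "\<phi> \<in> pers_hom K M N"
  shows "\<And>t x. x \<in> carrier (sp M t) \<Longrightarrow> \<phi> t x \<in> carrier (sp N t)"
    and "\<And>t x. x \<notin> carrier (sp M t) \<Longrightarrow> \<phi> t x = undefined"
    and "\<And>t x y. x \<in> carrier (sp M t) \<Longrightarrow> y \<in> carrier (sp M t) \<Longrightarrow>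
           \<phi> t (x \<oplus>\<^bsub>sp M t\<^esub> y) = \<phi> t x \<oplus>\<^bsub>sp N t\<^esub> \<phi> t y"
    and "\<And>t a x. a \<in> carrier K \<Longrightarrow> x \<in> carrier (sp M t) \<Longrightarrow>
           \<phi> t (a \<odot>\<^bsub>sp M t\<^esub> x) = a \<odot>\<^bsub>sp N t\<^esub> \<phi> t x"
    and "\<And>s t x. s \<le> t \<Longrightarrow> x \<in> carrier (sp M s) \<Longrightarrow> \<phi> t (mp M s t x) = mp N s t (\<phi> s x)"
proof -
  have l: "\<phi> t \<in> lin_hom K (sp M t) (sp N t)" for t
    using assms unfolding pers_hom_def by auto
  show "\<phi> t x \<in> carrier (sp N t)" if "x \<in> carrier (sp M t)" for t x
    using l[of t] that unfolding lin_hom_def by auto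
  show "\<phi> t x = undefined" if "x \<notin> carrier (sp M t)" for t x
    using l[of t] that unfolding lin_hom_def by (auto simp: PiE_def extensional_def)
  show "\<phi> t (x \<oplus>\<^bsub>sp M t\<^esub> y) = \<phi> t x \<oplus>\<^bsub>sp N t\<^esub> \<phi> t y"
    if "x \<in> carrier (sp M t)" "y \<in> carrier (sp M t)" for t x y
    using l[of t] that unfolding lin_hom_def by auto
  show "\<phi> t (a \<odot>\<^bsub>sp M t\<^esub> x) = a \<odot>\<^bsub>sp N t\<^esub> \<phi> t x"
    if "a \<in> carrier K" "x \<in> carrier (sp M t)" for t a x
    using l[of t] that unfolding lin_hom_def by auto
  show "\<phi> t (mp M s t x) = mp N s t (\<phi> s x)" if "s \<le> t" "x \<in> carrier (sp M s)" for s t x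
  proof -
    have "compose (carrier (sp M s)) (\<phi> t) (mp M s t) = compose (carrier (sp M s)) (mp N s t) (\<phi> s)"
      using assms that(1) unfolding pers_hom_def by auto
    from fun_cong[OF this, of x] show ?thesis using that by (simp add: compose_def)
  qed
qed

lemma pers_hom_lin: "\<phi> \<in> pers_hom K M N \<Longrightarrow> \<phi> t \<in> lin_hom K (sp M t) (sp N t)"
  unfolding pers_hom_def by auto

lemma pers_hom_zero:
  assumes "\<phi> \<in> pers_hom K M N" "persistence_module K M" "persistence_module K N"
  shows "\<phi> t \<zero>\<^bsub>sp M t\<^esub> = \<zero>\<^bsub>sp N t\<^esub>"
  by (rule lin_hom_zero[OF pers_hom_lin[OF assms(1)] pmod_group[OF assms(2)] pmod_group[OF assms(3)]])

lemma pers_hom_a_inv: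
  assumes "\<phi> \<in> pers_hom K M N" "persistence_module K M" "persistence_module K N"
    and "x \<in> carrier (sp M t)"
  shows "\<phi> t (\<ominus>\<^bsub>sp M t\<^esub> x) = \<ominus>\<^bsub>sp N t\<^esub> \<phi> t x"
  by (rule lin_hom_a_inv[OF pers_hom_lin[OF assms(1)] pmod_group[OF assms(2)] pmod_group[OF assms(3)] assms(4)])

lemma pers_hom_minus:
  assumes "\<phi> \<in> pers_hom K M N" "persistence_module K M" "persistence_module K N"
    and "x \<in> carrier (sp M t)" "y \<in> carrier (sp M t)"
  shows "\<phi> t (x \<ominus>\<^bsub>sp M t\<^esub> y) = \<phi> t x \<ominus>\<^bsub>sp N t\<^esub> \<phi> t y"
  using assms(4,5) pers_homD(3)[OF assms(1)] pers_hom_a_inv[OF assms(1-3)]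
  by (simp add: a_minus_def abelian_group.a_inv_closed[OF pmod_group[OF assms(2)]])

lemma pmod_mp:
  assumes "persistence_module K M" "s \<le> t"
  shows "\<And>x. x \<in> carrier (sp M s) \<Longrightarrow> mp M s t x \<in> carrier (sp M t)"
    and "\<And>x. x \<notin> carrier (sp M s) \<Longrightarrow> mp M s t x = undefined"
    and "\<And>x y. x \<in> carrier (sp M s) \<Longrightarrow> y \<in> carrier (sp M s) \<Longrightarrow>
           mp M s t (x \<oplus>\<^bsub>sp M s\<^esub> y) = mp M s t x \<oplus>\<^bsub>sp M t\<^esub> mp M s t y"
    and "\<And>a x. a \<in> carrier K \<Longrightarrow> x \<in> carrier (sp M s) \<Longrightarrow>
           mp M s t (a \<odot>\<^bsub>sp M s\<^esub> x) = a \<odot>\<^bsub>sp M t\<^esub> mp M s t x"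
    and "mp M s t \<zero>\<^bsub>sp M s\<^esub> = \<zero>\<^bsub>sp M t\<^esub>"
    and "\<And>x. x \<in> carrier (sp M s) \<Longrightarrow> mp M s t (\<ominus>\<^bsub>sp M s\<^esub> x) = \<ominus>\<^bsub>sp M t\<^esub> mp M s t x"
proof -
  have l: "mp M s t \<in> lin_hom K (sp M s) (sp M t)"
    using assms unfolding persistence_module_def by blast
  show "mp M s t x \<in> carrier (sp M t)" if "x \<in> carrier (sp M s)" for x
    using l that unfolding lin_hom_def by auto
  show "mp M s t x = undefined" if "x \<notin> carrier (sp M s)" for x
    using l that unfolding lin_hom_def by (auto simp: PiE_def extensional_def)
  show "mp M s t (x \<oplus>\<^bsub>sp M s\<^esub> y) = mp M s t x \<oplus>\<^bsub>sp M t\<^esub> mp M s t y"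
    if "x \<in> carrier (sp M s)" "y \<in> carrier (sp M s)" for x y
    using l that unfolding lin_hom_def by auto
  show "mp M s t (a \<odot>\<^bsub>sp M s\<^esub> x) = a \<odot>\<^bsub>sp M t\<^esub> mp M s t x"
    if "a \<in> carrier K" "x \<in> carrier (sp M s)" for a x
    using l that unfolding lin_hom_def by auto
  show "mp M s t \<zero>\<^bsub>sp M s\<^esub> = \<zero>\<^bsub>sp M t\<^esub>"
    by (rule lin_hom_zero[OF l pmod_group[OF assms(1)] pmod_group[OF assms(1)]])
  show "mp M s t (\<ominus>\<^bsub>sp M s\<^esub> x) = \<ominus>\<^bsub>sp M t\<^esub> mp M s t x"
    if "x \<in> carrier (sp M s)" for x
    by (rule lin_hom_a_inv[OF l pmod_group[OF assms(1)] pmod_group[OF assms(1)] that])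
qed

lemma pmod_mp_trans:
  assumes "persistence_module K M" "s \<le> t" "t \<le> u" "x \<in> carrier (sp M s)"
  shows "mp M t u (mp M s t x) = mp M s u x"
proof -
  have "mp M s u = compose (carrier (sp M s)) (mp M t u) (mp M s t)"
    using assms unfolding persistence_module_def by blast
  then show ?thesis using assms by (simp add: compose_def)
qed

lemma pmod_mp_refl:
  "persistence_module K M \<Longrightarrow> mp M t t = (\<lambda>x\<in>carrier (sp M t). x)"
  unfolding persistence_module_def by blast

lemma persistence_moduleI:
  fixes M :: "('n::finite,'k,'v) pmod"
  assumes "\<And>t. Module.module K (sp M t)"
    and "\<And>s t x. s \<le> t \<Longrightarrow> x \<in> carrier (sp M s) \<Longrightarrow> mp M s t x \<in> carrier (sp M t)"
    and "\<And>s t x. s \<le> t \<Longrightarrow> x \<notin> carrier (sp M s) \<Longrightarrow> mp M s t x = undefined"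
    and "\<And>s t x y. s \<le> t \<Longrightarrow> x \<in> carrier (sp M s) \<Longrightarrow> y \<in> carrier (sp M s) \<Longrightarrow>
           mp M s t (x \<oplus>\<^bsub>sp M s\<^esub> y) = mp M s t x \<oplus>\<^bsub>sp M t\<^esub> mp M s t y"
    and "\<And>s t a x. s \<le> t \<Longrightarrow> a \<in> carrier K \<Longrightarrow> x \<in> carrier (sp M s) \<Longrightarrow>
           mp M s t (a \<odot>\<^bsub>sp M s\<^esub> x) = a \<odot>\<^bsub>sp M t\<^esub> mp M s t x"
    and "\<And>t x. x \<in> carrier (sp M t) \<Longrightarrow> mp M t t x = x"
    and "\<And>s t u x. s \<le> t \<Longrightarrow> t \<le> u \<Longrightarrow> x \<in> carrier (sp M s) \<Longrightarrow>
           mp M t u (mp M s t x) = mp M s u x"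
  shows "persistence_module K M"
  unfolding persistence_module_def
proof (intro conjI allI impI)
  fix s t u :: "real^'n" assume "s \<le> t" "t \<le> u"
  then show "mp M s u = compose (carrier (sp M s)) (mp M t u) (mp M s t)"
    using assms(3)[of s u] assms(7)[of s t u] by (auto simp: compose_def fun_eq_iff)
next
  fix s t :: "real^'n" assume "s \<le> t"
  then show "mp M s t \<in> lin_hom K (sp M s) (sp M t)"
    unfolding lin_hom_def using assms by (auto simp: PiE_def extensional_def)
next
  fix t :: "real^'n"
  show "mp M t t = (\<lambda>x\<in>carrier (sp M t). x)" using assms(3)[of t t] assms(6) by (auto simp: fun_eq_iff)
qed (use assms in auto)

section \<open>Cochain complexes and chain maps\<close>

lemma cpx_pmod: "cochain_complex K X \<Longrightarrow> persistence_module K (ob X i)"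
  and cpx_df: "cochain_complex K X \<Longrightarrow> df X i \<in> pers_hom K (ob X i) (ob X (i + 1))"
  unfolding cochain_complex_def by auto

lemmas cpx_group = pmod_group[OF cpx_pmod]

text \<open>Coboundaries and homotopies involve the differential that arrives in degree
  \<open>i\<close>; the general fact would place its target in degree
  \<open>i - 1 + 1\<close>.\<close>

lemma cpx_df_pred:
  "cochain_complex K X \<Longrightarrow> df X (i - 1) \<in> pers_hom K (ob X (i - 1)) (ob X i)"
  using cpx_df[of K X "i - 1"] by simp

lemma cpx_dd:
  assumes "cochain_complex K X" "x \<in> carrier (sp (ob X i) t)"
  shows "df X (i + 1) t (df X i t x) = \<zero>\<^bsub>sp (ob X (i + 2)) t\<^esub>"
proof -
  have "pers_comp (ob X i) (df X (i + 1)) (df X i) t x = pers_zero (ob X i) (ob X (i + 2)) t x"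
    using assms unfolding cochain_complex_def by auto
  then show ?thesis using assms by (simp add: pers_comp_def compose_def pers_zero_def)
qed

lemma cpx_dd_pred:
  assumes "cochain_complex K X" "x \<in> carrier (sp (ob X (i - 1)) t)"
  shows "df X i t (df X (i - 1) t x) = \<zero>\<^bsub>sp (ob X (i + 1)) t\<^esub>"
  using cpx_dd[of K X x "i - 1" t] assms by (simp add: add.commute)

lemma cochain_complexI:
  assumes "\<And>i. persistence_module K (ob X i)"
    and "\<And>i. df X i \<in> pers_hom K (ob X i) (ob X (i + 1))"
    and "\<And>i t x. x \<in> carrier (sp (ob X i) t) \<Longrightarrow>
           df X (i + 1) t (df X i t x) = \<zero>\<^bsub>sp (ob X (i + 2)) t\<^esub>"
  shows "cochain_complex K X"
  unfolding cochain_complex_def using assms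
  by (auto simp: pers_comp_def pers_zero_def compose_def fun_eq_iff)

lemma chain_maps_hom: "f \<in> chain_maps K X Y \<Longrightarrow> f i \<in> pers_hom K (ob X i) (ob Y i)"
  unfolding chain_maps_def by auto

lemma chain_maps_df:
  assumes "f \<in> chain_maps K X Y" "x \<in> carrier (sp (ob X i) t)"
  shows "f (i + 1) t (df X i t x) = df Y i t (f i t x)"
proof -
  have "pers_comp (ob X i) (f (i + 1)) (df X i) t x = pers_comp (ob X i) (df Y i) (f i) t x"
    using assms(1) unfolding chain_maps_def by auto
  then show ?thesis using assms by (simp add: pers_comp_def compose_def)
qed

lemma chain_maps_df_pred:
  assumes "f \<in> chain_maps K X Y" "x \<in> carrier (sp (ob X (i - 1)) t)"
  shows "f i t (df X (i - 1) t x) = df Y (i - 1) t (f (i - 1) t x)"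
  using chain_maps_df[OF assms] by simp

lemma chain_mapsI:
  assumes "\<And>i. f i \<in> pers_hom K (ob X i) (ob Y i)"
    and "\<And>i t x. x \<in> carrier (sp (ob X i) t) \<Longrightarrow> f (i + 1) t (df X i t x) = df Y i t (f i t x)"
  shows "f \<in> chain_maps K X Y"
proof -
  have "pers_comp (ob X i) (f (i + 1)) (df X i) = pers_comp (ob X i) (df Y i) (f i)" for i
    unfolding pers_comp_def compose_def by (rule ext, rule restrict_ext) (rule assms(2))
  then show ?thesis unfolding chain_maps_def using assms(1) by blast
qed

lemmas chain_map_closed = pers_homD(1)[OF chain_maps_hom]
lemmas df_closed = pers_homD(1)[OF cpx_df]
lemmas df_closed_pred = pers_homD(1)[OF cpx_df_pred]

lemma chain_map_minus:
  assumes "f \<in> chain_maps K X Y" "cochain_complex K X" "cochain_complex K Y"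
    and "x \<in> carrier (sp (ob X i) t)" "y \<in> carrier (sp (ob X i) t)"
  shows "f i t (x \<ominus>\<^bsub>sp (ob X i) t\<^esub> y) = f i t x \<ominus>\<^bsub>sp (ob Y i) t\<^esub> f i t y"
  by (rule pers_hom_minus[OF chain_maps_hom[OF assms(1)] cpx_pmod[OF assms(2)] cpx_pmod[OF assms(3)]
        assms(4,5)])

lemma pmod_add_closed:
  "persistence_module K M \<Longrightarrow> x \<in> carrier (sp M t) \<Longrightarrow> y \<in> carrier (sp M t) \<Longrightarrow>
    x \<oplus>\<^bsub>sp M t\<^esub> y \<in> carrier (sp M t)"
  by (rule abelian_monoid.a_closed[OF abelian_group.axioms(1)[OF pmod_group]])

lemmas pmod_smult_closed = Module.module.smult_closed[OF pmod_module]
lemmas pmod_zero_closed = abelian_monoid.zero_closed[OF abelian_group.axioms(1)[OF pmod_group]]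

section \<open>Identities, composites, zero, negatives and sums of morphisms\<close>

lemma pers_id_hom: "persistence_module K M \<Longrightarrow> pers_id M \<in> pers_hom K M M"
  by (rule pers_homI)
    (simp_all add: pers_id_def pmod_add_closed pmod_smult_closed pmod_mp(1))

lemma pers_comp_hom:
  assumes "persistence_module K L" "\<phi> \<in> pers_hom K L M" "\<psi> \<in> pers_hom K M N"
  shows "pers_comp L \<psi> \<phi> \<in> pers_hom K L N"
  by (rule pers_homI)
    (simp_all add: pers_comp_def compose_def pmod_add_closed[OF assms(1)]
      pmod_smult_closed[OF assms(1)] pmod_mp(1)[OF assms(1)]
      pers_homD(1,3-5)[OF assms(2)] pers_homD(1,3-5)[OF assms(3)])

lemma pers_zero_hom:
  assumes "persistence_module K M" "persistence_module K N"
  shows "pers_zero M N \<in> pers_hom K M N"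
proof -
  have "a \<odot>\<^bsub>sp N t\<^esub> \<zero>\<^bsub>sp N t\<^esub> = \<zero>\<^bsub>sp N t\<^esub>" if "a \<in> carrier K" for a t
    using Module.module.smult_r_null[OF pmod_module[OF assms(2)] that] .
  moreover have "\<zero>\<^bsub>sp N t\<^esub> \<oplus>\<^bsub>sp N t\<^esub> \<zero>\<^bsub>sp N t\<^esub> = \<zero>\<^bsub>sp N t\<^esub>" for t
    using abelian_monoid.r_zero[OF abelian_group.axioms(1)[OF pmod_group] pmod_zero_closed] assms(2)
    by blast
  ultimately show ?thesis
    by (intro pers_homI)
      (simp_all add: pers_zero_def pmod_add_closed[OF assms(1)] pmod_smult_closed[OF assms(1)]
        pmod_mp(1)[OF assms(1)] pmod_mp(5)[OF assms(2)] pmod_zero_closed[OF assms(2)])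
qed

lemma pers_hom_neg:
  assumes "persistence_module K M" "persistence_module K N" "\<phi> \<in> pers_hom K M N"
  shows "(\<lambda>t. \<lambda>x\<in>carrier (sp M t). \<ominus>\<^bsub>sp N t\<^esub> \<phi> t x) \<in> pers_hom K M N"
proof -
  note N = abelian_group.a_inv_closed[OF pmod_group[OF assms(2)]]
    abelian_group.minus_add[OF pmod_group[OF assms(2)]]
    Module.module.smult_r_minus[OF pmod_module[OF assms(2)]]
  show ?thesis
    by (intro pers_homI)
      (simp_all add: pmod_add_closed[OF assms(1)] pmod_smult_closed[OF assms(1)]
        pmod_mp(1)[OF assms(1)] pers_homD(1,3-5)[OF assms(3)] N pmod_mp(6)[OF assms(2)])
qed

lemma pers_hom_add:
  assumes "persistence_module K M" "persistence_module K N"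
    and "\<phi> \<in> pers_hom K M N" "\<psi> \<in> pers_hom K M N"
  shows "(\<lambda>t. \<lambda>x\<in>carrier (sp M t). \<phi> t x \<oplus>\<^bsub>sp N t\<^esub> \<psi> t x) \<in> pers_hom K M N"
proof -
  note N = pmod_add_closed[OF assms(2)] Module.module.smult_r_distr[OF pmod_module[OF assms(2)]]
    abelian_monoid.a_ac[OF abelian_group.axioms(1)[OF pmod_group[OF assms(2)]]]
  show ?thesis
    by (intro pers_homI)
      (simp_all add: pmod_add_closed[OF assms(1)] pmod_smult_closed[OF assms(1)]
        pmod_mp(1)[OF assms(1)] pers_homD(1,3-5)[OF assms(3)] pers_homD(1,3-5)[OF assms(4)]
        N pmod_mp(3)[OF assms(2)])
qed

lemma chain_id_map: "cochain_complex K X \<Longrightarrow> chain_id X \<in> chain_maps K X X"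
  by (rule chain_mapsI)
    (simp_all add: chain_id_def pers_id_hom cpx_pmod, simp_all add: pers_id_def df_closed)

lemma chain_comp_map:
  assumes "cochain_complex K X" "f \<in> chain_maps K X Y" "g \<in> chain_maps K Y Z"
  shows "chain_comp X g f \<in> chain_maps K X Z"
proof (rule chain_mapsI)
  fix i show "chain_comp X g f i \<in> pers_hom K (ob X i) (ob Z i)"
    unfolding chain_comp_def
    by (rule pers_comp_hom[OF cpx_pmod[OF assms(1)] chain_maps_hom[OF assms(2)]
          chain_maps_hom[OF assms(3)]])
next
  fix i t x assume x: "x \<in> carrier (sp (ob X i) t)"
  then show "chain_comp X g f (i + 1) t (df X i t x) = df Z i t (chain_comp X g f i t x)"
    using df_closed[OF assms(1) x] chain_map_closed[OF assms(2) x]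
    by (simp add: chain_comp_def pers_comp_def compose_def chain_maps_df[OF assms(2)] chain_maps_df[OF assms(3)])
qed

lemma chain_comp_apply:
  "x \<in> carrier (sp (ob X i) t) \<Longrightarrow> chain_comp X g f i t x = g i t (f i t x)"
  by (simp add: chain_comp_def pers_comp_def compose_def)

text \<open>An equality of functions: off the carriers of X both sides are \<open>undefined\<close>,
  and on them f lands in the carriers of Y, where the inner restricted composite of g and h takes
  its genuine value.\<close>

lemma chain_comp_assoc:
  assumes "f \<in> chain_maps K X Y"
  shows "chain_comp X h (chain_comp X g f) = chain_comp X (chain_comp Y h g) f"
  by (simp add: chain_comp_def pers_comp_def compose_def fun_eq_iff chain_map_closed[OF assms])

lemma chain_map_outside:
  "f \<in> chain_maps K X Y \<Longrightarrow> x \<notin> carrier (sp (ob X i) t) \<Longrightarrow> f i t x = undefined"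
  by (rule pers_homD(2)[OF chain_maps_hom])

text \<open>The identity law is strict because f is extensional and so agrees with the composite off
  the carriers too.\<close>

lemma chain_comp_id_left:
  assumes "f \<in> chain_maps K X Y" shows "chain_comp X (chain_id Y) f = f"
  by (simp add: chain_comp_def pers_comp_def compose_def chain_id_def pers_id_def fun_eq_iff
      chain_map_closed[OF assms] chain_map_outside[OF assms] restrict_def)

lemma chain_comp_id_right:
  assumes "f \<in> chain_maps K X Y" shows "chain_comp X f (chain_id X) = f"
  by (simp add: chain_comp_def pers_comp_def compose_def chain_id_def pers_id_def fun_eq_iff
      chain_map_outside[OF assms] restrict_def)

section \<open>The homotopy category\<close>

lemma homotopyI:
  assumes "f \<in> chain_maps K X Y" "g \<in> chain_maps K X Y"
    and "\<And>i. h i \<in> pers_hom K (ob X i) (ob Y (i - 1))"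
    and "\<And>i t x. x \<in> carrier (sp (ob X i) t) \<Longrightarrow>
           f i t x \<ominus>\<^bsub>sp (ob Y i) t\<^esub> g i t x =
             df Y (i - 1) t (h i t x) \<oplus>\<^bsub>sp (ob Y i) t\<^esub> h (i + 1) t (df X i t x)"
  shows "(f, g) \<in> homotopy K X Y"
  unfolding homotopy_def using assms by blast

lemma homotopyE:
  assumes "(f, g) \<in> homotopy K X Y"
  obtains h where "f \<in> chain_maps K X Y" "g \<in> chain_maps K X Y"
    and "\<forall>i. h i \<in> pers_hom K (ob X i) (ob Y (i - 1))"
    and "\<forall>i t. \<forall>x\<in>carrier (sp (ob X i) t).
           f i t x \<ominus>\<^bsub>sp (ob Y i) t\<^esub> g i t x =
             df Y (i - 1) t (h i t x) \<oplus>\<^bsub>sp (ob Y i) t\<^esub> h (i + 1) t (df X i t x)"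
  using assms unfolding homotopy_def by blast

text \<open>At index \<open>i + 1\<close> a homotopy lands in degree \<open>i + 1 - 1\<close>; here
  the value is placed in degree \<open>i\<close>, where the homotopy equation adds it to the other
  term.\<close>

lemma homotopy_succ_closed:
  assumes "\<And>i. h i \<in> pers_hom K (ob X i) (ob Y (i - 1))" "x \<in> carrier (sp (ob X (i + 1)) t)"
  shows "h (i + 1) t x \<in> carrier (sp (ob Y i) t)"
  using pers_homD(1)[OF assms(1) assms(2)] by simp

text \<open>The three witnesses are the zero homotopy, the negative of a homotopy and the sum of
  two; the homotopy equation is additive in the homotopy.\<close>

lemma equiv_homotopy:
  assumes X: "cochain_complex K X" and Y: "cochain_complex K Y"
  shows "equiv (chain_maps K X Y) (homotopy K X Y)"
proof (rule equivI)
  show "homotopy K X Y \<subseteq> chain_maps K X Y \<times> chain_maps K X Y"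
    unfolding homotopy_def by auto
  show "refl_on (chain_maps K X Y) (homotopy K X Y)"
  proof (rule refl_onI)
    fix f assume f: "f \<in> chain_maps K X Y"
    show "(f, f) \<in> homotopy K X Y"
    proof (rule homotopyI[where h = "\<lambda>i. pers_zero (ob X i) (ob Y (i - 1))", OF f f])
      fix i show "pers_zero (ob X i) (ob Y (i - 1)) \<in> pers_hom K (ob X i) (ob Y (i - 1))"
        by (rule pers_zero_hom[OF cpx_pmod[OF X] cpx_pmod[OF Y]])
    next
      fix i t x assume x: "x \<in> carrier (sp (ob X i) t)"
      interpret abelian_group "sp (ob Y i) t" by (rule cpx_group[OF Y])
      show "f i t x \<ominus>\<^bsub>sp (ob Y i) t\<^esub> f i t x =
          df Y (i - 1) t (pers_zero (ob X i) (ob Y (i - 1)) t x) \<oplus>\<^bsub>sp (ob Y i) t\<^esub>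
          pers_zero (ob X (i + 1)) (ob Y (i + 1 - 1)) t (df X i t x)"
        using chain_map_closed[OF f x] df_closed[OF X x] x
        by (simp add: pers_zero_def pers_hom_zero[OF cpx_df_pred[OF Y] cpx_pmod[OF Y] cpx_pmod[OF Y]]
            r_neg a_minus_def)
    qed
  qed
  show "sym (homotopy K X Y)"
  proof (rule symI)
    fix f g assume "(f, g) \<in> homotopy K X Y"
    then obtain h where f: "f \<in> chain_maps K X Y" and g: "g \<in> chain_maps K X Y"
      and h0: "\<forall>i. h i \<in> pers_hom K (ob X i) (ob Y (i - 1))"
      and e0: "\<forall>i t. \<forall>x\<in>carrier (sp (ob X i) t).
           f i t x \<ominus>\<^bsub>sp (ob Y i) t\<^esub> g i t x =
             df Y (i - 1) t (h i t x) \<oplus>\<^bsub>sp (ob Y i) t\<^esub> h (i + 1) t (df X i t x)"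
      by (rule homotopyE)
    note h = h0[rule_format] and e = e0[rule_format]
    show "(g, f) \<in> homotopy K X Y"
    proof (rule homotopyI[OF g f, where h = "\<lambda>i t. \<lambda>x\<in>carrier (sp (ob X i) t). \<ominus>\<^bsub>sp (ob Y (i - 1)) t\<^esub> h i t x"])
      fix i
      show "(\<lambda>t. \<lambda>x\<in>carrier (sp (ob X i) t). \<ominus>\<^bsub>sp (ob Y (i - 1)) t\<^esub> h i t x)
          \<in> pers_hom K (ob X i) (ob Y (i - 1))"
        by (rule pers_hom_neg[OF cpx_pmod[OF X] cpx_pmod[OF Y] h])
    next
      fix i t x assume x: "x \<in> carrier (sp (ob X i) t)"
      interpret abelian_group "sp (ob Y i) t" by (rule cpx_group[OF Y])
      note c = chain_map_closed[OF f x] chain_map_closed[OF g x] x df_closed[OF X x]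
        df_closed_pred[OF Y pers_homD(1)[OF h x]] homotopy_succ_closed[of h, OF h df_closed[OF X x]]
      have "g i t x \<ominus>\<^bsub>sp (ob Y i) t\<^esub> f i t x = \<ominus>\<^bsub>sp (ob Y i) t\<^esub> (f i t x \<ominus>\<^bsub>sp (ob Y i) t\<^esub> g i t x)"
        using c(1,2) by (simp add: a_minus_def minus_add a_comm)
      then show "g i t x \<ominus>\<^bsub>sp (ob Y i) t\<^esub> f i t x =
          df Y (i - 1) t ((\<lambda>x\<in>carrier (sp (ob X i) t). \<ominus>\<^bsub>sp (ob Y (i - 1)) t\<^esub> h i t x) x) \<oplus>\<^bsub>sp (ob Y i) t\<^esub>
          (\<lambda>x\<in>carrier (sp (ob X (i + 1)) t). \<ominus>\<^bsub>sp (ob Y (i + 1 - 1)) t\<^esub> h (i + 1) t x) (df X i t x)"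
        using c by (simp add: e[OF x] minus_add
            pers_hom_a_inv[OF cpx_df_pred[OF Y] cpx_pmod[OF Y] cpx_pmod[OF Y] pers_homD(1)[OF h x]])
    qed
  qed
  show "trans (homotopy K X Y)"
  proof (rule transI)
    fix f g k assume "(f, g) \<in> homotopy K X Y" "(g, k) \<in> homotopy K X Y"
    from this(1) obtain h where f: "f \<in> chain_maps K X Y" and g: "g \<in> chain_maps K X Y"
      and h0: "\<forall>i. h i \<in> pers_hom K (ob X i) (ob Y (i - 1))"
      and e0: "\<forall>i t. \<forall>x\<in>carrier (sp (ob X i) t).
           f i t x \<ominus>\<^bsub>sp (ob Y i) t\<^esub> g i t x =
             df Y (i - 1) t (h i t x) \<oplus>\<^bsub>sp (ob Y i) t\<^esub> h (i + 1) t (df X i t x)"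
      by (rule homotopyE)
    note h = h0[rule_format] and e = e0[rule_format]
    from \<open>(g, k) \<in> homotopy K X Y\<close> obtain h' where k: "k \<in> chain_maps K X Y"
      and h'0: "\<forall>i. h' i \<in> pers_hom K (ob X i) (ob Y (i - 1))"
      and e'0: "\<forall>i t. \<forall>x\<in>carrier (sp (ob X i) t).
           g i t x \<ominus>\<^bsub>sp (ob Y i) t\<^esub> k i t x =
             df Y (i - 1) t (h' i t x) \<oplus>\<^bsub>sp (ob Y i) t\<^esub> h' (i + 1) t (df X i t x)"
      by (rule homotopyE)
    note h' = h'0[rule_format] and e' = e'0[rule_format]
    show "(f, k) \<in> homotopy K X Y"
    proof (rule homotopyI[OF f k, where
          h = "\<lambda>i t. \<lambda>x\<in>carrier (sp (ob X i) t). h i t x \<oplus>\<^bsub>sp (ob Y (i - 1)) t\<^esub> h' i t x"])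
      fix i
      show "(\<lambda>t. \<lambda>x\<in>carrier (sp (ob X i) t). h i t x \<oplus>\<^bsub>sp (ob Y (i - 1)) t\<^esub> h' i t x)
          \<in> pers_hom K (ob X i) (ob Y (i - 1))"
        by (rule pers_hom_add[OF cpx_pmod[OF X] cpx_pmod[OF Y] h h'])
    next
      fix i t x assume x: "x \<in> carrier (sp (ob X i) t)"
      interpret abelian_group "sp (ob Y i) t" by (rule cpx_group[OF Y])
      note c = chain_map_closed[OF f x] chain_map_closed[OF g x] chain_map_closed[OF k x] x
        df_closed[OF X x]
        df_closed_pred[OF Y pers_homD(1)[OF h x]] homotopy_succ_closed[of h, OF h df_closed[OF X x]]
        df_closed_pred[OF Y pers_homD(1)[OF h' x]] homotopy_succ_closed[of h', OF h' df_closed[OF X x]]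
      have "f i t x \<ominus>\<^bsub>sp (ob Y i) t\<^esub> k i t x =
          (f i t x \<ominus>\<^bsub>sp (ob Y i) t\<^esub> g i t x) \<oplus>\<^bsub>sp (ob Y i) t\<^esub> (g i t x \<ominus>\<^bsub>sp (ob Y i) t\<^esub> k i t x)"
        using c(1-3) by (simp add: a_minus_def a_assoc r_neg1)
      then show "f i t x \<ominus>\<^bsub>sp (ob Y i) t\<^esub> k i t x =
          df Y (i - 1) t ((\<lambda>x\<in>carrier (sp (ob X i) t). h i t x \<oplus>\<^bsub>sp (ob Y (i - 1)) t\<^esub> h' i t x) x) \<oplus>\<^bsub>sp (ob Y i) t\<^esub>
          (\<lambda>x\<in>carrier (sp (ob X (i + 1)) t). h (i + 1) t x \<oplus>\<^bsub>sp (ob Y (i + 1 - 1)) t\<^esub> h' (i + 1) t x) (df X i t x)"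
        using c by (simp add: e[OF x] e'[OF x] a_ac
            pers_homD(3)[OF cpx_df_pred[OF Y] pers_homD(1)[OF h x] pers_homD(1)[OF h' x]])
    qed
  qed
qed

text \<open>If h is a homotopy from f to f', then g after h is one for the composites, since g
  commutes with the differentials.\<close>

lemma homotopy_comp_left:
  assumes X: "cochain_complex K X" and Y: "cochain_complex K Y" and Z: "cochain_complex K Z"
    and "(f, f') \<in> homotopy K X Y" and g: "g \<in> chain_maps K Y Z"
  shows "(chain_comp X g f, chain_comp X g f') \<in> homotopy K X Z"
proof -
  from assms(4) obtain h where f: "f \<in> chain_maps K X Y" and f': "f' \<in> chain_maps K X Y"
    and h0: "\<forall>i. h i \<in> pers_hom K (ob X i) (ob Y (i - 1))"
    and e0: "\<forall>i t. \<forall>x\<in>carrier (sp (ob X i) t).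
         f i t x \<ominus>\<^bsub>sp (ob Y i) t\<^esub> f' i t x =
           df Y (i - 1) t (h i t x) \<oplus>\<^bsub>sp (ob Y i) t\<^esub> h (i + 1) t (df X i t x)"
      by (rule homotopyE)
    note h = h0[rule_format] and e = e0[rule_format]
  show ?thesis
  proof (rule homotopyI[OF chain_comp_map[OF X f g] chain_comp_map[OF X f' g],
        where h = "\<lambda>i. pers_comp (ob X i) (g (i - 1)) (h i)"])
    fix i
    show "pers_comp (ob X i) (g (i - 1)) (h i) \<in> pers_hom K (ob X i) (ob Z (i - 1))"
      by (rule pers_comp_hom[OF cpx_pmod[OF X] h chain_maps_hom[OF g]])
  next
    fix i t x assume x: "x \<in> carrier (sp (ob X i) t)"
    note hx = pers_homD(1)[OF h x]
    have "chain_comp X g f i t x \<ominus>\<^bsub>sp (ob Z i) t\<^esub> chain_comp X g f' i t x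
        = g i t (f i t x \<ominus>\<^bsub>sp (ob Y i) t\<^esub> f' i t x)"
      using chain_map_minus[OF g Y Z chain_map_closed[OF f x] chain_map_closed[OF f' x]] x
      by (simp add: chain_comp_apply)
    also have "\<dots> = g i t (df Y (i - 1) t (h i t x)) \<oplus>\<^bsub>sp (ob Z i) t\<^esub> g i t (h (i + 1) t (df X i t x))"
      unfolding e[OF x]
      by (rule pers_homD(3)[OF chain_maps_hom[OF g] df_closed_pred[OF Y hx]
            homotopy_succ_closed[of h, OF h df_closed[OF X x]]])
    finally show "chain_comp X g f i t x \<ominus>\<^bsub>sp (ob Z i) t\<^esub> chain_comp X g f' i t x =
        df Z (i - 1) t (pers_comp (ob X i) (g (i - 1)) (h i) t x) \<oplus>\<^bsub>sp (ob Z i) t\<^esub>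
        pers_comp (ob X (i + 1)) (g (i + 1 - 1)) (h (i + 1)) t (df X i t x)"
      using x df_closed[OF X x] by (simp add: pers_comp_def compose_def chain_maps_df_pred[OF g hx])
  qed
qed

text \<open>Here the homotopy is h after f; commutation of f with the differentials rewrites the
  second term of the equation.\<close>

lemma homotopy_comp_right:
  assumes X: "cochain_complex K X"
    and "(g, g') \<in> homotopy K Y Z" and f: "f \<in> chain_maps K X Y"
  shows "(chain_comp X g f, chain_comp X g' f) \<in> homotopy K X Z"
proof -
  from assms(2) obtain h where g: "g \<in> chain_maps K Y Z" and g': "g' \<in> chain_maps K Y Z"
    and h0: "\<forall>i. h i \<in> pers_hom K (ob Y i) (ob Z (i - 1))"
    and e0: "\<forall>i t. \<forall>x\<in>carrier (sp (ob Y i) t).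
         g i t x \<ominus>\<^bsub>sp (ob Z i) t\<^esub> g' i t x =
           df Z (i - 1) t (h i t x) \<oplus>\<^bsub>sp (ob Z i) t\<^esub> h (i + 1) t (df Y i t x)"
      by (rule homotopyE)
    note h = h0[rule_format] and e = e0[rule_format]
  show ?thesis
  proof (rule homotopyI[OF chain_comp_map[OF X f g] chain_comp_map[OF X f g'],
        where h = "\<lambda>i. pers_comp (ob X i) (h i) (f i)"])
    fix i
    show "pers_comp (ob X i) (h i) (f i) \<in> pers_hom K (ob X i) (ob Z (i - 1))"
      by (rule pers_comp_hom[OF cpx_pmod[OF X] chain_maps_hom[OF f] h])
  next
    fix i t x assume x: "x \<in> carrier (sp (ob X i) t)"
    show "chain_comp X g f i t x \<ominus>\<^bsub>sp (ob Z i) t\<^esub> chain_comp X g' f i t x =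
        df Z (i - 1) t (pers_comp (ob X i) (h i) (f i) t x) \<oplus>\<^bsub>sp (ob Z i) t\<^esub>
        pers_comp (ob X (i + 1)) (h (i + 1)) (f (i + 1)) t (df X i t x)"
      using x df_closed[OF X x] e[OF chain_map_closed[OF f x]]
      by (simp add: chain_comp_apply pers_comp_def compose_def chain_maps_df[OF f x])
  qed
qed

section \<open>Morphisms of the homotopy category as classes\<close>

lemma K_hom_class: "f \<in> chain_maps K X Y \<Longrightarrow> K_class K X Y f \<in> K_hom K X Y"
  unfolding K_hom_def K_class_def by (rule quotientI)

lemma K_homE:
  assumes "F \<in> K_hom K X Y"
  obtains f where "f \<in> chain_maps K X Y" "F = K_class K X Y f"
  using assms unfolding K_hom_def K_class_def by (rule quotientE)

lemma K_class_eqI: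
  assumes "cochain_complex K X" "cochain_complex K Y" "(f, g) \<in> homotopy K X Y"
  shows "K_class K X Y f = K_class K X Y g"
  unfolding K_class_def by (rule equiv_class_eq[OF equiv_homotopy[OF assms(1,2)] assms(3)])

lemma K_class_self:
  assumes "cochain_complex K X" "cochain_complex K Y" "f \<in> chain_maps K X Y"
  shows "f \<in> K_class K X Y f"
  unfolding K_class_def by (rule equiv_class_self[OF equiv_homotopy[OF assms(1,2)] assms(3)])

lemma K_class_memD: "g \<in> K_class K X Y f \<Longrightarrow> (f, g) \<in> homotopy K X Y"
  unfolding K_class_def by simp

lemma K_class_mem_chain_maps: "g \<in> K_class K X Y f \<Longrightarrow> g \<in> chain_maps K X Y"
  unfolding K_class_def homotopy_def by simp

text \<open>\<open>K_comp\<close> is a union over all pairs of representatives. Changing either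
  representative changes the composite by a homotopy only, so every term is the same class, and the
  pair (g, f) itself shows that the union is not empty.\<close>

lemma K_comp_class:
  assumes X: "cochain_complex K X" and Y: "cochain_complex K Y" and Z: "cochain_complex K Z"
    and f: "f \<in> chain_maps K X Y" and g: "g \<in> chain_maps K Y Z"
  shows "K_comp K X Z (K_class K Y Z g) (K_class K X Y f) = K_class K X Z (chain_comp X g f)"
proof -
  have "K_class K X Z (chain_comp X g' f') = K_class K X Z (chain_comp X g f)"
    if g': "g' \<in> K_class K Y Z g" and f': "f' \<in> K_class K X Y f" for g' f'
  proof -
    have "K_class K X Z (chain_comp X g f) = K_class K X Z (chain_comp X g f')"
      by (rule K_class_eqI[OF X Z homotopy_comp_left[OF X Y Z K_class_memD[OF f'] g]])
    also have "\<dots> = K_class K X Z (chain_comp X g' f')"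
      by (rule K_class_eqI[OF X Z homotopy_comp_right[OF X K_class_memD[OF g']
              K_class_mem_chain_maps[OF f']]])
    finally show ?thesis ..
  qed
  then show ?thesis
    unfolding K_comp_def using K_class_self[OF X Y f] K_class_self[OF Y Z g] by blast
qed

lemma K_comp_hom:
  assumes "cochain_complex K X" "cochain_complex K Y" "cochain_complex K Z"
    and "F \<in> K_hom K X Y" and "G \<in> K_hom K Y Z"
  shows "K_comp K X Z G F \<in> K_hom K X Z"
proof -
  from assms(4) obtain f where f: "f \<in> chain_maps K X Y" "F = K_class K X Y f" by (rule K_homE)
  from assms(5) obtain g where g: "g \<in> chain_maps K Y Z" "G = K_class K Y Z g" by (rule K_homE)
  show ?thesis
    unfolding f g K_comp_class[OF assms(1-3) f(1) g(1)]
    by (rule K_hom_class[OF chain_comp_map[OF assms(1) f(1) g(1)]])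
qed

lemma K_comp_assoc:
  assumes W: "cochain_complex K W" and X: "cochain_complex K X" and Y: "cochain_complex K Y"
    and Z: "cochain_complex K Z"
    and "F \<in> K_hom K W X" "G \<in> K_hom K X Y" "H \<in> K_hom K Y Z"
  shows "K_comp K W Z (K_comp K X Z H G) F = K_comp K W Z H (K_comp K W Y G F)"
proof -
  from assms(5) obtain f where f: "f \<in> chain_maps K W X" "F = K_class K W X f" by (rule K_homE)
  from assms(6) obtain g where g: "g \<in> chain_maps K X Y" "G = K_class K X Y g" by (rule K_homE)
  from assms(7) obtain h where h: "h \<in> chain_maps K Y Z" "H = K_class K Y Z h" by (rule K_homE)
  show ?thesis
    unfolding f g h
    using f(1) g(1) h(1) X Y Z W
    by (simp add: K_comp_class[OF X Y Z] K_comp_class[OF W X Z] K_comp_class[OF W X Y]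
        K_comp_class[OF W Y Z] chain_comp_map[OF X g(1) h(1)] chain_comp_map[OF W f(1) g(1)]
        chain_comp_assoc[OF f(1)])
qed

lemma K_id_hom: "cochain_complex K X \<Longrightarrow> K_id K X \<in> K_hom K X X"
  unfolding K_id_def by (rule K_hom_class[OF chain_id_map])

lemma K_comp_id_left:
  assumes X: "cochain_complex K X" and Y: "cochain_complex K Y" and "F \<in> K_hom K X Y"
  shows "K_comp K X Y (K_id K Y) F = F"
proof -
  from assms(3) obtain f where f: "f \<in> chain_maps K X Y" "F = K_class K X Y f" by (rule K_homE)
  show ?thesis
    unfolding f K_id_def K_comp_class[OF X Y Y f(1) chain_id_map[OF Y]] chain_comp_id_left[OF f(1)] ..
qed

lemma K_comp_id_right:
  assumes X: "cochain_complex K X" and Y: "cochain_complex K Y" and "F \<in> K_hom K X Y"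
  shows "K_comp K X Y F (K_id K X) = F"
proof -
  from assms(3) obtain f where f: "f \<in> chain_maps K X Y" "F = K_class K X Y f" by (rule K_homE)
  show ?thesis
    unfolding f K_id_def K_comp_class[OF X X Y chain_id_map[OF X] f(1)] chain_comp_id_right[OF f(1)] ..
qed

section \<open>Shifts\<close>

lemma pers_shift_simps [simp]:
  "sp (pers_shift \<epsilon> M) t = sp M (t + diag \<epsilon>)"
  "mp (pers_shift \<epsilon> M) s t = mp M (s + diag \<epsilon>) (t + diag \<epsilon>)"
  by (simp_all add: pers_shift_def)

lemma cpx_shift_simps [simp]:
  "ob (cpx_shift \<epsilon> X) i = pers_shift \<epsilon> (ob X i)"
  "df (cpx_shift \<epsilon> X) i t = df X i (t + diag \<epsilon>)"
  by (simp_all add: cpx_shift_def pers_shift_map_def)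

lemma diag_mono: "s \<le> t \<Longrightarrow> s + diag \<epsilon> \<le> t + diag \<epsilon>"
  by (simp add: less_eq_vec_def)

lemma diag_add: "t + diag a + diag b = t + diag (a + b)"
  by (simp add: diag_def vec_eq_iff)

lemma pers_shift_twice: "pers_shift a (pers_shift b M) = pers_shift (a + b) M"
  by (simp add: pers_shift_def diag_add)

text \<open>A literal equality of records, so a morphism into the shift by \<open>a + b\<close>
  already is a morphism into the iterated shift, with no comparison isomorphism in between.\<close>

lemma cpx_shift_twice: "cpx_shift a (cpx_shift b X) = cpx_shift (a + b) X"
  by (simp add: cpx_shift_def pers_shift_twice pers_shift_map_def diag_add)

lemma persistence_module_shift:
  assumes "persistence_module K M"
  shows "persistence_module K (pers_shift \<epsilon> M)"
  by (rule persistence_moduleI)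
    (simp_all add: pmod_module[OF assms] pmod_mp(1-4)[OF assms diag_mono] pmod_mp_refl[OF assms]
      pmod_mp_trans[OF assms diag_mono diag_mono])

lemma pers_hom_shift:
  assumes "\<phi> \<in> pers_hom K M N"
  shows "pers_shift_map \<epsilon> \<phi> \<in> pers_hom K (pers_shift \<epsilon> M) (pers_shift \<epsilon> N)"
  by (rule pers_homI)
    (simp_all add: pers_shift_map_def pers_homD(1-4)[OF assms] pers_homD(5)[OF assms diag_mono])

lemma cochain_complex_shift:
  assumes "cochain_complex K X"
  shows "cochain_complex K (cpx_shift \<epsilon> X)"
proof (rule cochain_complexI)
  fix i show "persistence_module K (ob (cpx_shift \<epsilon> X) i)"
    by (simp add: persistence_module_shift cpx_pmod[OF assms])
  show "df (cpx_shift \<epsilon> X) i \<in> pers_hom K (ob (cpx_shift \<epsilon> X) i) (ob (cpx_shift \<epsilon> X) (i + 1))"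
    using pers_hom_shift[OF cpx_df[OF assms, of i]] by (simp add: cpx_shift_def)
qed (simp add: cpx_dd[OF assms])

lemma chain_shift_apply [simp]: "chain_shift \<epsilon> f i t = f i (t + diag \<epsilon>)"
  by (simp add: chain_shift_def pers_shift_map_def)

lemma chain_shift_map:
  assumes "f \<in> chain_maps K X Y"
  shows "chain_shift \<epsilon> f \<in> chain_maps K (cpx_shift \<epsilon> X) (cpx_shift \<epsilon> Y)"
proof (rule chain_mapsI)
  fix i show "chain_shift \<epsilon> f i \<in> pers_hom K (ob (cpx_shift \<epsilon> X) i) (ob (cpx_shift \<epsilon> Y) i)"
    using pers_hom_shift[OF chain_maps_hom[OF assms, of i]] by (simp add: chain_shift_def)
qed (simp add: chain_maps_df[OF assms])

lemma chain_shift_comp: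
  "chain_comp (cpx_shift \<epsilon> X) (chain_shift \<epsilon> g) (chain_shift \<epsilon> f) = chain_shift \<epsilon> (chain_comp X g f)"
  by (simp add: chain_comp_def pers_comp_def chain_shift_def pers_shift_map_def)

lemma homotopy_shift:
  assumes "(f, g) \<in> homotopy K X Y"
  shows "(chain_shift \<epsilon> f, chain_shift \<epsilon> g) \<in> homotopy K (cpx_shift \<epsilon> X) (cpx_shift \<epsilon> Y)"
proof -
  from assms obtain h where f: "f \<in> chain_maps K X Y" and g: "g \<in> chain_maps K X Y"
    and h: "\<forall>i. h i \<in> pers_hom K (ob X i) (ob Y (i - 1))"
    and e: "\<forall>i t. \<forall>x\<in>carrier (sp (ob X i) t).
           f i t x \<ominus>\<^bsub>sp (ob Y i) t\<^esub> g i t x =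
             df Y (i - 1) t (h i t x) \<oplus>\<^bsub>sp (ob Y i) t\<^esub> h (i + 1) t (df X i t x)"
    by (rule homotopyE)
  show ?thesis
  proof (rule homotopyI[OF chain_shift_map[OF f] chain_shift_map[OF g],
        where h = "\<lambda>i. pers_shift_map \<epsilon> (h i)"])
    fix i show "pers_shift_map \<epsilon> (h i) \<in> pers_hom K (ob (cpx_shift \<epsilon> X) i) (ob (cpx_shift \<epsilon> Y) (i - 1))"
      using pers_hom_shift[OF h[rule_format, of i]] by simp
  qed (use e in \<open>simp add: pers_shift_map_def\<close>)
qed

lemma K_shift_class:
  assumes X: "cochain_complex K X" and Y: "cochain_complex K Y" and f: "f \<in> chain_maps K X Y"
  shows "K_shift K \<epsilon> X Y (K_class K X Y f) = K_class K (cpx_shift \<epsilon> X) (cpx_shift \<epsilon> Y) (chain_shift \<epsilon> f)"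
proof -
  have "K_class K (cpx_shift \<epsilon> X) (cpx_shift \<epsilon> Y) (chain_shift \<epsilon> f') =
      K_class K (cpx_shift \<epsilon> X) (cpx_shift \<epsilon> Y) (chain_shift \<epsilon> f)" if "f' \<in> K_class K X Y f" for f'
    using K_class_eqI[OF cochain_complex_shift[OF X] cochain_complex_shift[OF Y]
        homotopy_shift[OF K_class_memD[OF that]]] ..
  then show ?thesis unfolding K_shift_def using K_class_self[OF X Y f] by blast
qed

lemma K_shift_hom:
  assumes X: "cochain_complex K X" and Y: "cochain_complex K Y" and "F \<in> K_hom K X Y"
  shows "K_shift K \<epsilon> X Y F \<in> K_hom K (cpx_shift \<epsilon> X) (cpx_shift \<epsilon> Y)"
proof -
  from assms(3) obtain f where f: "f \<in> chain_maps K X Y" "F = K_class K X Y f" by (rule K_homE)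
  show ?thesis
    unfolding f(2) K_shift_class[OF X Y f(1)] by (rule K_hom_class[OF chain_shift_map[OF f(1)]])
qed

lemma K_shift_comp:
  assumes X: "cochain_complex K X" and Y: "cochain_complex K Y" and Z: "cochain_complex K Z"
    and "F \<in> K_hom K X Y" "G \<in> K_hom K Y Z"
  shows "K_shift K \<epsilon> X Z (K_comp K X Z G F) =
    K_comp K (cpx_shift \<epsilon> X) (cpx_shift \<epsilon> Z) (K_shift K \<epsilon> Y Z G) (K_shift K \<epsilon> X Y F)"
proof -
  note S = cochain_complex_shift
  from assms(4) obtain f where f: "f \<in> chain_maps K X Y" "F = K_class K X Y f" by (rule K_homE)
  from assms(5) obtain g where g: "g \<in> chain_maps K Y Z" "G = K_class K Y Z g" by (rule K_homE)
  show ?thesis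
    unfolding f(2) g(2) K_comp_class[OF X Y Z f(1) g(1)]
      K_shift_class[OF X Z chain_comp_map[OF X f(1) g(1)]]
      K_shift_class[OF X Y f(1)] K_shift_class[OF Y Z g(1)]
      K_comp_class[OF S[OF X] S[OF Y] S[OF Z] chain_shift_map[OF f(1)] chain_shift_map[OF g(1)]]
      chain_shift_comp ..
qed

section \<open>Quasi-isomorphisms\<close>

lemma coboundaries_subgroup:
  assumes X: "cochain_complex K X"
  shows "abelian_subgroup (coboundaries X i t) (sp (ob X i) t)"
proof -
  interpret P: abelian_group "sp (ob X (i - 1)) t" by (rule cpx_group[OF X])
  interpret Q: abelian_group "sp (ob X i) t" by (rule cpx_group[OF X])
  note d = cpx_df_pred[OF X, of i]
  note d_neg = pers_hom_a_inv[OF d cpx_pmod[OF X] cpx_pmod[OF X], symmetric]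
  have "subgroup (coboundaries X i t) (add_monoid (sp (ob X i) t))"
  proof (rule Q.add.subgroupI)
    show "coboundaries X i t \<subseteq> carrier (sp (ob X i) t)"
      using pers_homD(1)[OF d] by (auto simp: coboundaries_def)
    show "coboundaries X i t \<noteq> {}" using P.zero_closed by (auto simp: coboundaries_def)
  next
    fix a assume "a \<in> coboundaries X i t"
    then show "\<ominus>\<^bsub>sp (ob X i) t\<^esub> a \<in> coboundaries X i t"
      by (auto simp: coboundaries_def d_neg)
  next
    fix a b assume "a \<in> coboundaries X i t" "b \<in> coboundaries X i t"
    then show "a \<oplus>\<^bsub>sp (ob X i) t\<^esub> b \<in> coboundaries X i t"
      by (auto simp: coboundaries_def pers_homD(3)[OF d, symmetric])
  qed
  then show ?thesis
    by (intro abelian_subgroupI3 additive_subgroup.intro Q.abelian_group_axioms)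
qed

lemma cocycles_closed: "x \<in> cocycles X i t \<Longrightarrow> x \<in> carrier (sp (ob X i) t)"
  and cocycles_df: "x \<in> cocycles X i t \<Longrightarrow> df X i t x = \<zero>\<^bsub>sp (ob X (i + 1)) t\<^esub>"
  by (auto simp: cocycles_def)

lemma coboundaries_smult:
  assumes X: "cochain_complex K X" and "a \<in> carrier K" "b \<in> coboundaries X i t"
  shows "a \<odot>\<^bsub>sp (ob X i) t\<^esub> b \<in> coboundaries X i t"
  using assms(2,3) pmod_smult_closed[OF cpx_pmod[OF X]]
  by (auto simp: coboundaries_def pers_homD(4)[OF cpx_df_pred[OF X], symmetric])

lemma chain_map_coboundaries:
  assumes f: "f \<in> chain_maps K X Y" and "b \<in> coboundaries X i t"
  shows "f i t b \<in> coboundaries Y i t"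
  using assms(2)
  by (auto simp: coboundaries_def chain_maps_df_pred[OF f] chain_map_closed[OF f])

lemma mp_coboundaries:
  assumes X: "cochain_complex K X" and "s \<le> t" "b \<in> coboundaries X i s"
  shows "mp (ob X i) s t b \<in> coboundaries X i t"
  using assms(3)
  by (auto simp: coboundaries_def pers_homD(5)[OF cpx_df_pred[OF X] assms(2), symmetric]
      pmod_mp(1)[OF cpx_pmod[OF X] assms(2)])

lemma cocycles_add:
  assumes X: "cochain_complex K X" and "x \<in> cocycles X i t" "y \<in> cocycles X i t"
  shows "x \<oplus>\<^bsub>sp (ob X i) t\<^esub> y \<in> cocycles X i t"
proof -
  interpret abelian_group "sp (ob X i) t" by (rule cpx_group[OF X])
  interpret S: abelian_group "sp (ob X (i + 1)) t" by (rule cpx_group[OF X])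
  show ?thesis using assms(2,3) by (simp add: cocycles_def pers_homD(3)[OF cpx_df[OF X]])
qed

lemma cocycles_a_inv:
  assumes X: "cochain_complex K X" and "x \<in> cocycles X i t"
  shows "\<ominus>\<^bsub>sp (ob X i) t\<^esub> x \<in> cocycles X i t"
proof -
  interpret abelian_group "sp (ob X i) t" by (rule cpx_group[OF X])
  interpret S: abelian_group "sp (ob X (i + 1)) t" by (rule cpx_group[OF X])
  show ?thesis using assms(2)
    by (simp add: cocycles_def pers_hom_a_inv[OF cpx_df[OF X] cpx_pmod[OF X] cpx_pmod[OF X]])
qed

lemma cocycles_minus:
  "cochain_complex K X \<Longrightarrow> x \<in> cocycles X i t \<Longrightarrow> y \<in> cocycles X i t \<Longrightarrow>
    x \<ominus>\<^bsub>sp (ob X i) t\<^esub> y \<in> cocycles X i t"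
  by (simp add: a_minus_def cocycles_add cocycles_a_inv)

lemma cocycles_zero:
  assumes X: "cochain_complex K X"
  shows "\<zero>\<^bsub>sp (ob X i) t\<^esub> \<in> cocycles X i t"
  by (simp add: cocycles_def pmod_zero_closed[OF cpx_pmod[OF X]]
      pers_hom_zero[OF cpx_df[OF X] cpx_pmod[OF X] cpx_pmod[OF X]])

lemma cocycles_smult:
  assumes X: "cochain_complex K X" and "a \<in> carrier K" "x \<in> cocycles X i t"
  shows "a \<odot>\<^bsub>sp (ob X i) t\<^esub> x \<in> cocycles X i t"
  using assms(2,3) Module.module.smult_r_null[OF pmod_module[OF cpx_pmod[OF X]] assms(2)]
  by (simp add: cocycles_def pers_homD(4)[OF cpx_df[OF X]] pmod_smult_closed[OF cpx_pmod[OF X]])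

lemma chain_map_cocycles:
  assumes X: "cochain_complex K X" and Y: "cochain_complex K Y" and f: "f \<in> chain_maps K X Y"
    and "x \<in> cocycles X i t"
  shows "f i t x \<in> cocycles Y i t"
  using assms(4)
  by (simp add: cocycles_def chain_map_closed[OF f] chain_maps_df[OF f, symmetric]
      pers_hom_zero[OF chain_maps_hom[OF f] cpx_pmod[OF X] cpx_pmod[OF Y]])

lemma mp_cocycles:
  assumes X: "cochain_complex K X" and st: "s \<le> t" and "x \<in> cocycles X i s"
  shows "mp (ob X i) s t x \<in> cocycles X i t"
  using assms(3)
  by (simp add: cocycles_def pmod_mp(1,5)[OF cpx_pmod[OF X] st] pers_homD(5)[OF cpx_df[OF X] st])

text \<open>Translates between equality in a quotient and differences of representatives, the
  language of all later cohomology arguments.\<close>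

lemma coset_eq_iff:
  assumes "abelian_subgroup B V" "x \<in> carrier V" "y \<in> carrier V"
  shows "B +>\<^bsub>V\<^esub> x = B +>\<^bsub>V\<^esub> y \<longleftrightarrow> x \<ominus>\<^bsub>V\<^esub> y \<in> B"
proof -
  interpret abelian_subgroup B V by fact
  show ?thesis
    using a_rcos_module[OF assms(3,2)] a_repr_independence'[OF _ assms(3), of x]
      a_repr_independenceD[OF assms(2), of y]
    unfolding a_minus_def by metis
qed

lemma minus_zero_right:
  assumes "abelian_group V" "x \<in> carrier V"
  shows "x \<ominus>\<^bsub>V\<^esub> \<zero>\<^bsub>V\<^esub> = x"
proof -
  interpret abelian_group V by fact
  have "\<ominus>\<^bsub>V\<^esub> \<zero>\<^bsub>V\<^esub> = \<zero>\<^bsub>V\<^esub>" using minus_equality[OF r_zero[OF zero_closed]] by simp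
  then show ?thesis using assms(2) by (simp add: a_minus_def)
qed

text \<open>Well-definedness of an induced map on a quotient. The scalar multiplication, the
  structure maps and the induced maps of cohomology are all defined by unions of this shape. The
  coset contains z, so the union is not empty, and it is enough to compare each other element with
  z.\<close>

lemma UN_coset_const:
  assumes B: "abelian_subgroup B V" and z: "z \<in> carrier V" and B': "abelian_subgroup B' W"
    and \<phi>: "\<And>x. x \<in> carrier V \<Longrightarrow> \<phi> x \<in> carrier W"
    and "\<And>x. x \<in> carrier V \<Longrightarrow> x \<ominus>\<^bsub>V\<^esub> z \<in> B \<Longrightarrow> \<phi> x \<ominus>\<^bsub>W\<^esub> \<phi> z \<in> B'"
  shows "(\<Union>x\<in>B +>\<^bsub>V\<^esub> z. B' +>\<^bsub>W\<^esub> \<phi> x) = B' +>\<^bsub>W\<^esub> \<phi> z"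
proof -
  interpret V: abelian_subgroup B V by fact
  have "B' +>\<^bsub>W\<^esub> \<phi> x = B' +>\<^bsub>W\<^esub> \<phi> z" if x: "x \<in> B +>\<^bsub>V\<^esub> z" for x
  proof -
    have xc: "x \<in> carrier V" using V.a_elemrcos_carrier[OF z x] .
    then have "x \<ominus>\<^bsub>V\<^esub> z \<in> B"
      using V.a_rcos_module_imp[OF z x] by (simp add: a_minus_def)
    with assms(5) xc show ?thesis by (simp add: coset_eq_iff[OF B' \<phi>[OF xc] \<phi>[OF z]])
  qed
  then show ?thesis using V.a_rcos_self[OF z] by blast
qed

section \<open>Operations of cohomology on representatives\<close>

lemma cohomology_simps [simp]:
  "carrier (sp (cohomology X i) t) =
    {coboundaries X i t +>\<^bsub>sp (ob X i) t\<^esub> z | z. z \<in> cocycles X i t}"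
  "\<zero>\<^bsub>sp (cohomology X i) t\<^esub> = coboundaries X i t"
  "C \<oplus>\<^bsub>sp (cohomology X i) t\<^esub> D = C <+>\<^bsub>sp (ob X i) t\<^esub> D"
  by (simp_all add: cohomology_def cohom_space_def subquotient_def)

lemma cohomology_add:
  assumes "cochain_complex K X" "x \<in> cocycles X i t" "y \<in> cocycles X i t"
  shows "(coboundaries X i t +>\<^bsub>sp (ob X i) t\<^esub> x) <+>\<^bsub>sp (ob X i) t\<^esub>
      (coboundaries X i t +>\<^bsub>sp (ob X i) t\<^esub> y) =
    coboundaries X i t +>\<^bsub>sp (ob X i) t\<^esub> (x \<oplus>\<^bsub>sp (ob X i) t\<^esub> y)"
  by (rule abelian_subgroup.a_rcos_sum[OF coboundaries_subgroup[OF assms(1)]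
        cocycles_closed[OF assms(2)] cocycles_closed[OF assms(3)]])

lemma cohomology_smult:
  assumes X: "cochain_complex K X" and a: "a \<in> carrier K" and x: "x \<in> cocycles X i t"
  shows "a \<odot>\<^bsub>sp (cohomology X i) t\<^esub> (coboundaries X i t +>\<^bsub>sp (ob X i) t\<^esub> x) =
    coboundaries X i t +>\<^bsub>sp (ob X i) t\<^esub> (a \<odot>\<^bsub>sp (ob X i) t\<^esub> x)"
proof -
  interpret V: abelian_group "sp (ob X i) t" by (rule cpx_group[OF X])
  note m = pmod_module[OF cpx_pmod[OF X]]
  have "a \<odot>\<^bsub>sp (ob X i) t\<^esub> y \<ominus>\<^bsub>sp (ob X i) t\<^esub> a \<odot>\<^bsub>sp (ob X i) t\<^esub> x =
      a \<odot>\<^bsub>sp (ob X i) t\<^esub> (y \<ominus>\<^bsub>sp (ob X i) t\<^esub> x)" if "y \<in> carrier (sp (ob X i) t)" for y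
    using that cocycles_closed[OF x] a
    by (simp add: a_minus_def Module.module.smult_r_distr[OF m] Module.module.smult_r_minus[OF m])
  then have "(\<Union>y\<in>coboundaries X i t +>\<^bsub>sp (ob X i) t\<^esub> x.
      coboundaries X i t +>\<^bsub>sp (ob X i) t\<^esub> (a \<odot>\<^bsub>sp (ob X i) t\<^esub> y)) =
    coboundaries X i t +>\<^bsub>sp (ob X i) t\<^esub> (a \<odot>\<^bsub>sp (ob X i) t\<^esub> x)"
    by (intro UN_coset_const coboundaries_subgroup[OF X] cocycles_closed[OF x])
      (simp_all add: pmod_smult_closed[OF cpx_pmod[OF X] a] coboundaries_smult[OF X a])
  then show ?thesis by (simp add: cohomology_def cohom_space_def subquotient_def)
qed

lemma cohomology_mp:
  assumes X: "cochain_complex K X" and st: "s \<le> t" and x: "x \<in> cocycles X i s"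
  shows "mp (cohomology X i) s t (coboundaries X i s +>\<^bsub>sp (ob X i) s\<^esub> x) =
    coboundaries X i t +>\<^bsub>sp (ob X i) t\<^esub> mp (ob X i) s t x"
proof -
  interpret V: abelian_group "sp (ob X i) s" by (rule cpx_group[OF X])
  note m = pmod_mp[OF cpx_pmod[OF X] st]
  have "mp (ob X i) s t y \<ominus>\<^bsub>sp (ob X i) t\<^esub> mp (ob X i) s t x = mp (ob X i) s t (y \<ominus>\<^bsub>sp (ob X i) s\<^esub> x)"
    if "y \<in> carrier (sp (ob X i) s)" for y
    using that cocycles_closed[OF x] by (simp add: a_minus_def m)
  then have "(\<Union>y\<in>coboundaries X i s +>\<^bsub>sp (ob X i) s\<^esub> x.
      coboundaries X i t +>\<^bsub>sp (ob X i) t\<^esub> mp (ob X i) s t y) =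
    coboundaries X i t +>\<^bsub>sp (ob X i) t\<^esub> mp (ob X i) s t x"
    by (intro UN_coset_const coboundaries_subgroup[OF X] cocycles_closed[OF x])
      (simp_all add: m mp_coboundaries[OF X st])
  moreover have "coboundaries X i s +>\<^bsub>sp (ob X i) s\<^esub> x \<in> carrier (cohom_space X i s)"
    using x by (auto simp: cohom_space_def subquotient_def)
  ultimately show ?thesis by (simp add: cohomology_def)
qed

lemma cohom_map_coset:
  assumes X: "cochain_complex K X" and Y: "cochain_complex K Y" and f: "f \<in> chain_maps K X Y"
    and x: "x \<in> cocycles X i t"
  shows "cohom_map X Y f i t (coboundaries X i t +>\<^bsub>sp (ob X i) t\<^esub> x) =
    coboundaries Y i t +>\<^bsub>sp (ob Y i) t\<^esub> f i t x"
proof -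
  have "(\<Union>y\<in>coboundaries X i t +>\<^bsub>sp (ob X i) t\<^esub> x. coboundaries Y i t +>\<^bsub>sp (ob Y i) t\<^esub> f i t y) =
      coboundaries Y i t +>\<^bsub>sp (ob Y i) t\<^esub> f i t x"
    by (intro UN_coset_const coboundaries_subgroup[OF X] coboundaries_subgroup[OF Y] cocycles_closed[OF x])
      (simp_all add: chain_map_closed[OF f] chain_map_coboundaries[OF f]
        chain_map_minus[OF f X Y _ cocycles_closed[OF x], symmetric])
  moreover have "coboundaries X i t +>\<^bsub>sp (ob X i) t\<^esub> x \<in> carrier (cohom_space X i t)"
    using x by (auto simp: cohom_space_def subquotient_def)
  ultimately show ?thesis by (simp add: cohom_map_def)
qed

lemma cohom_map_hom:
  assumes X: "cochain_complex K X" and Y: "cochain_complex K Y" and f: "f \<in> chain_maps K X Y"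
  shows "cohom_map X Y f i \<in> pers_hom K (cohomology X i) (cohomology Y i)"
proof (rule pers_homI)
  fix t C assume "C \<in> carrier (sp (cohomology X i) t)"
  then show "cohom_map X Y f i t C \<in> carrier (sp (cohomology Y i) t)"
    using chain_map_cocycles[OF X Y f] by (auto simp: cohom_map_coset[OF X Y f])
next
  fix t C assume "C \<notin> carrier (sp (cohomology X i) t)"
  then show "cohom_map X Y f i t C = undefined"
    by (auto simp: cohom_map_def cohom_space_def subquotient_def)
next
  fix t C D assume "C \<in> carrier (sp (cohomology X i) t)" "D \<in> carrier (sp (cohomology X i) t)"
  then obtain x y where "x \<in> cocycles X i t" "C = coboundaries X i t +>\<^bsub>sp (ob X i) t\<^esub> x"
    "y \<in> cocycles X i t" "D = coboundaries X i t +>\<^bsub>sp (ob X i) t\<^esub> y" by auto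
  then show "cohom_map X Y f i t (C \<oplus>\<^bsub>sp (cohomology X i) t\<^esub> D) =
      cohom_map X Y f i t C \<oplus>\<^bsub>sp (cohomology Y i) t\<^esub> cohom_map X Y f i t D"
    by (simp add: cohomology_add[OF X] cohomology_add[OF Y] cohom_map_coset[OF X Y f] cocycles_add[OF X]
        chain_map_cocycles[OF X Y f] pers_homD(3)[OF chain_maps_hom[OF f]] cocycles_closed)
next
  fix t a C assume a: "a \<in> carrier K" and "C \<in> carrier (sp (cohomology X i) t)"
  then obtain x where "x \<in> cocycles X i t" "C = coboundaries X i t +>\<^bsub>sp (ob X i) t\<^esub> x" by auto
  with a show "cohom_map X Y f i t (a \<odot>\<^bsub>sp (cohomology X i) t\<^esub> C) =
      a \<odot>\<^bsub>sp (cohomology Y i) t\<^esub> cohom_map X Y f i t C"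
    by (simp add: cohomology_smult[OF X] cohomology_smult[OF Y] cohom_map_coset[OF X Y f]
        cocycles_smult[OF X] chain_map_cocycles[OF X Y f] pers_homD(4)[OF chain_maps_hom[OF f]]
        cocycles_closed)
next
  fix s t C assume st: "s \<le> t" and "C \<in> carrier (sp (cohomology X i) s)"
  then obtain x where "x \<in> cocycles X i s" "C = coboundaries X i s +>\<^bsub>sp (ob X i) s\<^esub> x" by auto
  then show "cohom_map X Y f i t (mp (cohomology X i) s t C) =
      mp (cohomology Y i) s t (cohom_map X Y f i s C)"
    by (simp add: cohomology_mp[OF X st] cohomology_mp[OF Y st] cohom_map_coset[OF X Y f]
        mp_cocycles[OF X st] chain_map_cocycles[OF X Y f] pers_homD(5)[OF chain_maps_hom[OF f] st]
        cocycles_closed)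
qed

text \<open>A pointwise bijective natural transformation has a natural inverse. Of M only three
  closure properties are asked, so the criterion applies to \<open>cohomology X i\<close> without
  first showing that this is a persistence module.\<close>

lemma pers_iso_bij:
  fixes M :: "('n::finite,'k,'v) pmod"
  assumes \<phi>: "\<phi> \<in> pers_hom K M N"
    and bij: "\<And>t. bij_betw (\<phi> t) (carrier (sp M t)) (carrier (sp N t))"
    and add: "\<And>t x y. x \<in> carrier (sp M t) \<Longrightarrow> y \<in> carrier (sp M t) \<Longrightarrow> x \<oplus>\<^bsub>sp M t\<^esub> y \<in> carrier (sp M t)"
    and smult: "\<And>t a x. a \<in> carrier K \<Longrightarrow> x \<in> carrier (sp M t) \<Longrightarrow> a \<odot>\<^bsub>sp M t\<^esub> x \<in> carrier (sp M t)"
    and mp: "\<And>s t x. s \<le> t \<Longrightarrow> x \<in> carrier (sp M s) \<Longrightarrow> mp M s t x \<in> carrier (sp M t)"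
  shows "pers_iso K M N \<phi>"
proof -
  define \<psi> where "\<psi> = (\<lambda>t. \<lambda>y\<in>carrier (sp N t). inv_into (carrier (sp M t)) (\<phi> t) y)"
  have \<psi>: "\<psi> t y \<in> carrier (sp M t)" "\<phi> t (\<psi> t y) = y" if "y \<in> carrier (sp N t)" for t y
    using bij_betw_inv_into_right[OF bij that] bij_betw_apply[OF bij_betw_inv_into[OF bij] that] that
    by (simp_all add: \<psi>_def)
  \<comment> \<open>Linearity and naturality of the inverse are checked after applying
    \<open>\<phi>\<close>: two elements with the same image coincide.\<close>
  have \<psi>_eqI: "\<psi> t y = x" if "x \<in> carrier (sp M t)" "y = \<phi> t x" for t x y
    using bij_betw_inv_into_left[OF bij that(1)] pers_homD(1)[OF \<phi> that(1)] that
    by (simp add: \<psi>_def)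
  have "\<psi> \<in> pers_hom K N M"
  proof (rule pers_homI)
    show "\<psi> t y \<in> carrier (sp M t)" if "y \<in> carrier (sp N t)" for t y by (rule \<psi>(1)[OF that])
    show "\<psi> t y = undefined" if "y \<notin> carrier (sp N t)" for t y using that by (simp add: \<psi>_def)
    show "\<psi> t (x \<oplus>\<^bsub>sp N t\<^esub> y) = \<psi> t x \<oplus>\<^bsub>sp M t\<^esub> \<psi> t y"
      if "x \<in> carrier (sp N t)" "y \<in> carrier (sp N t)" for t x y
      using that by (intro \<psi>_eqI) (simp_all add: \<psi> add pers_homD(3)[OF \<phi>])
    show "\<psi> t (a \<odot>\<^bsub>sp N t\<^esub> y) = a \<odot>\<^bsub>sp M t\<^esub> \<psi> t y"
      if "a \<in> carrier K" "y \<in> carrier (sp N t)" for t a y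
      using that by (intro \<psi>_eqI) (simp_all add: \<psi> smult pers_homD(4)[OF \<phi>])
    show "\<psi> t (mp N s t y) = mp M s t (\<psi> s y)" if "s \<le> t" "y \<in> carrier (sp N s)" for s t y
      using that by (intro \<psi>_eqI) (simp_all add: \<psi> mp pers_homD(5)[OF \<phi>])
  qed
  moreover have "pers_comp M \<psi> \<phi> = pers_id M" "pers_comp N \<phi> \<psi> = pers_id N"
    unfolding pers_comp_def pers_id_def compose_def
    by (rule ext, rule restrict_ext, simp add: \<psi>_eqI \<psi>)+
  ultimately show ?thesis using \<phi> unfolding pers_iso_def by blast
qed

text \<open>Injectivity and surjectivity of the induced maps on cohomology, expressed through
  representatives so that no cosets occur.\<close>

definition cohom_bij :: "('n::finite,'k,'v) cpx \<Rightarrow> ('n,'k,'v) cpx \<Rightarrow> ('n,'v) cmap \<Rightarrow> bool" where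
  "cohom_bij X Y f \<longleftrightarrow> (\<forall>i t.
     (\<forall>x\<in>cocycles X i t. f i t x \<in> coboundaries Y i t \<longrightarrow> x \<in> coboundaries X i t) \<and>
     (\<forall>y\<in>cocycles Y i t. \<exists>x\<in>cocycles X i t. y \<ominus>\<^bsub>sp (ob Y i) t\<^esub> f i t x \<in> coboundaries Y i t))"

text \<open>Replaces isomorphisms of cohomology modules by a condition suited to diagram chases. An
  inverse on cohomology gives pointwise bijectivity, and \<open>pers_iso_bij\<close> gives the
  converse.\<close>

lemma quasi_iso_iff:
  assumes X: "cochain_complex K X" and Y: "cochain_complex K Y" and f: "f \<in> chain_maps K X Y"
  shows "quasi_iso K X Y f \<longleftrightarrow> cohom_bij X Y f"
proof
  assume q: "quasi_iso K X Y f"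
  show "cohom_bij X Y f"
    unfolding cohom_bij_def
  proof (intro allI conjI ballI impI)
    fix i t
    obtain \<psi> where \<psi>: "\<psi> \<in> pers_hom K (cohomology Y i) (cohomology X i)"
      and l: "pers_comp (cohomology X i) \<psi> (cohom_map X Y f i) = pers_id (cohomology X i)"
      and r: "pers_comp (cohomology Y i) (cohom_map X Y f i) \<psi> = pers_id (cohomology Y i)"
      using q unfolding quasi_iso_def pers_iso_def by blast
    have l': "\<psi> t (cohom_map X Y f i t C) = C" if "C \<in> carrier (sp (cohomology X i) t)" for C
      using fun_cong[OF fun_cong[OF l, of t], of C] that
      by (simp add: pers_comp_def pers_id_def compose_def del: cohomology_simps)
    have r': "cohom_map X Y f i t (\<psi> t C) = C" if "C \<in> carrier (sp (cohomology Y i) t)" for C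
      using fun_cong[OF fun_cong[OF r, of t], of C] that
      by (simp add: pers_comp_def pers_id_def compose_def del: cohomology_simps)
    interpret V: abelian_group "sp (ob X i) t" by (rule cpx_group[OF X])
    interpret W: abelian_group "sp (ob Y i) t" by (rule cpx_group[OF Y])
    note BX = coboundaries_subgroup[OF X] and BY = coboundaries_subgroup[OF Y]
    {
      fix x assume x: "x \<in> cocycles X i t" and fx: "f i t x \<in> coboundaries Y i t"
      note f0 = pers_hom_zero[OF chain_maps_hom[OF f] cpx_pmod[OF X] cpx_pmod[OF Y]]
      \<comment> \<open>The classes of x and of zero have the same image in the cohomology of Y, so
        applying the inverse \<open>\<psi>\<close> identifies them.\<close>
      have "coboundaries Y i t +>\<^bsub>sp (ob Y i) t\<^esub> f i t x =
          coboundaries Y i t +>\<^bsub>sp (ob Y i) t\<^esub> f i t \<zero>\<^bsub>sp (ob X i) t\<^esub>"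
        using fx cocycles_closed[OF x]
        by (simp add: coset_eq_iff[OF BY] f0 chain_map_closed[OF f] minus_zero_right[OF W.abelian_group_axioms])
      then have "coboundaries X i t +>\<^bsub>sp (ob X i) t\<^esub> x = coboundaries X i t +>\<^bsub>sp (ob X i) t\<^esub> \<zero>\<^bsub>sp (ob X i) t\<^esub>"
        using l'[of "coboundaries X i t +>\<^bsub>sp (ob X i) t\<^esub> x"] x cocycles_zero[OF X, of i t]
          l'[of "coboundaries X i t +>\<^bsub>sp (ob X i) t\<^esub> \<zero>\<^bsub>sp (ob X i) t\<^esub>"]
        by (auto simp: cohom_map_coset[OF X Y f])
      then show "x \<in> coboundaries X i t"
        using cocycles_closed[OF x] by (simp add: coset_eq_iff[OF BX] minus_zero_right[OF V.abelian_group_axioms])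
    next
      fix y assume y: "y \<in> cocycles Y i t"
      let ?C = "coboundaries Y i t +>\<^bsub>sp (ob Y i) t\<^esub> y"
      have C: "?C \<in> carrier (sp (cohomology Y i) t)" using y by auto
      obtain x where x: "x \<in> cocycles X i t" "\<psi> t ?C = coboundaries X i t +>\<^bsub>sp (ob X i) t\<^esub> x"
        using pers_homD(1)[OF \<psi> C] by auto
      have "?C = coboundaries Y i t +>\<^bsub>sp (ob Y i) t\<^esub> f i t x"
        using r'[OF C] x by (simp add: cohom_map_coset[OF X Y f])
      then have "y \<ominus>\<^bsub>sp (ob Y i) t\<^esub> f i t x \<in> coboundaries Y i t"
        using cocycles_closed[OF x(1)] cocycles_closed[OF y]
        by (simp add: coset_eq_iff[OF BY] chain_map_closed[OF f])
      with x(1) show "\<exists>x\<in>cocycles X i t. y \<ominus>\<^bsub>sp (ob Y i) t\<^esub> f i t x \<in> coboundaries Y i t" by blast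
    }
  qed
next
  assume b: "cohom_bij X Y f"
  note BX = coboundaries_subgroup[OF X] and BY = coboundaries_subgroup[OF Y]
  have "pers_iso K (cohomology X i) (cohomology Y i) (cohom_map X Y f i)" for i
  proof (rule pers_iso_bij[OF cohom_map_hom[OF X Y f]])
    fix t
    have "inj_on (cohom_map X Y f i t) (carrier (sp (cohomology X i) t))"
    proof (rule inj_onI)
      fix C D assume "C \<in> carrier (sp (cohomology X i) t)" "D \<in> carrier (sp (cohomology X i) t)"
        and e: "cohom_map X Y f i t C = cohom_map X Y f i t D"
      then obtain x y where xy: "x \<in> cocycles X i t" "C = coboundaries X i t +>\<^bsub>sp (ob X i) t\<^esub> x"
        "y \<in> cocycles X i t" "D = coboundaries X i t +>\<^bsub>sp (ob X i) t\<^esub> y" by auto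
      note c = cocycles_closed[OF xy(1)] cocycles_closed[OF xy(3)]
      have "f i t (x \<ominus>\<^bsub>sp (ob X i) t\<^esub> y) \<in> coboundaries Y i t"
        using e xy c by (simp add: cohom_map_coset[OF X Y f] coset_eq_iff[OF BY] chain_map_closed[OF f]
            chain_map_minus[OF f X Y])
      then have "x \<ominus>\<^bsub>sp (ob X i) t\<^esub> y \<in> coboundaries X i t"
        using b cocycles_minus[OF X xy(1,3)] unfolding cohom_bij_def by blast
      then show "C = D" using xy c by (simp add: coset_eq_iff[OF BX])
    qed
    moreover have "C \<in> cohom_map X Y f i t ` carrier (sp (cohomology X i) t)"
      if "C \<in> carrier (sp (cohomology Y i) t)" for C
    proof -
      from that obtain y where y: "y \<in> cocycles Y i t" "C = coboundaries Y i t +>\<^bsub>sp (ob Y i) t\<^esub> y" by auto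
      then obtain x where x: "x \<in> cocycles X i t" "y \<ominus>\<^bsub>sp (ob Y i) t\<^esub> f i t x \<in> coboundaries Y i t"
        using b unfolding cohom_bij_def by blast
      then have "C = cohom_map X Y f i t (coboundaries X i t +>\<^bsub>sp (ob X i) t\<^esub> x)"
        using y cocycles_closed[OF x(1)] cocycles_closed[OF y(1)]
        by (simp add: cohom_map_coset[OF X Y f] coset_eq_iff[OF BY] chain_map_closed[OF f])
      then show ?thesis using x(1) by auto
    qed
    ultimately show "bij_betw (cohom_map X Y f i t) (carrier (sp (cohomology X i) t)) (carrier (sp (cohomology Y i) t))"
      using pers_homD(1)[OF cohom_map_hom[OF X Y f]] unfolding bij_betw_def by blast
  next
    show "C \<oplus>\<^bsub>sp (cohomology X i) t\<^esub> D \<in> carrier (sp (cohomology X i) t)"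
      if "C \<in> carrier (sp (cohomology X i) t)" "D \<in> carrier (sp (cohomology X i) t)" for t C D
      using that cocycles_add[OF X] by (auto simp: cohomology_add[OF X])
    show "a \<odot>\<^bsub>sp (cohomology X i) t\<^esub> C \<in> carrier (sp (cohomology X i) t)"
      if "a \<in> carrier K" "C \<in> carrier (sp (cohomology X i) t)" for t a C
      using that cocycles_smult[OF X] by (auto simp: cohomology_smult[OF X])
    show "mp (cohomology X i) s t C \<in> carrier (sp (cohomology X i) t)"
      if "s \<le> t" "C \<in> carrier (sp (cohomology X i) s)" for s t C
      using that mp_cocycles[OF X] by (auto simp: cohomology_mp[OF X])
  qed
  with f show "quasi_iso K X Y f" unfolding quasi_iso_def by blast
qed

section \<open>Homotopy invariance and two out of three\<close>

lemma subgroup_minus_trans: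
  assumes "abelian_subgroup B V" "x \<in> carrier V" "y \<in> carrier V" "z \<in> carrier V"
    and "x \<ominus>\<^bsub>V\<^esub> y \<in> B" "y \<ominus>\<^bsub>V\<^esub> z \<in> B"
  shows "x \<ominus>\<^bsub>V\<^esub> z \<in> B"
  using assms(5,6) by (simp add: coset_eq_iff[OF assms(1), symmetric] assms(2-4))

lemma subgroup_minus_mem_iff:
  assumes "abelian_subgroup B V" "x \<in> carrier V" "y \<in> carrier V" "x \<ominus>\<^bsub>V\<^esub> y \<in> B"
  shows "x \<in> B \<longleftrightarrow> y \<in> B"
proof -
  interpret abelian_subgroup B V by fact
  have z: "x \<ominus>\<^bsub>V\<^esub> \<zero>\<^bsub>V\<^esub> = x" "y \<ominus>\<^bsub>V\<^esub> \<zero>\<^bsub>V\<^esub> = y"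
    using assms(2,3) by (simp_all add: minus_zero_right[OF abelian_group_axioms])
  show ?thesis
    using assms(4) coset_eq_iff[OF assms(1-3)] coset_eq_iff[OF assms(1,2) zero_closed]
      coset_eq_iff[OF assms(1,3) zero_closed] z by metis
qed

lemma cohom_bijD:
  assumes "cohom_bij X Y f"
  shows "\<And>i t x. x \<in> cocycles X i t \<Longrightarrow> f i t x \<in> coboundaries Y i t \<Longrightarrow> x \<in> coboundaries X i t"
    and "\<And>i t y. y \<in> cocycles Y i t \<Longrightarrow>
      \<exists>x\<in>cocycles X i t. y \<ominus>\<^bsub>sp (ob Y i) t\<^esub> f i t x \<in> coboundaries Y i t"
  using assms unfolding cohom_bij_def by blast+

text \<open>On a cocycle the term of the homotopy equation that contains the differential of X
  vanishes, and the other term is a coboundary.\<close>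

lemma homotopy_cohomologous:
  assumes X: "cochain_complex K X" and Y: "cochain_complex K Y"
    and "(f, g) \<in> homotopy K X Y" and x: "x \<in> cocycles X i t"
  shows "f i t x \<ominus>\<^bsub>sp (ob Y i) t\<^esub> g i t x \<in> coboundaries Y i t"
proof -
  from assms(3) obtain h where h: "\<forall>i. h i \<in> pers_hom K (ob X i) (ob Y (i - 1))"
    and e: "\<forall>i t. \<forall>x\<in>carrier (sp (ob X i) t).
           f i t x \<ominus>\<^bsub>sp (ob Y i) t\<^esub> g i t x =
             df Y (i - 1) t (h i t x) \<oplus>\<^bsub>sp (ob Y i) t\<^esub> h (i + 1) t (df X i t x)"
    by (rule homotopyE)
  interpret abelian_group "sp (ob Y i) t" by (rule cpx_group[OF Y])
  note hx = pers_homD(1)[OF h[rule_format] cocycles_closed[OF x]]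
  have "h (i + 1) t (df X i t x) = \<zero>\<^bsub>sp (ob Y i) t\<^esub>"
    using pers_hom_zero[OF h[rule_format, of "i + 1"] cpx_pmod[OF X] cpx_pmod[OF Y]]
    by (simp add: cocycles_df[OF x])
  then have "f i t x \<ominus>\<^bsub>sp (ob Y i) t\<^esub> g i t x = df Y (i - 1) t (h i t x)"
    using e[rule_format, OF cocycles_closed[OF x]] df_closed_pred[OF Y hx] by simp
  then show ?thesis using hx by (simp add: coboundaries_def)
qed

lemma cohom_bij_homotopic:
  assumes X: "cochain_complex K X" and Y: "cochain_complex K Y"
    and fg: "(f, g) \<in> homotopy K X Y" and b: "cohom_bij X Y f"
  shows "cohom_bij X Y g"
  unfolding cohom_bij_def
proof (intro allI conjI ballI impI)
  have f: "f \<in> chain_maps K X Y" and g: "g \<in> chain_maps K X Y"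
    using fg by (auto simp: homotopy_def)
  note BY = coboundaries_subgroup[OF Y]
  fix i t x assume x: "x \<in> cocycles X i t" and gx: "g i t x \<in> coboundaries Y i t"
  show "x \<in> coboundaries X i t"
    using subgroup_minus_mem_iff[OF BY chain_map_closed[OF f cocycles_closed[OF x]]
        chain_map_closed[OF g cocycles_closed[OF x]] homotopy_cohomologous[OF X Y fg x]] gx
      cohom_bijD(1)[OF b x] by simp
next
  have f: "f \<in> chain_maps K X Y" and g: "g \<in> chain_maps K X Y"
    using fg by (auto simp: homotopy_def)
  note BY = coboundaries_subgroup[OF Y]
  fix i t y assume y: "y \<in> cocycles Y i t"
  then obtain x where x: "x \<in> cocycles X i t" "y \<ominus>\<^bsub>sp (ob Y i) t\<^esub> f i t x \<in> coboundaries Y i t"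
    using cohom_bijD(2)[OF b] by blast
  have "y \<ominus>\<^bsub>sp (ob Y i) t\<^esub> g i t x \<in> coboundaries Y i t"
    by (rule subgroup_minus_trans[OF BY cocycles_closed[OF y]
          chain_map_closed[OF f cocycles_closed[OF x(1)]]
          chain_map_closed[OF g cocycles_closed[OF x(1)]] x(2) homotopy_cohomologous[OF X Y fg x(1)]])
  with x(1) show "\<exists>x\<in>cocycles X i t. y \<ominus>\<^bsub>sp (ob Y i) t\<^esub> g i t x \<in> coboundaries Y i t" by blast
qed

lemma cohom_bij_id:
  assumes X: "cochain_complex K X"
  shows "cohom_bij X X (chain_id X)"
proof -
  have "y \<ominus>\<^bsub>sp (ob X i) t\<^esub> y \<in> coboundaries X i t" if "y \<in> cocycles X i t" for i t y
    using coset_eq_iff[OF coboundaries_subgroup[OF X], of y] cocycles_closed[OF that] by blast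
  moreover have "chain_id X i t x = x" if "x \<in> cocycles X i t" for i t x
    using cocycles_closed[OF that] by (simp add: chain_id_def pers_id_def)
  ultimately show ?thesis unfolding cohom_bij_def by metis
qed

lemma cohom_bij_comp:
  assumes X: "cochain_complex K X" and Y: "cochain_complex K Y" and Z: "cochain_complex K Z"
    and f: "f \<in> chain_maps K X Y" and g: "g \<in> chain_maps K Y Z"
    and bf: "cohom_bij X Y f" and bg: "cohom_bij Y Z g"
  shows "cohom_bij X Z (chain_comp X g f)"
  unfolding cohom_bij_def
proof (intro allI conjI ballI impI)
  fix i t x assume x: "x \<in> cocycles X i t" and "chain_comp X g f i t x \<in> coboundaries Z i t"
  then show "x \<in> coboundaries X i t"
    using cohom_bijD(1)[OF bg chain_map_cocycles[OF X Y f x]] cohom_bijD(1)[OF bf x]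
    by (simp add: chain_comp_apply[OF cocycles_closed[OF x]])
next
  fix i t z assume z: "z \<in> cocycles Z i t"
  then obtain y where y: "y \<in> cocycles Y i t" "z \<ominus>\<^bsub>sp (ob Z i) t\<^esub> g i t y \<in> coboundaries Z i t"
    using cohom_bijD(2)[OF bg] by blast
  then obtain x where x: "x \<in> cocycles X i t" "y \<ominus>\<^bsub>sp (ob Y i) t\<^esub> f i t x \<in> coboundaries Y i t"
    using cohom_bijD(2)[OF bf] by blast
  note fx = chain_map_cocycles[OF X Y f x(1)]
  have "g i t y \<ominus>\<^bsub>sp (ob Z i) t\<^esub> g i t (f i t x) \<in> coboundaries Z i t"
    using chain_map_coboundaries[OF g x(2)]
    by (simp add: chain_map_minus[OF g Y Z cocycles_closed[OF y(1)] cocycles_closed[OF fx]])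
  then have "z \<ominus>\<^bsub>sp (ob Z i) t\<^esub> g i t (f i t x) \<in> coboundaries Z i t"
    by (rule subgroup_minus_trans[OF coboundaries_subgroup[OF Z] cocycles_closed[OF z]
          chain_map_closed[OF g cocycles_closed[OF y(1)]]
          chain_map_closed[OF g cocycles_closed[OF fx]] y(2)])
  then show "\<exists>x\<in>cocycles X i t. z \<ominus>\<^bsub>sp (ob Z i) t\<^esub> chain_comp X g f i t x \<in> coboundaries Z i t"
    using x(1) chain_comp_apply[OF cocycles_closed[OF x(1)]] by metis
qed

text \<open>Injectivity of f is inherited from the composite, as g preserves coboundaries. For
  surjectivity, the image of y under g is cohomologous to the image of some x under the composite,
  and injectivity of g on cohomology moves this relation back to Y.\<close>

lemma cohom_bij_cancel:
  assumes X: "cochain_complex K X" and Y: "cochain_complex K Y" and Z: "cochain_complex K Z"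
    and f: "f \<in> chain_maps K X Y" and g: "g \<in> chain_maps K Y Z"
    and bg: "cohom_bij Y Z g" and bgf: "cohom_bij X Z (chain_comp X g f)"
  shows "cohom_bij X Y f"
  unfolding cohom_bij_def
proof (intro allI conjI ballI impI)
  fix i t x assume x: "x \<in> cocycles X i t" and "f i t x \<in> coboundaries Y i t"
  then show "x \<in> coboundaries X i t"
    using cohom_bijD(1)[OF bgf x] chain_map_coboundaries[OF g]
    by (simp add: chain_comp_apply[OF cocycles_closed[OF x]])
next
  fix i t y assume y: "y \<in> cocycles Y i t"
  obtain x where x: "x \<in> cocycles X i t"
      "g i t y \<ominus>\<^bsub>sp (ob Z i) t\<^esub> g i t (f i t x) \<in> coboundaries Z i t"
    using cohom_bijD(2)[OF bgf chain_map_cocycles[OF Y Z g y]] chain_comp_apply[OF cocycles_closed]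
    by metis
  note fx = chain_map_cocycles[OF X Y f x(1)]
  have "y \<ominus>\<^bsub>sp (ob Y i) t\<^esub> f i t x \<in> coboundaries Y i t"
    using cohom_bijD(1)[OF bg cocycles_minus[OF Y y fx]] x(2)
    by (simp add: chain_map_minus[OF g Y Z cocycles_closed[OF y] cocycles_closed[OF fx]])
  with x(1) show "\<exists>x\<in>cocycles X i t. y \<ominus>\<^bsub>sp (ob Y i) t\<^esub> f i t x \<in> coboundaries Y i t" by blast
qed

text \<open>The condition is imposed at each point t separately, so a shift merely reindexes it.
  This is the form in which exactness of the shift enters.\<close>

lemma cohom_bij_shift: "cohom_bij X Y f \<Longrightarrow> cohom_bij (cpx_shift \<epsilon> X) (cpx_shift \<epsilon> Y) (chain_shift \<epsilon> f)"
  by (simp add: cohom_bij_def cocycles_def coboundaries_def)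

section \<open>Quasi-isomorphisms in the homotopy category\<close>

lemma K_quasi_isos_hom: "F \<in> K_quasi_isos K X Y \<Longrightarrow> F \<in> K_hom K X Y"
  by (simp add: K_quasi_isos_def)

text \<open>A class contains a quasi-isomorphism iff any given representative is one, because
  homotopic maps agree on cohomology.\<close>

lemma K_quasi_isos_class_iff:
  assumes X: "cochain_complex K X" and Y: "cochain_complex K Y" and f: "f \<in> chain_maps K X Y"
  shows "K_class K X Y f \<in> K_quasi_isos K X Y \<longleftrightarrow> cohom_bij X Y f"
proof
  assume "K_class K X Y f \<in> K_quasi_isos K X Y"
  then obtain g where g: "g \<in> K_class K X Y f" "quasi_iso K X Y g"
    by (auto simp: K_quasi_isos_def)
  have "(g, f) \<in> homotopy K X Y"
    using K_class_memD[OF g(1)] equiv_homotopy[OF X Y] by (auto elim: equivE dest: symD)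
  then show "cohom_bij X Y f"
    using g quasi_iso_iff[OF X Y K_class_mem_chain_maps[OF g(1)]] cohom_bij_homotopic[OF X Y] by blast
next
  assume "cohom_bij X Y f"
  then show "K_class K X Y f \<in> K_quasi_isos K X Y"
    using K_class_self[OF X Y f] K_hom_class[OF f] quasi_iso_iff[OF X Y f]
    by (auto simp: K_quasi_isos_def)
qed

lemma K_quasi_isos_id: "cochain_complex K X \<Longrightarrow> K_id K X \<in> K_quasi_isos K X X"
  unfolding K_id_def by (simp add: K_quasi_isos_class_iff chain_id_map cohom_bij_id)

lemma K_quasi_isos_comp:
  assumes X: "cochain_complex K X" and Y: "cochain_complex K Y" and Z: "cochain_complex K Z"
    and "F \<in> K_quasi_isos K X Y" and "G \<in> K_quasi_isos K Y Z"
  shows "K_comp K X Z G F \<in> K_quasi_isos K X Z"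
proof -
  from assms(4)[THEN K_quasi_isos_hom] obtain f where f: "f \<in> chain_maps K X Y" "F = K_class K X Y f" by (rule K_homE)
  from assms(5)[THEN K_quasi_isos_hom] obtain g where g: "g \<in> chain_maps K Y Z" "G = K_class K Y Z g" by (rule K_homE)
  show ?thesis
    using assms(4,5) cohom_bij_comp[OF X Y Z f(1) g(1)]
    unfolding f(2) g(2) K_comp_class[OF X Y Z f(1) g(1)]
    by (simp add: K_quasi_isos_class_iff[OF X Y f(1)] K_quasi_isos_class_iff[OF Y Z g(1)]
        K_quasi_isos_class_iff[OF X Z chain_comp_map[OF X f(1) g(1)]])
qed

text \<open>Equivalence of roofs only requires the composite of \<open>S\<close> and
  \<open>U\<close> to be a quasi-isomorphism. This recovers the property for \<open>U\<close>, which
  can then be pulled back by the Ore condition.\<close>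

lemma K_quasi_isos_cancel:
  assumes X: "cochain_complex K X" and Y: "cochain_complex K Y" and Z: "cochain_complex K Z"
    and "F \<in> K_hom K X Y" and "G \<in> K_quasi_isos K Y Z" and "K_comp K X Z G F \<in> K_quasi_isos K X Z"
  shows "F \<in> K_quasi_isos K X Y"
proof -
  from assms(4) obtain f where f: "f \<in> chain_maps K X Y" "F = K_class K X Y f" by (rule K_homE)
  from assms(5)[THEN K_quasi_isos_hom] obtain g where g: "g \<in> chain_maps K Y Z" "G = K_class K Y Z g" by (rule K_homE)
  show ?thesis
    using assms(5,6) cohom_bij_cancel[OF X Y Z f(1) g(1)]
    unfolding f(2) g(2) K_comp_class[OF X Y Z f(1) g(1)]
    by (simp add: K_quasi_isos_class_iff[OF X Y f(1)] K_quasi_isos_class_iff[OF Y Z g(1)]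
        K_quasi_isos_class_iff[OF X Z chain_comp_map[OF X f(1) g(1)]])
qed

lemma K_quasi_isos_shift:
  assumes X: "cochain_complex K X" and Y: "cochain_complex K Y" and "F \<in> K_quasi_isos K X Y"
  shows "K_shift K \<epsilon> X Y F \<in> K_quasi_isos K (cpx_shift \<epsilon> X) (cpx_shift \<epsilon> Y)"
proof -
  from assms(3)[THEN K_quasi_isos_hom] obtain f where f: "f \<in> chain_maps K X Y" "F = K_class K X Y f" by (rule K_homE)
  show ?thesis
    using assms(3) cohom_bij_shift
    unfolding f(2) K_shift_class[OF X Y f(1)]
    by (simp add: K_quasi_isos_class_iff[OF X Y f(1)] K_quasi_isos_class_iff[OF
          cochain_complex_shift[OF X] cochain_complex_shift[OF Y] chain_shift_map[OF f(1)]])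
qed

section \<open>Homotopy pullbacks\<close>

text \<open>
  Since \<open>'v\<close> is infinite, a bijection \<open>'v \<rightarrow> 'v \<times> 'v \<times> 'v\<close> realises direct sums of three vector spaces
  inside the fixed universe \<open>'v\<close>.
\<close>

definition untriple :: "'v::infinite \<Rightarrow> 'v \<times> 'v \<times> 'v" where
  "untriple = (SOME f. bij f)"

definition triple :: "'v::infinite \<Rightarrow> 'v \<Rightarrow> 'v \<Rightarrow> 'v" where
  "triple a b c = inv_into UNIV untriple (a, b, c)"

definition pr1 :: "'v::infinite \<Rightarrow> 'v" where "pr1 x = fst (untriple x)"
definition pr2 :: "'v::infinite \<Rightarrow> 'v" where "pr2 x = fst (snd (untriple x))"
definition pr3 :: "'v::infinite \<Rightarrow> 'v" where "pr3 x = snd (snd (untriple x))"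

text \<open>An infinite type is equipotent with its square; using this twice gives a bijection from
  the cube, whose inverse justifies the choice made in \<open>untriple\<close>.\<close>

lemma bij_untriple: "bij (untriple :: 'v::infinite \<Rightarrow> 'v \<times> 'v \<times> 'v)"
proof -
  obtain g :: "'v \<times> 'v \<Rightarrow> 'v" where g: "bij g"
    using card_of_Times_same_infinite[of "UNIV :: 'v set"] infinite_UNIV[where 'a = 'v]
    by (auto simp: card_of_ordIso[symmetric])
  then have "bij (map_prod (id :: 'v \<Rightarrow> 'v) g)"
    by (simp add: bij_def prod.inj_map map_prod_surj)
  then have "bij (g \<circ> map_prod id g)" using g by (rule bij_comp)
  then have "bij (inv_into UNIV (g \<circ> map_prod id g))" by (rule bij_imp_bij_inv)
  then show ?thesis unfolding untriple_def by (rule someI[where P = bij])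
qed

lemma triple_simps [simp]:
  "pr1 (triple a b c) = a" "pr2 (triple a b c) = b" "pr3 (triple a b c) = c"
  "triple (pr1 x) (pr2 x) (pr3 x) = x"
  "triple a b c = triple a' b' c' \<longleftrightarrow> a = a' \<and> b = b' \<and> c = c'"
proof -
  have u: "untriple (triple a b c) = (a, b, c)" for a b c :: 'a
    by (simp add: triple_def bij_untriple bij_is_surj surj_f_inv_f)
  then show "pr1 (triple a b c) = a" "pr2 (triple a b c) = b" "pr3 (triple a b c) = c"
    by (simp_all add: pr1_def pr2_def pr3_def)
  show "triple (pr1 x) (pr2 x) (pr3 x) = x"
    by (simp add: triple_def pr1_def pr2_def pr3_def bij_untriple bij_is_inj)
  show "triple a b c = triple a' b' c' \<longleftrightarrow> a = a' \<and> b = b' \<and> c = c'"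
    using u by (metis Pair_inject)
qed

section \<open>Direct sums of three modules\<close>

definition sum3 :: "('k,'v::infinite) module \<Rightarrow> ('k,'v) module \<Rightarrow> ('k,'v) module \<Rightarrow> ('k,'v) module" where
  "sum3 A B C = \<lparr>carrier = {x. pr1 x \<in> carrier A \<and> pr2 x \<in> carrier B \<and> pr3 x \<in> carrier C},
     mult = undefined, one = undefined, zero = triple \<zero>\<^bsub>A\<^esub> \<zero>\<^bsub>B\<^esub> \<zero>\<^bsub>C\<^esub>,
     add = (\<lambda>x y. triple (pr1 x \<oplus>\<^bsub>A\<^esub> pr1 y) (pr2 x \<oplus>\<^bsub>B\<^esub> pr2 y) (pr3 x \<oplus>\<^bsub>C\<^esub> pr3 y)),
     smult = (\<lambda>a x. triple (a \<odot>\<^bsub>A\<^esub> pr1 x) (a \<odot>\<^bsub>B\<^esub> pr2 x) (a \<odot>\<^bsub>C\<^esub> pr3 x))\<rparr>"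

lemma sum3_simps [simp]:
  "x \<in> carrier (sum3 A B C) \<longleftrightarrow> pr1 x \<in> carrier A \<and> pr2 x \<in> carrier B \<and> pr3 x \<in> carrier C"
  "\<zero>\<^bsub>sum3 A B C\<^esub> = triple \<zero>\<^bsub>A\<^esub> \<zero>\<^bsub>B\<^esub> \<zero>\<^bsub>C\<^esub>"
  "x \<oplus>\<^bsub>sum3 A B C\<^esub> y = triple (pr1 x \<oplus>\<^bsub>A\<^esub> pr1 y) (pr2 x \<oplus>\<^bsub>B\<^esub> pr2 y) (pr3 x \<oplus>\<^bsub>C\<^esub> pr3 y)"
  "a \<odot>\<^bsub>sum3 A B C\<^esub> x = triple (a \<odot>\<^bsub>A\<^esub> pr1 x) (a \<odot>\<^bsub>B\<^esub> pr2 x) (a \<odot>\<^bsub>C\<^esub> pr3 x)"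
  by (simp_all add: sum3_def)

lemma sum3_module:
  assumes "Module.module K A" "Module.module K B" "Module.module K C"
  shows "Module.module K (sum3 A B C)"
proof -
  interpret A: Module.module K A by fact
  interpret B: Module.module K B by fact
  interpret C: Module.module K C by fact
  have "abelian_group (sum3 A B C)"
  proof (rule abelian_groupI)
    fix x assume "x \<in> carrier (sum3 A B C)"
    then show "\<exists>y\<in>carrier (sum3 A B C). y \<oplus>\<^bsub>sum3 A B C\<^esub> x = \<zero>\<^bsub>sum3 A B C\<^esub>"
      by (intro bexI[of _ "triple (\<ominus>\<^bsub>A\<^esub> pr1 x) (\<ominus>\<^bsub>B\<^esub> pr2 x) (\<ominus>\<^bsub>C\<^esub> pr3 x)"])
        (simp_all add: A.l_neg B.l_neg C.l_neg)
  qed (simp_all add: A.a_ac B.a_ac C.a_ac)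
  then show ?thesis
    by (intro moduleI A.R.is_cring)
      (simp_all add: A.smult_l_distr B.smult_l_distr C.smult_l_distr A.smult_r_distr B.smult_r_distr
        C.smult_r_distr A.smult_assoc1 B.smult_assoc1 C.smult_assoc1)
qed

definition pers_sum3 ::
    "('n::finite,'k,'v::infinite) pmod \<Rightarrow> ('n,'k,'v) pmod \<Rightarrow> ('n,'k,'v) pmod \<Rightarrow> ('n,'k,'v) pmod" where
  "pers_sum3 A B C = \<lparr>sp = (\<lambda>t. sum3 (sp A t) (sp B t) (sp C t)),
     mp = (\<lambda>s t. \<lambda>x\<in>carrier (sum3 (sp A s) (sp B s) (sp C s)).
       triple (mp A s t (pr1 x)) (mp B s t (pr2 x)) (mp C s t (pr3 x)))\<rparr>"

lemma pers_sum3_simps [simp]: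
  "sp (pers_sum3 A B C) t = sum3 (sp A t) (sp B t) (sp C t)"
  "mp (pers_sum3 A B C) s t = (\<lambda>x\<in>carrier (sum3 (sp A s) (sp B s) (sp C s)).
       triple (mp A s t (pr1 x)) (mp B s t (pr2 x)) (mp C s t (pr3 x)))"
  by (simp_all add: pers_sum3_def)

lemma persistence_module_sum3:
  assumes A: "persistence_module K A" and B: "persistence_module K B" and C: "persistence_module K C"
  shows "persistence_module K (pers_sum3 A B C)"
  by (rule persistence_moduleI)
    (simp_all add: sum3_module pmod_module[OF A] pmod_module[OF B] pmod_module[OF C]
      pmod_mp(1,3,4)[OF A] pmod_mp(1,3,4)[OF B] pmod_mp(1,3,4)[OF C]
      pmod_mp_refl[OF A] pmod_mp_refl[OF B] pmod_mp_refl[OF C]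
      pmod_mp_trans[OF A] pmod_mp_trans[OF B] pmod_mp_trans[OF C]
      pmod_add_closed[OF A] pmod_add_closed[OF B] pmod_add_closed[OF C]
      pmod_smult_closed[OF A] pmod_smult_closed[OF B] pmod_smult_closed[OF C],
     blast)

section \<open>Subtraction in abelian groups\<close>

lemma (in abelian_group) add_minus_cancel:
  assumes "x \<in> carrier G" "y \<in> carrier G"
  shows "y \<oplus> (x \<ominus> y) = x"
  using assms by (simp add: a_minus_def a_lcomm[of y x] r_neg)

lemma (in abelian_group) minus_eq_zero_iff:
  assumes "x \<in> carrier G" "y \<in> carrier G"
  shows "x \<ominus> y = \<zero> \<longleftrightarrow> x = y"
  using add_minus_cancel[OF assms] assms by (metis a_minus_def r_neg r_zero)

lemma (in abelian_group) minus_minus_cancel: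
  assumes "x \<in> carrier G" "y \<in> carrier G"
  shows "x \<ominus> (x \<ominus> y) = y"
  using assms by (simp add: a_minus_def minus_add r_neg2)

lemma (in abelian_group) minus_minus_assoc:
  assumes "x \<in> carrier G" "y \<in> carrier G" "z \<in> carrier G"
  shows "(x \<ominus> y) \<ominus> z = x \<ominus> (y \<oplus> z)"
  using assms by (simp add: a_minus_def minus_add a_assoc)

text \<open>The cone of \<open>A \<oplus> B \<rightarrow> C\<close>, \<open>(a, b) \<mapsto> f a - s b\<close>, shifted by one degree.\<close>

definition homotopy_pullback ::
    "('n::finite,'k,'v::infinite) cpx \<Rightarrow> ('n,'k,'v) cpx \<Rightarrow> ('n,'k,'v) cpx \<Rightarrow>
     ('n,'v) cmap \<Rightarrow> ('n,'v) cmap \<Rightarrow> ('n,'k,'v) cpx" where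
  "homotopy_pullback A B C f s =
     \<lparr>ob = (\<lambda>i. pers_sum3 (ob A i) (ob B i) (ob C (i - 1))),
      df = (\<lambda>i t. \<lambda>x\<in>carrier (sum3 (sp (ob A i) t) (sp (ob B i) t) (sp (ob C (i - 1)) t)).
        triple (df A i t (pr1 x)) (df B i t (pr2 x))
          ((f i t (pr1 x) \<ominus>\<^bsub>sp (ob C i) t\<^esub> s i t (pr2 x)) \<ominus>\<^bsub>sp (ob C i) t\<^esub> df C (i - 1) t (pr3 x)))\<rparr>"

lemma homotopy_pullback_simps [simp]:
  "ob (homotopy_pullback A B C f s) i = pers_sum3 (ob A i) (ob B i) (ob C (i - 1))"
  "df (homotopy_pullback A B C f s) i t =
     (\<lambda>x\<in>carrier (sum3 (sp (ob A i) t) (sp (ob B i) t) (sp (ob C (i - 1)) t)).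
        triple (df A i t (pr1 x)) (df B i t (pr2 x))
          ((f i t (pr1 x) \<ominus>\<^bsub>sp (ob C i) t\<^esub> s i t (pr2 x)) \<ominus>\<^bsub>sp (ob C i) t\<^esub> df C (i - 1) t (pr3 x)))"
  by (simp_all add: homotopy_pullback_def)

context
  fixes K :: "('k,'m) ring_scheme" and A B C :: "('n::finite,'k,'v::infinite) cpx" and f s
  assumes A: "cochain_complex K A" and B: "cochain_complex K B" and C: "cochain_complex K C"
    and f: "f \<in> chain_maps K A C" and s: "s \<in> chain_maps K B C"
begin

abbreviation (input) "HP \<equiv> homotopy_pullback A B C f s"

lemma homotopy_pullback_df_hom: "df HP i \<in> pers_hom K (ob HP i) (ob HP (i + 1))"
proof (rule pers_homI)
  note pA = cpx_pmod[OF A] and pB = cpx_pmod[OF B] and pC = cpx_pmod[OF C]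
  \<comment> \<open>Five facts each for the differentials of A, B and C and for f and s, in this
    order; indices that agree modulo five denote the same property.\<close>
  note hom = pers_homD[OF cpx_df[OF A]] pers_homD[OF cpx_df[OF B]] pers_homD[OF cpx_df_pred[OF C]]
    pers_homD[OF chain_maps_hom[OF f]] pers_homD[OF chain_maps_hom[OF s]]
  {
    fix t x assume x: "x \<in> carrier (sp (ob HP i) t)"
    interpret V: abelian_group "sp (ob C i) t" by (rule cpx_group[OF C])
    show "df HP i t x \<in> carrier (sp (ob HP (i + 1)) t)"
      using x by (simp add: hom(1,6,11,16,21))
  next
    fix t x assume "x \<notin> carrier (sp (ob HP i) t)"
    then show "df HP i t x = undefined" by auto
  next
    fix t x y assume x: "x \<in> carrier (sp (ob HP i) t)" and y: "y \<in> carrier (sp (ob HP i) t)"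
    interpret V: abelian_group "sp (ob C i) t" by (rule cpx_group[OF C])
    show "df HP i t (x \<oplus>\<^bsub>sp (ob HP i) t\<^esub> y) = df HP i t x \<oplus>\<^bsub>sp (ob HP (i + 1)) t\<^esub> df HP i t y"
      using x y
      by (simp add: hom(1,6,11,16,21) hom(3,8,13,18,23) pmod_add_closed[OF pA] pmod_add_closed[OF pB]
          pmod_add_closed[OF pC] a_minus_def V.minus_add V.a_ac)
  next
    fix t a x assume a: "a \<in> carrier K" and x: "x \<in> carrier (sp (ob HP i) t)"
    interpret V: Module.module K "sp (ob C i) t" by (rule pmod_module[OF pC])
    show "df HP i t (a \<odot>\<^bsub>sp (ob HP i) t\<^esub> x) = a \<odot>\<^bsub>sp (ob HP (i + 1)) t\<^esub> df HP i t x"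
      using a x
      by (simp add: hom(1,6,11,16,21) hom(4,9,14,19,24) pmod_smult_closed[OF pA] pmod_smult_closed[OF pB]
          pmod_smult_closed[OF pC] a_minus_def V.smult_r_distr V.smult_r_minus)
  next
    fix r t :: "real ^ 'n" and x assume le: "r \<le> t" and x: "x \<in> carrier (sp (ob HP i) r)"
    interpret V: abelian_group "sp (ob C i) t" by (rule cpx_group[OF C])
    interpret W: abelian_group "sp (ob C i) r" by (rule cpx_group[OF C])
    show "df HP i t (mp (ob HP i) r t x) = mp (ob HP (i + 1)) r t (df HP i r x)"
      using x
      by (simp add: hom(1,6,11,16,21) hom(5,10,15,20,25)[OF le] pmod_mp(1,3,6)[OF pA le]
          pmod_mp(1,3,6)[OF pB le] pmod_mp(1,3,6)[OF pC le] a_minus_def)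
  }
qed

text \<open>In the third coordinate of the squared differential, \<open>f d a - s d b\<close> meets
  \<open>- d (f a - s b - d c)\<close>. Since f and s commute with the differentials and the
  differential of C squares to zero, the two cancel; the minus sign before the differential of C
  makes this work.\<close>

lemma homotopy_pullback_complex: "cochain_complex K HP"
proof (rule cochain_complexI)
  fix i
  show "persistence_module K (ob HP i)"
    by (simp add: persistence_module_sum3 cpx_pmod[OF A] cpx_pmod[OF B] cpx_pmod[OF C])
  show "df HP i \<in> pers_hom K (ob HP i) (ob HP (i + 1))" by (rule homotopy_pullback_df_hom)
next
  fix i t x assume x: "x \<in> carrier (sp (ob HP i) t)"
  let ?V = "sp (ob C i) t" and ?W = "sp (ob C (i + 1)) t"
  interpret V: abelian_group ?V by (rule cpx_group[OF C])
  interpret W: abelian_group ?W by (rule cpx_group[OF C])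
  let ?a = "pr1 x" and ?b = "pr2 x" and ?c = "pr3 x"
  have a: "?a \<in> carrier (sp (ob A i) t)" and b: "?b \<in> carrier (sp (ob B i) t)"
    and c: "?c \<in> carrier (sp (ob C (i - 1)) t)" using x by simp_all
  note fa = chain_map_closed[OF f a] and sb = chain_map_closed[OF s b] and dc = df_closed_pred[OF C c]
  note dC = pers_hom_minus[OF cpx_df[OF C] cpx_pmod[OF C] cpx_pmod[OF C]]
  have "df C i t ((f i t ?a \<ominus>\<^bsub>?V\<^esub> s i t ?b) \<ominus>\<^bsub>?V\<^esub> df C (i - 1) t ?c)
      = df C i t (f i t ?a) \<ominus>\<^bsub>?W\<^esub> df C i t (s i t ?b)"
    using fa sb dc by (simp add: dC cpx_dd_pred[OF C c] minus_zero_right[OF W.abelian_group_axioms] df_closed[OF C])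
  then have "(f (i + 1) t (df A i t ?a) \<ominus>\<^bsub>?W\<^esub> s (i + 1) t (df B i t ?b)) \<ominus>\<^bsub>?W\<^esub>
      df C i t ((f i t ?a \<ominus>\<^bsub>?V\<^esub> s i t ?b) \<ominus>\<^bsub>?V\<^esub> df C (i - 1) t ?c) = \<zero>\<^bsub>?W\<^esub>"
    using fa sb by (simp add: chain_maps_df[OF f a] chain_maps_df[OF s b] df_closed[OF C] a_minus_def W.r_neg)
  then show "df HP (i + 1) t (df HP i t x) = \<zero>\<^bsub>sp (ob HP (i + 2)) t\<^esub>"
    using a b c fa sb dc
    by (simp add: df_closed[OF A] df_closed[OF B] cpx_dd[OF A] cpx_dd[OF B] add.commute[of 1 i])
qed

definition pullback_pr1 :: "('n,'v) cmap" where
  "pullback_pr1 = (\<lambda>i t. \<lambda>x\<in>carrier (sp (ob HP i) t). pr1 x)"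

definition pullback_pr2 :: "('n,'v) cmap" where
  "pullback_pr2 = (\<lambda>i t. \<lambda>x\<in>carrier (sp (ob HP i) t). pr2 x)"

lemma sum3_pr_hom:
  assumes "persistence_module K L" "persistence_module K M" "persistence_module K N"
  shows "(\<lambda>t. \<lambda>x\<in>carrier (sp (pers_sum3 L M N) t). pr1 x) \<in> pers_hom K (pers_sum3 L M N) L"
    and "(\<lambda>t. \<lambda>x\<in>carrier (sp (pers_sum3 L M N) t). pr2 x) \<in> pers_hom K (pers_sum3 L M N) M"
    and "(\<lambda>t. \<lambda>x\<in>carrier (sp (pers_sum3 L M N) t). pr3 x) \<in> pers_hom K (pers_sum3 L M N) N"
proof -
  note [simp] = pmod_mp(1)[OF assms(1)] pmod_mp(1)[OF assms(2)] pmod_mp(1)[OF assms(3)]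
    pmod_add_closed[OF assms(1)] pmod_add_closed[OF assms(2)] pmod_add_closed[OF assms(3)]
    pmod_smult_closed[OF assms(1)] pmod_smult_closed[OF assms(2)] pmod_smult_closed[OF assms(3)]
  show "(\<lambda>t. \<lambda>x\<in>carrier (sp (pers_sum3 L M N) t). pr1 x) \<in> pers_hom K (pers_sum3 L M N) L"
    and "(\<lambda>t. \<lambda>x\<in>carrier (sp (pers_sum3 L M N) t). pr2 x) \<in> pers_hom K (pers_sum3 L M N) M"
    and "(\<lambda>t. \<lambda>x\<in>carrier (sp (pers_sum3 L M N) t). pr3 x) \<in> pers_hom K (pers_sum3 L M N) N"
    by (rule pers_homI; auto)+
qed

lemma pullback_pr_chain_maps:
  "pullback_pr1 \<in> chain_maps K HP A" "pullback_pr2 \<in> chain_maps K HP B"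
proof -
  note h = sum3_pr_hom[OF cpx_pmod[OF A] cpx_pmod[OF B] cpx_pmod[OF C]]
  have d: "df HP i t x \<in> carrier (sp (ob HP (i + 1)) t)" if "x \<in> carrier (sp (ob HP i) t)" for i t x
    by (rule pers_homD(1)[OF homotopy_pullback_df_hom that])
  show "pullback_pr1 \<in> chain_maps K HP A"
  proof (rule chain_mapsI)
    show "pullback_pr1 i \<in> pers_hom K (ob HP i) (ob A i)" for i
      using h(1)[of i i "i - 1"] by (simp add: pullback_pr1_def)
    show "pullback_pr1 (i + 1) t (df HP i t x) = df A i t (pullback_pr1 i t x)"
      if "x \<in> carrier (sp (ob HP i) t)" for i t x
      using d[OF that] that by (simp add: pullback_pr1_def)
  qed
  show "pullback_pr2 \<in> chain_maps K HP B"
  proof (rule chain_mapsI)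
    show "pullback_pr2 i \<in> pers_hom K (ob HP i) (ob B i)" for i
      using h(2)[of i i "i - 1"] by (simp add: pullback_pr2_def)
    show "pullback_pr2 (i + 1) t (df HP i t x) = df B i t (pullback_pr2 i t x)"
      if "x \<in> carrier (sp (ob HP i) t)" for i t x
      using d[OF that] that by (simp add: pullback_pr2_def)
  qed
qed

text \<open>The third projection is the homotopy: the third coordinate of the differential of (a, b,
  c) is \<open>f a - s b - d c\<close>, so adding \<open>d c\<close> leaves the difference of the
  two paths around the square.\<close>

lemma homotopy_pullback_square:
  "(chain_comp HP f pullback_pr1, chain_comp HP s pullback_pr2) \<in> homotopy K HP C"
proof (rule homotopyI[where h = "\<lambda>i t. \<lambda>x\<in>carrier (sp (ob HP i) t). pr3 x"])
  note p = pullback_pr_chain_maps and DD = homotopy_pullback_complex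
  show "chain_comp HP f pullback_pr1 \<in> chain_maps K HP C" by (rule chain_comp_map[OF DD p(1) f])
  show "chain_comp HP s pullback_pr2 \<in> chain_maps K HP C" by (rule chain_comp_map[OF DD p(2) s])
  show "(\<lambda>t. \<lambda>x\<in>carrier (sp (ob HP i) t). pr3 x) \<in> pers_hom K (ob HP i) (ob C (i - 1))" for i
    using sum3_pr_hom(3)[OF cpx_pmod[OF A] cpx_pmod[OF B] cpx_pmod[OF C], of i i "i - 1"] by simp
next
  fix i t x assume x: "x \<in> carrier (sp (ob HP i) t)"
  interpret V: abelian_group "sp (ob C i) t" by (rule cpx_group[OF C])
  have a: "pr1 x \<in> carrier (sp (ob A i) t)" and b: "pr2 x \<in> carrier (sp (ob B i) t)"
    and c: "pr3 x \<in> carrier (sp (ob C (i - 1)) t)" using x by simp_all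
  note fa = chain_map_closed[OF f a] and sb = chain_map_closed[OF s b] and dc = df_closed_pred[OF C c]
  have d: "df HP i t x \<in> carrier (sp (ob HP (i + 1)) t)"
    by (rule pers_homD(1)[OF homotopy_pullback_df_hom x])
  have "f i t (pr1 x) \<ominus>\<^bsub>sp (ob C i) t\<^esub> s i t (pr2 x) = df C (i - 1) t (pr3 x) \<oplus>\<^bsub>sp (ob C i) t\<^esub>
      ((f i t (pr1 x) \<ominus>\<^bsub>sp (ob C i) t\<^esub> s i t (pr2 x)) \<ominus>\<^bsub>sp (ob C i) t\<^esub> df C (i - 1) t (pr3 x))"
    using V.add_minus_cancel[OF V.minus_closed[OF fa sb] dc] ..
  then show "chain_comp HP f pullback_pr1 i t x \<ominus>\<^bsub>sp (ob C i) t\<^esub> chain_comp HP s pullback_pr2 i t x =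
      df C (i - 1) t ((\<lambda>x\<in>carrier (sp (ob HP i) t). pr3 x) x) \<oplus>\<^bsub>sp (ob C i) t\<^esub>
      (\<lambda>x\<in>carrier (sp (ob HP (i + 1)) t). pr3 x) (df HP i t x)"
    using x d by (simp add: chain_comp_apply pullback_pr1_def pullback_pr2_def)
qed

text \<open>The kernel of the projection is, up to signs, the shifted cone of s, and this has no
  cohomology when s is a quasi-isomorphism. The proof carries out the corresponding diagram chase on
  elements.\<close>

lemma pullback_pr1_cohom_bij:
  assumes bij: "cohom_bij B C s"
  shows "cohom_bij HP A pullback_pr1"
  unfolding cohom_bij_def
proof (intro allI conjI ballI impI)
  fix i t x assume x: "x \<in> cocycles HP i t" and px: "pullback_pr1 i t x \<in> coboundaries A i t"
  let ?V = "sp (ob C i) t" and ?U = "sp (ob C (i - 1)) t"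
  interpret V: abelian_group ?V by (rule cpx_group[OF C])
  interpret U: abelian_group ?U by (rule cpx_group[OF C])
  define a b c where "a = pr1 x" and "b = pr2 x" and "c = pr3 x"
  have xc: "x \<in> carrier (sp (ob HP i) t)" by (rule cocycles_closed[OF x])
  then have a: "a \<in> carrier (sp (ob A i) t)" and b: "b \<in> carrier (sp (ob B i) t)"
    and c: "c \<in> carrier ?U" by (simp_all add: a_def b_def c_def)
  note fa = chain_map_closed[OF f a] and sb = chain_map_closed[OF s b] and dc = df_closed_pred[OF C c]
  \<comment> \<open>The last two coordinates of the cocycle condition: b is a cocycle, and the
    difference of f a and s b is the boundary of c.\<close>
  have db: "b \<in> cocycles B i t"
    and e: "(f i t a \<ominus>\<^bsub>?V\<^esub> s i t b) \<ominus>\<^bsub>?V\<^esub> df C (i - 1) t c = \<zero>\<^bsub>?V\<^esub>"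
    using cocycles_df[OF x] xc b by (simp_all add: a_def b_def c_def cocycles_def)
  from e have e': "f i t a \<ominus>\<^bsub>?V\<^esub> df C (i - 1) t c = s i t b"
    using fa sb dc V.minus_minus_cancel[OF fa sb] V.minus_eq_zero_iff[OF V.minus_closed[OF fa sb] dc]
    by simp
  from px xc obtain a' where a': "a' \<in> carrier (sp (ob A (i - 1)) t)" "a = df A (i - 1) t a'"
    by (auto simp: coboundaries_def pullback_pr1_def a_def)
  note fa' = chain_map_closed[OF f a'(1)]
  have fad: "f i t a = df C (i - 1) t (f (i - 1) t a')"
    unfolding a'(2) by (rule chain_maps_df_pred[OF f a'(1)])
  note dm = pers_hom_minus[OF cpx_df_pred[OF C] cpx_pmod[OF C] cpx_pmod[OF C]]
  \<comment> \<open>Now f a and \<open>d c\<close> are both coboundaries, hence so is s b, and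
    injectivity of s on cohomology makes b a coboundary as well.\<close>
  have "s i t b = df C (i - 1) t (f (i - 1) t a' \<ominus>\<^bsub>?U\<^esub> c)"
    using fa' c by (simp add: e'[symmetric] fad dm)
  then have "s i t b \<in> coboundaries C i t" using fa' c by (auto simp: coboundaries_def)
  then obtain b' where b': "b' \<in> carrier (sp (ob B (i - 1)) t)" "b = df B (i - 1) t b'"
    using cohom_bijD(1)[OF bij db] by (auto simp: coboundaries_def)
  note sb' = chain_map_closed[OF s b'(1)]
  have sbd: "s i t b = df C (i - 1) t (s (i - 1) t b')"
    unfolding b'(2) by (rule chain_maps_df_pred[OF s b'(1)])
  \<comment> \<open>The primitives \<open>a'\<close> and \<open>b'\<close> alone produce the third
    coordinate \<open>f a' - s b'\<close> where c is wanted. The error \<open>?w\<close> is a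
    cocycle, because c and that difference both have boundary \<open>f a - s b\<close>; surjectivity
    of s on cohomology then writes it as \<open>s b2 + d c'\<close>.\<close>
  let ?w = "c \<ominus>\<^bsub>?U\<^esub> (f (i - 1) t a' \<ominus>\<^bsub>?U\<^esub> s (i - 1) t b')"
  have "df C (i - 1) t ?w = df C (i - 1) t c \<ominus>\<^bsub>?V\<^esub> (f i t a \<ominus>\<^bsub>?V\<^esub> s i t b)"
    using c fa' sb' by (simp add: dm fad sbd)
  also have "\<dots> = \<zero>\<^bsub>?V\<^esub>"
    using e V.minus_eq_zero_iff[OF V.minus_closed[OF fa sb] dc]
      V.minus_eq_zero_iff[OF dc V.minus_closed[OF fa sb]] by simp
  finally have "?w \<in> cocycles C (i - 1) t"
    using c fa' sb' by (simp add: cocycles_def)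
  then obtain b2 where b2: "b2 \<in> cocycles B (i - 1) t"
    "?w \<ominus>\<^bsub>?U\<^esub> s (i - 1) t b2 \<in> coboundaries C (i - 1) t"
    using cohom_bijD(2)[OF bij] by blast
  then obtain c' where c': "c' \<in> carrier (sp (ob C (i - 1 - 1)) t)"
    "?w \<ominus>\<^bsub>?U\<^esub> s (i - 1) t b2 = df C (i - 1 - 1) t c'" by (auto simp: coboundaries_def)
  interpret Bg: abelian_group "sp (ob B (i - 1)) t" by (rule cpx_group[OF B])
  interpret Cg: abelian_group "sp (ob C (i - 1 - 1)) t" by (rule cpx_group[OF C])
  note b2c = cocycles_closed[OF b2(1)]
  note sb2 = chain_map_closed[OF s b2c] and dc' = df_closed_pred[OF C c'(1)]
  \<comment> \<open>Subtracting the cocycle \<open>b2\<close> leaves the second coordinate of the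
    boundary equal to b and adds \<open>s b2\<close> to the third. The sign of \<open>c'\<close>
    undoes the minus sign before the differential of C.\<close>
  let ?y = "triple a' (b' \<ominus>\<^bsub>sp (ob B (i - 1)) t\<^esub> b2) (\<ominus>\<^bsub>sp (ob C (i - 1 - 1)) t\<^esub> c')"
  have y: "?y \<in> carrier (sp (ob HP (i - 1)) t)"
    using a' b' b2c c'(1) by (simp add: abelian_group.a_inv_closed[OF cpx_group[OF C]])
  have "df B (i - 1) t (b' \<ominus>\<^bsub>sp (ob B (i - 1)) t\<^esub> b2) = b"
    by (simp add: pers_hom_minus[OF cpx_df_pred[OF B] cpx_pmod[OF B] cpx_pmod[OF B] b'(1) b2c]
        cocycles_df[OF b2(1), simplified] b'(2)[symmetric] minus_zero_right[OF cpx_group[OF B] b])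
  moreover have "(f (i - 1) t a' \<ominus>\<^bsub>?U\<^esub> s (i - 1) t (b' \<ominus>\<^bsub>sp (ob B (i - 1)) t\<^esub> b2)) \<ominus>\<^bsub>?U\<^esub>
      df C (i - 1 - 1) t (\<ominus>\<^bsub>sp (ob C (i - 1 - 1)) t\<^esub> c') = c"
  proof -
    let ?p = "f (i - 1) t a' \<ominus>\<^bsub>?U\<^esub> s (i - 1) t b'" and ?q = "s (i - 1) t b2"
    note p = U.minus_closed[OF fa' sb']
    have "(f (i - 1) t a' \<ominus>\<^bsub>?U\<^esub> s (i - 1) t (b' \<ominus>\<^bsub>sp (ob B (i - 1)) t\<^esub> b2)) \<ominus>\<^bsub>?U\<^esub>
        df C (i - 1 - 1) t (\<ominus>\<^bsub>sp (ob C (i - 1 - 1)) t\<^esub> c') = (?p \<oplus>\<^bsub>?U\<^esub> ?q) \<oplus>\<^bsub>?U\<^esub> df C (i - 1 - 1) t c'"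
      using fa' sb' sb2 dc'
      unfolding chain_map_minus[OF s B C b'(1) b2c]
        pers_hom_a_inv[OF cpx_df_pred[OF C] cpx_pmod[OF C] cpx_pmod[OF C] c'(1)]
      by (simp add: a_minus_def U.minus_add U.a_ac)
    also have "df C (i - 1 - 1) t c' = c \<ominus>\<^bsub>?U\<^esub> (?p \<oplus>\<^bsub>?U\<^esub> ?q)"
      unfolding c'(2)[symmetric] by (rule U.minus_minus_assoc[OF c p sb2])
    finally show ?thesis using U.add_minus_cancel[OF c U.a_closed[OF p sb2]] by simp
  qed
  ultimately have "df HP (i - 1) t ?y = triple a b c"
    using y a'(2) by simp
  then have "df HP (i - 1) t ?y = x" by (simp add: a_def b_def c_def)
  with y show "x \<in> coboundaries HP i t" unfolding coboundaries_def by blast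
next
  fix i t y assume y: "y \<in> cocycles A i t"
  let ?V = "sp (ob C i) t"
  interpret V: abelian_group ?V by (rule cpx_group[OF C])
  obtain b where b: "b \<in> cocycles B i t" "f i t y \<ominus>\<^bsub>?V\<^esub> s i t b \<in> coboundaries C i t"
    using cohom_bijD(2)[OF bij chain_map_cocycles[OF A C f y]] by blast
  from b(2) obtain c where c: "c \<in> carrier (sp (ob C (i - 1)) t)"
    "f i t y \<ominus>\<^bsub>?V\<^esub> s i t b = df C (i - 1) t c" by (auto simp: coboundaries_def)
  \<comment> \<open>The relation between y, b and c is exactly the vanishing of the third coordinate
    of the differential, so this cocycle lifts y itself and not only its class.\<close>
  let ?x = "triple y b c"
  have x: "?x \<in> carrier (sp (ob HP i) t)"
    using c cocycles_closed[OF b(1)] cocycles_closed[OF y] by simp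
  have "?x \<in> cocycles HP i t"
    using x c(2) df_closed_pred[OF C c(1)]
    by (simp add: cocycles_def cocycles_df[OF b(1)] cocycles_df[OF y] a_minus_def V.r_neg)
  moreover have "y \<ominus>\<^bsub>sp (ob A i) t\<^esub> pullback_pr1 i t ?x \<in> coboundaries A i t"
    using x coset_eq_iff[OF coboundaries_subgroup[OF A], of y i t y] cocycles_closed[OF y]
    by (simp add: pullback_pr1_def)
  ultimately show "\<exists>x\<in>cocycles HP i t. y \<ominus>\<^bsub>sp (ob A i) t\<^esub> pullback_pr1 i t x \<in> coboundaries A i t"
    by blast
qed

end

text \<open>\<open>U\<close> is the pullback of the quasi-isomorphism \<open>S\<close> along
  \<open>F\<close>. The two paths of the homotopy pullback are homotopic maps, which become equal
  morphisms of the homotopy category.\<close>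

lemma K_ore:
  fixes A B C :: "('n::finite,'k,'v::infinite) cpx"
  assumes A: "cochain_complex K A" and B: "cochain_complex K B" and C: "cochain_complex K C"
    and "F \<in> K_hom K A C" and "S \<in> K_quasi_isos K B C"
  obtains D U V where "cochain_complex K D" "U \<in> K_quasi_isos K D A" "V \<in> K_hom K D B"
    "K_comp K D C F U = K_comp K D C S V"
proof -
  from assms(4) obtain f where f: "f \<in> chain_maps K A C" "F = K_class K A C f" by (rule K_homE)
  from assms(5)[THEN K_quasi_isos_hom] obtain s where s: "s \<in> chain_maps K B C" "S = K_class K B C s"
    by (rule K_homE)
  let ?D = "homotopy_pullback A B C f s"
  let ?p = "pullback_pr1 A B C f s" and ?q = "pullback_pr2 A B C f s"
  note D = homotopy_pullback_complex[OF A B C f(1) s(1)]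
  note p = pullback_pr_chain_maps(1)[OF A B C f(1) s(1)]
  note q = pullback_pr_chain_maps(2)[OF A B C f(1) s(1)]
  have "cohom_bij B C s"
    using assms(5) unfolding s(2) K_quasi_isos_class_iff[OF B C s(1)] .
  then have "cohom_bij ?D A ?p" by (rule pullback_pr1_cohom_bij[OF A B C f(1) s(1)])
  then have "K_class K ?D A ?p \<in> K_quasi_isos K ?D A"
    unfolding K_quasi_isos_class_iff[OF D A p] .
  moreover have "K_comp K ?D C F (K_class K ?D A ?p) = K_comp K ?D C S (K_class K ?D B ?q)"
    unfolding f(2) s(2) K_comp_class[OF D A C p f(1)] K_comp_class[OF D B C q s(1)]
    by (rule K_class_eqI[OF D C homotopy_pullback_square[OF A B C f(1) s(1)]])
  ultimately show thesis using that D K_hom_class[OF q] by blast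
qed

section \<open>The derived category\<close>

lemma roofs_iff:
  "(Z, S, F) \<in> roofs K X Y \<longleftrightarrow> cochain_complex K Z \<and> S \<in> K_quasi_isos K Z X \<and> F \<in> K_hom K Z Y"
  by (simp add: roofs_def)

lemma roof_equiv_iff:
  "((Z, S, F), (Z', S', F')) \<in> roof_equiv K X Y \<longleftrightarrow>
     (Z, S, F) \<in> roofs K X Y \<and> (Z', S', F') \<in> roofs K X Y \<and>
     (\<exists>W U U'. cochain_complex K W \<and> U \<in> K_hom K W Z \<and> U' \<in> K_hom K W Z' \<and>
        K_comp K W X S U = K_comp K W X S' U' \<and>
        K_comp K W X S U \<in> K_quasi_isos K W X \<and>
        K_comp K W Y F U = K_comp K W Y F' U')"
  by (auto simp: roof_equiv_def)

text \<open>Only transitivity has content. The two given refinements both map to the middle apex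
  \<open>Z2\<close>, and the Ore condition provides a complex \<open>Q\<close> over both of them,
  which then refines the outer two roofs.\<close>

lemma equiv_roof_equiv:
  fixes X Y :: "('n::finite,'k,'v::infinite) cpx"
  assumes X: "cochain_complex K X" and Y: "cochain_complex K Y"
  shows "equiv (roofs K X Y) (roof_equiv K X Y)"
proof (rule equivI)
  show "roof_equiv K X Y \<subseteq> roofs K X Y \<times> roofs K X Y" by (auto simp: roof_equiv_def)
  show "refl_on (roofs K X Y) (roof_equiv K X Y)"
  proof (rule refl_onI)
    fix \<rho> assume "\<rho> \<in> roofs K X Y"
    moreover obtain Z S F where \<rho>: "\<rho> = (Z, S, F)" by (cases \<rho>)
    ultimately have r: "(Z, S, F) \<in> roofs K X Y"
      and Z: "cochain_complex K Z" and S: "S \<in> K_quasi_isos K Z X" by (simp_all add: roofs_iff)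
    have "K_comp K Z X S (K_id K Z) \<in> K_quasi_isos K Z X"
      using S by (simp add: K_comp_id_right[OF Z X K_quasi_isos_hom[OF S]])
    then show "(\<rho>, \<rho>) \<in> roof_equiv K X Y"
      unfolding \<rho> roof_equiv_iff using r Z K_id_hom[OF Z] by blast
  qed
  show "sym (roof_equiv K X Y)"
  proof (rule symI)
    fix \<rho> \<sigma> assume e: "(\<rho>, \<sigma>) \<in> roof_equiv K X Y"
    obtain Z S F Z' S' F' where "\<rho> = (Z, S, F)" "\<sigma> = (Z', S', F')" by (cases \<rho>, cases \<sigma>)
    then show "(\<sigma>, \<rho>) \<in> roof_equiv K X Y" using e by (simp add: roof_equiv_iff) metis
  qed
  show "trans (roof_equiv K X Y)"
  proof (rule transI)
    fix \<rho> \<sigma> \<tau> assume e: "(\<rho>, \<sigma>) \<in> roof_equiv K X Y" "(\<sigma>, \<tau>) \<in> roof_equiv K X Y"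
    obtain Z1 S1 F1 Z2 S2 F2 Z3 S3 F3
      where eq: "\<rho> = (Z1, S1, F1)" "\<sigma> = (Z2, S2, F2)" "\<tau> = (Z3, S3, F3)"
      by (cases \<rho>, cases \<sigma>, cases \<tau>)
    have r1: "(Z1, S1, F1) \<in> roofs K X Y" and r2: "(Z2, S2, F2) \<in> roofs K X Y"
      and r3: "(Z3, S3, F3) \<in> roofs K X Y"
      using e unfolding eq by (simp_all add: roof_equiv_iff)
    from e(1)[unfolded eq roof_equiv_iff] obtain W U1 U2 where W: "cochain_complex K W"
      and U1: "U1 \<in> K_hom K W Z1" and U2: "U2 \<in> K_hom K W Z2"
      and s: "K_comp K W X S1 U1 = K_comp K W X S2 U2" and q: "K_comp K W X S1 U1 \<in> K_quasi_isos K W X"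
      and t: "K_comp K W Y F1 U1 = K_comp K W Y F2 U2" by blast
    from e(2)[unfolded eq roof_equiv_iff] obtain W' U2' U3 where W': "cochain_complex K W'"
      and U2': "U2' \<in> K_hom K W' Z2" and U3: "U3 \<in> K_hom K W' Z3"
      and s': "K_comp K W' X S2 U2' = K_comp K W' X S3 U3" and q': "K_comp K W' X S2 U2' \<in> K_quasi_isos K W' X"
      and t': "K_comp K W' Y F2 U2' = K_comp K W' Y F3 U3" by blast
    note Z = r1[unfolded roofs_iff, THEN conjunct1] r2[unfolded roofs_iff, THEN conjunct1]
      r3[unfolded roofs_iff, THEN conjunct1]
    have Sq: "S1 \<in> K_quasi_isos K Z1 X" "S2 \<in> K_quasi_isos K Z2 X" "S3 \<in> K_quasi_isos K Z3 X"
      and F: "F1 \<in> K_hom K Z1 Y" "F2 \<in> K_hom K Z2 Y" "F3 \<in> K_hom K Z3 Y"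
      using r1 r2 r3 by (simp_all add: roofs_iff)
    note S = Sq[THEN K_quasi_isos_hom]
    \<comment> \<open>Both \<open>S2\<close> and its composite with \<open>U2'\<close> are
      quasi-isomorphisms; the Ore condition needs one leg to be one.\<close>
    have U2'_q: "U2' \<in> K_quasi_isos K W' Z2"
      by (rule K_quasi_isos_cancel[OF W' Z(2) X U2' Sq(2) q'])
    obtain Q A B where Q: "cochain_complex K Q" and A: "A \<in> K_quasi_isos K Q W"
      and B: "B \<in> K_hom K Q W'" and sq: "K_comp K Q Z2 U2 A = K_comp K Q Z2 U2' B"
      by (rule K_ore[OF W W' Z(2) U2 U2'_q])
    note A' = K_quasi_isos_hom[OF A]
    \<comment> \<open>Stated for an arbitrary target E, so that one computation serves the legs to X
      and the legs to Y.\<close>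
    have "K_comp K Q E G1 (K_comp K Q Z1 U1 A) = K_comp K Q E G3 (K_comp K Q Z3 U3 B)"
      if E: "cochain_complex K E" and G: "G1 \<in> K_hom K Z1 E" "G2 \<in> K_hom K Z2 E" "G3 \<in> K_hom K Z3 E"
        and g: "K_comp K W E G1 U1 = K_comp K W E G2 U2" "K_comp K W' E G2 U2' = K_comp K W' E G3 U3"
      for E G1 G2 G3
    proof -
      have "K_comp K Q E G1 (K_comp K Q Z1 U1 A) = K_comp K Q E (K_comp K W E G2 U2) A"
        unfolding g(1)[symmetric] by (rule K_comp_assoc[OF Q W Z(1) E A' U1 G(1), symmetric])
      also have "\<dots> = K_comp K Q E G2 (K_comp K Q Z2 U2 A)"
        by (rule K_comp_assoc[OF Q W Z(2) E A' U2 G(2)])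
      also have "\<dots> = K_comp K Q E (K_comp K W' E G2 U2') B"
        unfolding sq by (rule K_comp_assoc[OF Q W' Z(2) E B U2' G(2), symmetric])
      also have "\<dots> = K_comp K Q E G3 (K_comp K Q Z3 U3 B)"
        unfolding g(2) by (rule K_comp_assoc[OF Q W' Z(3) E B U3 G(3)])
      finally show ?thesis .
    qed
    note this[OF X S s s'] this[OF Y F t t']
    moreover have "K_comp K Q X S1 (K_comp K Q Z1 U1 A) \<in> K_quasi_isos K Q X"
      unfolding K_comp_assoc[OF Q W Z(1) X A' U1 S(1), symmetric]
      by (rule K_quasi_isos_comp[OF Q W X A q])
    ultimately show "(\<rho>, \<tau>) \<in> roof_equiv K X Y"
      unfolding eq roof_equiv_iff
      using r1 r3 Q K_comp_hom[OF Q W Z(1) A' U1] K_comp_hom[OF Q W' Z(3) B U3] by blast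
  qed
qed

section \<open>The image of the homotopy category\<close>

lemma iota_roof:
  "cochain_complex K X \<Longrightarrow> F \<in> K_hom K X Y \<Longrightarrow> (X, K_id K X, F) \<in> roofs K X Y"
  by (simp add: roofs_iff K_quasi_isos_id)

lemma iota_K_hom:
  "cochain_complex K X \<Longrightarrow> F \<in> K_hom K X Y \<Longrightarrow> iota_K K X Y F \<in> D_hom K X Y"
  unfolding iota_K_def D_class_def D_hom_def by (intro quotientI iota_roof)

text \<open>In a comparison with a roof whose left leg is the identity of X, the map from the
  refinement to X is forced to be the composite of \<open>S\<close> and \<open>U\<close>. Thus
  \<open>U\<close> is the only datum left, and it is a quasi-isomorphism by two out of
  three.\<close>

lemma mem_iota_K_iff:
  fixes X Y :: "('n::finite,'k,'v::infinite) cpx"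
  assumes X: "cochain_complex K X" and Y: "cochain_complex K Y" and F: "F \<in> K_hom K X Y"
  shows "(Z, S, G) \<in> iota_K K X Y F \<longleftrightarrow> (Z, S, G) \<in> roofs K X Y \<and>
    (\<exists>W U. cochain_complex K W \<and> U \<in> K_quasi_isos K W Z \<and>
      K_comp K W Y G U = K_comp K W Y F (K_comp K W X S U))"
proof
  assume "(Z, S, G) \<in> iota_K K X Y F"
  then obtain W U' U where r: "(Z, S, G) \<in> roofs K X Y" and W: "cochain_complex K W"
    and U': "U' \<in> K_hom K W X" and U: "U \<in> K_hom K W Z"
    and s: "K_comp K W X (K_id K X) U' = K_comp K W X S U"
    and q: "K_comp K W X (K_id K X) U' \<in> K_quasi_isos K W X"
    and t: "K_comp K W Y F U' = K_comp K W Y G U"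
    unfolding iota_K_def D_class_def Image_singleton_iff roof_equiv_iff by blast
  from r have Z: "cochain_complex K Z" and S: "S \<in> K_quasi_isos K Z X" by (simp_all add: roofs_iff)
  have "U \<in> K_quasi_isos K W Z"
    using q unfolding s by (rule K_quasi_isos_cancel[OF W Z X U S])
  moreover have "U' = K_comp K W X S U"
    using s unfolding K_comp_id_left[OF W X U'] .
  ultimately show "(Z, S, G) \<in> roofs K X Y \<and>
    (\<exists>W U. cochain_complex K W \<and> U \<in> K_quasi_isos K W Z \<and>
      K_comp K W Y G U = K_comp K W Y F (K_comp K W X S U))"
    using r W t by metis
next
  assume "(Z, S, G) \<in> roofs K X Y \<and>
    (\<exists>W U. cochain_complex K W \<and> U \<in> K_quasi_isos K W Z \<and>
      K_comp K W Y G U = K_comp K W Y F (K_comp K W X S U))"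
  then obtain W U where r: "(Z, S, G) \<in> roofs K X Y" and W: "cochain_complex K W"
    and U: "U \<in> K_quasi_isos K W Z"
    and t: "K_comp K W Y G U = K_comp K W Y F (K_comp K W X S U)" by blast
  from r have Z: "cochain_complex K Z" and S: "S \<in> K_quasi_isos K Z X" by (simp_all add: roofs_iff)
  have SU: "K_comp K W X S U \<in> K_quasi_isos K W X" by (rule K_quasi_isos_comp[OF W Z X U S])
  note SU' = K_quasi_isos_hom[OF SU]
  show "(Z, S, G) \<in> iota_K K X Y F"
    unfolding iota_K_def D_class_def Image_singleton_iff roof_equiv_iff
    using r iota_roof[OF X F] W SU SU' K_quasi_isos_hom[OF U] t K_comp_id_left[OF W X SU'] by metis
qed

text \<open>Collapses the unions over representatives: once all roofs indexing such a union lie in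
  one class, every term equals that class.\<close>

lemma D_class_eq_iota_K:
  fixes X Y :: "('n::finite,'k,'v::infinite) cpx"
  assumes X: "cochain_complex K X" and Y: "cochain_complex K Y" and "\<tau> \<in> iota_K K X Y F"
  shows "D_class K X Y \<tau> = iota_K K X Y F"
  using equiv_class_eq[OF equiv_roof_equiv[OF X Y]] assms(3)
  unfolding iota_K_def D_class_def by blast

lemma iota_K_self:
  fixes X Y :: "('n::finite,'k,'v::infinite) cpx"
  assumes X: "cochain_complex K X" and Y: "cochain_complex K Y" and F: "F \<in> K_hom K X Y"
  shows "(X, K_id K X, F) \<in> iota_K K X Y F"
  unfolding iota_K_def D_class_def
  by (rule equiv_class_self[OF equiv_roof_equiv[OF X Y] iota_roof[OF X F]])

text \<open>Two things are to be shown about the union defining \<open>D_comp\<close>: every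
  composite, for any representatives and any square, lies in the class of the composite in the
  homotopy category, and at least one composite exists.\<close>

lemma D_comp_iota_K:
  fixes X Y E :: "('n::finite,'k,'v::infinite) cpx"
  assumes X: "cochain_complex K X" and Y: "cochain_complex K Y" and E: "cochain_complex K E"
    and F: "F \<in> K_hom K X Y" and G: "G \<in> K_hom K Y E"
  shows "D_comp K X Y E (iota_K K Y E G) (iota_K K X Y F) = iota_K K X E (K_comp K X E G F)"
proof -
  note GF = K_comp_hom[OF X Y E F G]
  have comps: "\<tau> \<in> iota_K K X E (K_comp K X E G F)"
    if \<sigma>: "\<sigma> \<in> iota_K K Y E G" and \<rho>: "\<rho> \<in> iota_K K X Y F" and \<tau>: "\<tau> \<in> roof_comps K X Y E \<sigma> \<rho>"
    for \<rho> \<sigma> \<tau>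
  proof -
    obtain Z S F' where r: "\<rho> = (Z, S, F')" by (cases \<rho>)
    obtain W T G' where s: "\<sigma> = (W, T, G')" by (cases \<sigma>)
    from \<tau> obtain P U V where t: "\<tau> = (P, K_comp K P X S U, K_comp K P E G' V)"
      and P: "cochain_complex K P" and U: "U \<in> K_quasi_isos K P Z" and V: "V \<in> K_hom K P W"
      and sq: "K_comp K P Y F' U = K_comp K P Y T V"
      unfolding r s roof_comps_def by auto
    from \<rho>[unfolded r mem_iota_K_iff[OF X Y F]] obtain W1 u where Z: "cochain_complex K Z"
      and S: "S \<in> K_quasi_isos K Z X" and F': "F' \<in> K_hom K Z Y"
      and W1: "cochain_complex K W1" and u: "u \<in> K_quasi_isos K W1 Z"
      and eu: "K_comp K W1 Y F' u = K_comp K W1 Y F (K_comp K W1 X S u)"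
      unfolding roofs_iff by blast
    from \<sigma>[unfolded s mem_iota_K_iff[OF Y E G]] obtain W2 w where W: "cochain_complex K W"
      and T: "T \<in> K_quasi_isos K W Y" and G': "G' \<in> K_hom K W E"
      and W2: "cochain_complex K W2" and w: "w \<in> K_quasi_isos K W2 W"
      and ew: "K_comp K W2 E G' w = K_comp K W2 E G (K_comp K W2 Y T w)"
      unfolding roofs_iff by blast
    note h = K_quasi_isos_hom
    \<comment> \<open>The equations for \<open>F'\<close> and \<open>G'\<close> hold only after
      \<open>u\<close> and \<open>w\<close>. The first use of the Ore condition refines
      \<open>P\<close> so that \<open>U\<close> factors through \<open>u\<close>, the second so that
      \<open>V\<close> also factors through \<open>w\<close>; over \<open>Q\<close> both equations
      can be applied.\<close>
    obtain Q1 a a' where Q1: "cochain_complex K Q1" and a: "a \<in> K_quasi_isos K Q1 P"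
      and a': "a' \<in> K_hom K Q1 W1" and e1: "K_comp K Q1 Z U a = K_comp K Q1 Z u a'"
      by (rule K_ore[OF P W1 Z h[OF U] u])
    have Va: "K_comp K Q1 W V a \<in> K_hom K Q1 W" by (rule K_comp_hom[OF Q1 P W h[OF a] V])
    obtain Q b b' where Q: "cochain_complex K Q" and b: "b \<in> K_quasi_isos K Q Q1"
      and b': "b' \<in> K_hom K Q W2" and e2: "K_comp K Q W (K_comp K Q1 W V a) b = K_comp K Q W w b'"
      by (rule K_ore[OF Q1 W2 W Va w])
    let ?q = "K_comp K Q P a b" and ?a'b = "K_comp K Q W1 a' b"
    have q: "?q \<in> K_quasi_isos K Q P" by (rule K_quasi_isos_comp[OF Q Q1 P b a])
    have a'b: "?a'b \<in> K_hom K Q W1" by (rule K_comp_hom[OF Q Q1 W1 h[OF b] a'])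
    have Vq: "K_comp K Q W V ?q = K_comp K Q W w b'"
      using e2 K_comp_assoc[OF Q Q1 P W h[OF b] h[OF a] V] by simp
    have Uq: "K_comp K Q Z U ?q = K_comp K Q Z u ?a'b"
      using K_comp_assoc[OF Q Q1 P Z h[OF b] h[OF a] h[OF U]]
        K_comp_assoc[OF Q Q1 W1 Z h[OF b] a' h[OF u]] e1 by simp
    have Vq_hom: "K_comp K Q W V ?q \<in> K_hom K Q W" by (rule K_comp_hom[OF Q P W h[OF q] V])
    have Uq_hom: "K_comp K Q Z U ?q \<in> K_hom K Q Z" by (rule K_comp_hom[OF Q P Z h[OF q] h[OF U]])
    have SU: "K_comp K P X S U \<in> K_quasi_isos K P X" by (rule K_quasi_isos_comp[OF P Z X U S])
    have G'V: "K_comp K P E G' V \<in> K_hom K P E" by (rule K_comp_hom[OF P W E V G'])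
    \<comment> \<open>After the factorisation through \<open>w\<close>, the leg \<open>G'\<close>
      may be exchanged for \<open>T\<close> followed by \<open>G\<close>; \<open>FS\<close> is the
      analogous exchange of \<open>F'\<close> for \<open>S\<close> followed by
      \<open>F\<close>.\<close>
    have GT: "K_comp K Q E G' (K_comp K Q W V ?q) = K_comp K Q E G (K_comp K Q Y T (K_comp K Q W V ?q))"
    proof -
      have "K_comp K Q E G' (K_comp K Q W w b') = K_comp K Q E (K_comp K W2 E G' w) b'"
        by (rule K_comp_assoc[OF Q W2 W E b' h[OF w] G', symmetric])
      also have "\<dots> = K_comp K Q E G (K_comp K Q Y (K_comp K W2 Y T w) b')"
        unfolding ew
        by (rule K_comp_assoc[OF Q W2 Y E b' K_comp_hom[OF W2 W Y h[OF w] h[OF T]] G])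
      also have "K_comp K Q Y (K_comp K W2 Y T w) b' = K_comp K Q Y T (K_comp K Q W w b')"
        by (rule K_comp_assoc[OF Q W2 W Y b' h[OF w] h[OF T]])
      finally show ?thesis unfolding Vq .
    qed
    have FS: "K_comp K Q Y F' (K_comp K Q Z U ?q) = K_comp K Q Y F (K_comp K Q X S (K_comp K Q Z U ?q))"
    proof -
      have "K_comp K Q Y F' (K_comp K Q Z u ?a'b) = K_comp K Q Y (K_comp K W1 Y F' u) ?a'b"
        by (rule K_comp_assoc[OF Q W1 Z Y a'b h[OF u] F', symmetric])
      also have "\<dots> = K_comp K Q Y F (K_comp K Q X (K_comp K W1 X S u) ?a'b)"
        unfolding eu
        by (rule K_comp_assoc[OF Q W1 X Y a'b K_comp_hom[OF W1 Z X h[OF u] h[OF S]] F])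
      also have "K_comp K Q X (K_comp K W1 X S u) ?a'b = K_comp K Q X S (K_comp K Q Z u ?a'b)"
        by (rule K_comp_assoc[OF Q W1 Z X a'b h[OF u] h[OF S]])
      finally show ?thesis unfolding Uq .
    qed
    have TF: "K_comp K Q Y T (K_comp K Q W V ?q) = K_comp K Q Y F' (K_comp K Q Z U ?q)"
      using K_comp_assoc[OF Q P W Y h[OF q] V h[OF T]] K_comp_assoc[OF Q P Z Y h[OF q] h[OF U] F'] sq
      by simp
    \<comment> \<open>Over \<open>Q\<close> the replacements run from \<open>G' V\<close> to
      \<open>G T V\<close>, by the commuting square to \<open>G F' U\<close>, and finally to
      \<open>G F S U\<close>, which is the required equation for the left leg
      \<open>S U\<close>.\<close>
    have "K_comp K Q E (K_comp K P E G' V) ?q = K_comp K Q E G' (K_comp K Q W V ?q)"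
      by (rule K_comp_assoc[OF Q P W E h[OF q] V G'])
    also have "\<dots> = K_comp K Q E G (K_comp K Q Y F (K_comp K Q X S (K_comp K Q Z U ?q)))"
      unfolding GT TF FS ..
    also have "K_comp K Q X S (K_comp K Q Z U ?q) = K_comp K Q X (K_comp K P X S U) ?q"
      by (rule K_comp_assoc[OF Q P Z X h[OF q] h[OF U] h[OF S], symmetric])
    also have "K_comp K Q E G (K_comp K Q Y F \<dots>) = K_comp K Q E (K_comp K X E G F) \<dots>"
      by (rule K_comp_assoc[OF Q X Y E K_comp_hom[OF Q P X h[OF q] h[OF SU]] F G, symmetric])
    finally show ?thesis
      unfolding t mem_iota_K_iff[OF X E GF] roofs_iff using P SU G'V Q q by blast
  qed
  \<comment> \<open>The square with apex X, \<open>U\<close> the identity and \<open>V = F\<close>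
    shows that the canonical roofs have a composite, so the union is not empty.\<close>
  have w: "(X, K_comp K X X (K_id K X) (K_id K X), K_comp K X E G F)
      \<in> roof_comps K X Y E (Y, K_id K Y, G) (X, K_id K X, F)"
    unfolding roof_comps_def
    using X F K_quasi_isos_id[OF X] K_comp_id_left[OF X Y F] K_comp_id_right[OF X Y F] by force
  note cls = D_class_eq_iota_K[OF X E comps]
  note self = iota_K_self[OF Y E G] iota_K_self[OF X Y F]
  show ?thesis
    unfolding D_comp_def
  proof (intro equalityI UN_least)
    show "D_class K X E \<tau> \<subseteq> iota_K K X E (K_comp K X E G F)"
      if "\<sigma> \<in> iota_K K Y E G" "\<rho> \<in> iota_K K X Y F" "\<tau> \<in> roof_comps K X Y E \<sigma> \<rho>" for \<sigma> \<rho> \<tau>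
      unfolding cls[OF that] ..
  next
    show "iota_K K X E (K_comp K X E G F) \<subseteq>
        (\<Union>\<sigma>\<in>iota_K K Y E G. \<Union>\<rho>\<in>iota_K K X Y F. \<Union>\<tau>\<in>roof_comps K X Y E \<sigma> \<rho>. D_class K X E \<tau>)"
      by (rule subsetI, rule UN_I[OF self(1)], rule UN_I[OF self(2)], rule UN_I[OF w])
        (simp only: cls[OF self w])
  qed
qed

text \<open>The shift preserves composites and quasi-isomorphisms, so shifting the refinement that
  witnesses membership of a roof gives one for the shifted roof. The canonical roof keeps the union
  from being empty.\<close>

lemma D_shift_iota_K:
  fixes X Y :: "('n::finite,'k,'v::infinite) cpx"
  assumes X: "cochain_complex K X" and Y: "cochain_complex K Y" and F: "F \<in> K_hom K X Y"
  shows "D_shift K \<epsilon> X Y (iota_K K X Y F) =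
    iota_K K (cpx_shift \<epsilon> X) (cpx_shift \<epsilon> Y) (K_shift K \<epsilon> X Y F)"
proof -
  note sh = cochain_complex_shift[where \<epsilon> = \<epsilon>] and h = K_quasi_isos_hom
  note SF = K_shift_hom[OF X Y F, of \<epsilon>]
  have "roof_shift K \<epsilon> X Y \<rho> \<in> iota_K K (cpx_shift \<epsilon> X) (cpx_shift \<epsilon> Y) (K_shift K \<epsilon> X Y F)"
    if "\<rho> \<in> iota_K K X Y F" for \<rho>
  proof -
    obtain Z S G where r: "\<rho> = (Z, S, G)" by (cases \<rho>)
    from that[unfolded r mem_iota_K_iff[OF X Y F]] obtain W U where Z: "cochain_complex K Z"
      and S: "S \<in> K_quasi_isos K Z X" and G: "G \<in> K_hom K Z Y"
      and W: "cochain_complex K W" and U: "U \<in> K_quasi_isos K W Z"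
      and e: "K_comp K W Y G U = K_comp K W Y F (K_comp K W X S U)"
      unfolding roofs_iff by blast
    have "K_shift K \<epsilon> W Y (K_comp K W Y G U) = K_shift K \<epsilon> W Y (K_comp K W Y F (K_comp K W X S U))"
      by (simp add: e)
    then show ?thesis
      unfolding r roof_shift_def mem_iota_K_iff[OF sh[OF X] sh[OF Y] SF] roofs_iff
        K_shift_comp[OF W Z Y h[OF U] G] K_shift_comp[OF W X Y K_comp_hom[OF W Z X h[OF U] h[OF S]] F]
        K_shift_comp[OF W Z X h[OF U] h[OF S]] prod.case
      using sh[OF Z] sh[OF W] K_quasi_isos_shift[OF Z X S] K_shift_hom[OF Z Y G]
        K_quasi_isos_shift[OF W Z U] by blast
  qed
  note cls = D_class_eq_iota_K[OF sh[OF X] sh[OF Y] this]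
  show ?thesis
    unfolding D_shift_def
  proof (intro equalityI UN_least)
    show "D_class K (cpx_shift \<epsilon> X) (cpx_shift \<epsilon> Y) (roof_shift K \<epsilon> X Y \<rho>) \<subseteq>
        iota_K K (cpx_shift \<epsilon> X) (cpx_shift \<epsilon> Y) (K_shift K \<epsilon> X Y F)"
      if "\<rho> \<in> iota_K K X Y F" for \<rho>
      unfolding cls[OF that] ..
  next
    show "iota_K K (cpx_shift \<epsilon> X) (cpx_shift \<epsilon> Y) (K_shift K \<epsilon> X Y F) \<subseteq>
        (\<Union>\<rho>\<in>iota_K K X Y F. D_class K (cpx_shift \<epsilon> X) (cpx_shift \<epsilon> Y) (roof_shift K \<epsilon> X Y \<rho>))"
      by (rule subsetI, rule UN_I[OF iota_K_self[OF X Y F]]) (simp only: cls[OF iota_K_self[OF X Y F]])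
  qed
qed

section \<open>Interleavings\<close>

text \<open>The images of the two interleaving morphisms work: their composites in the derived
  category are the images of the composites in the homotopy category, which are the smoothings by
  hypothesis.\<close>

lemma interleaved_K_imp_D:
  fixes X Y :: "('n::finite,'k,'v::infinite) cpx"
  assumes X: "cochain_complex K X" and Y: "cochain_complex K Y" and "interleaved_K K \<epsilon> X Y"
  shows "interleaved_D K \<epsilon> X Y"
proof -
  note sh = cochain_complex_shift[where \<epsilon> = \<epsilon>]
  from assms(3) obtain F G where F: "F \<in> K_hom K X (cpx_shift \<epsilon> Y)" and G: "G \<in> K_hom K Y (cpx_shift \<epsilon> X)"
    and e: "K_comp K X (cpx_shift \<epsilon> (cpx_shift \<epsilon> X)) (K_shift K \<epsilon> Y (cpx_shift \<epsilon> X) G) F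
          = K_smoothing K (2 * \<epsilon>) X"
      "K_comp K Y (cpx_shift \<epsilon> (cpx_shift \<epsilon> Y)) (K_shift K \<epsilon> X (cpx_shift \<epsilon> Y) F) G
          = K_smoothing K (2 * \<epsilon>) Y"
    unfolding interleaved_K_def by blast
  \<comment> \<open>The smoothing ends in the shift by \<open>2 * \<epsilon>\<close>, the composite
    in the iterated shift by \<open>\<epsilon>\<close>; writing the former as the latter makes the
    targets match.\<close>
  have sh2: "cpx_shift (2 * \<epsilon>) Z = cpx_shift \<epsilon> (cpx_shift \<epsilon> Z)" for Z :: "('n,'k,'v) cpx"
    by (simp add: cpx_shift_twice)
  have "D_comp K X (cpx_shift \<epsilon> Y) (cpx_shift \<epsilon> (cpx_shift \<epsilon> X))
      (D_shift K \<epsilon> Y (cpx_shift \<epsilon> X) (iota_K K Y (cpx_shift \<epsilon> X) G)) (iota_K K X (cpx_shift \<epsilon> Y) F)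
    = D_smoothing K (2 * \<epsilon>) X"
    unfolding D_shift_iota_K[OF Y sh[OF X] G] D_smoothing_def e(1)[symmetric] sh2
    by (rule D_comp_iota_K[OF X sh[OF Y] sh[OF sh[OF X]] F K_shift_hom[OF Y sh[OF X] G]])
  moreover have "D_comp K Y (cpx_shift \<epsilon> X) (cpx_shift \<epsilon> (cpx_shift \<epsilon> Y))
      (D_shift K \<epsilon> X (cpx_shift \<epsilon> Y) (iota_K K X (cpx_shift \<epsilon> Y) F)) (iota_K K Y (cpx_shift \<epsilon> X) G)
    = D_smoothing K (2 * \<epsilon>) Y"
    unfolding D_shift_iota_K[OF X sh[OF Y] F] D_smoothing_def e(2)[symmetric] sh2
    by (rule D_comp_iota_K[OF Y sh[OF X] sh[OF sh[OF Y]] G K_shift_hom[OF X sh[OF Y] F]])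
  ultimately show ?thesis
    unfolding interleaved_D_def using iota_K_hom[OF X F] iota_K_hom[OF Y G] by blast
qed

section \<open>Complexes concentrated in degree 0\<close>

lemma zero_pmod_simps [simp]:
  "carrier (sp zero_pmod t) = {undefined}" "\<zero>\<^bsub>sp zero_pmod t\<^esub> = undefined"
  "x \<oplus>\<^bsub>sp zero_pmod t\<^esub> y = undefined" "a \<odot>\<^bsub>sp zero_pmod t\<^esub> x = undefined"
  "mp zero_pmod s t x = undefined"
  by (simp_all add: zero_pmod_def)

lemma persistence_module_zero:
  assumes "field K"
  shows "persistence_module K (zero_pmod :: ('n::finite,'k,'v) pmod)"
proof (rule persistence_moduleI)
  fix t
  have "abelian_group (sp (zero_pmod :: ('n,'k,'v) pmod) t)"
    by (rule abelian_groupI) simp_all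
  then show "Module.module K (sp (zero_pmod :: ('n,'k,'v) pmod) t)"
    by (intro moduleI fieldE(1)[OF assms]) simp_all
qed simp_all

lemma iota_Pers_simps [simp]:
  "ob (iota_Pers M) i = (if i = 0 then M else zero_pmod)"
  "df (iota_Pers M) i = pers_zero (ob (iota_Pers M) i) (ob (iota_Pers M) (i + 1))"
  by (simp_all add: iota_Pers_def Let_def)

lemma iota_Pers_complex:
  assumes "field K" "persistence_module K M"
  shows "cochain_complex K (iota_Pers M)"
proof -
  have p: "persistence_module K (ob (iota_Pers M) i)" for i
    using assms(2) by (simp add: persistence_module_zero[OF assms(1)])
  show ?thesis
  proof (rule cochain_complexI[OF p])
    show "df (iota_Pers M) i \<in> pers_hom K (ob (iota_Pers M) i) (ob (iota_Pers M) (i + 1))" for i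
      unfolding iota_Pers_simps(2) by (rule pers_zero_hom[OF p p])
    show "df (iota_Pers M) (i + 1) t (df (iota_Pers M) i t x) = \<zero>\<^bsub>sp (ob (iota_Pers M) (i + 2)) t\<^esub>"
      if "x \<in> carrier (sp (ob (iota_Pers M) i) t)" for i t x
    proof -
      have "i + 1 + 1 = i + 2" by simp
      with that pmod_zero_closed[OF p] show ?thesis
        unfolding iota_Pers_simps(2)
        by (simp add: pers_zero_def add.commute[of 2 i] del: iota_Pers_simps)
    qed
  qed
qed

text \<open>Away from degree 0 the carriers are \<open>{undefined}\<close>, and the constant
  function \<open>undefined\<close> is the only extensional map between them.\<close>

definition iota_Pers_map :: "('n::finite,'v,'v) pmap \<Rightarrow> ('n,'v) cmap" where
  "iota_Pers_map \<phi> = (\<lambda>i. if i = 0 then \<phi> else (\<lambda>t. \<lambda>x\<in>{undefined}. undefined))"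

lemma pers_shift_zero: "pers_shift \<epsilon> zero_pmod = zero_pmod"
  by (simp add: pers_shift_def zero_pmod_def)

text \<open>Equality of complexes on the nose: the zero module is constant in t, so the shift acts
  in degree 0 only.\<close>

lemma iota_Pers_shift: "cpx_shift \<epsilon> (iota_Pers M) = iota_Pers (pers_shift \<epsilon> M)"
  by (simp add: cpx_shift_def iota_Pers_def Let_def fun_eq_iff pers_shift_zero pers_shift_map_def pers_zero_def)

text \<open>All differentials here are zero maps, so commutation says only that the components
  preserve zero.\<close>

lemma iota_Pers_map_chain:
  fixes M N :: "('n::finite,'k,'v) pmod"
  assumes K: "field K" and M: "persistence_module K M" and N: "persistence_module K N"
    and \<phi>: "\<phi> \<in> pers_hom K M N"
  shows "iota_Pers_map \<phi> \<in> chain_maps K (iota_Pers M) (iota_Pers N)"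
proof (rule chain_mapsI)
  note X = iota_Pers_complex[OF K M] and Y = iota_Pers_complex[OF K N]
  have "(\<lambda>t. \<lambda>x\<in>{undefined}. undefined)
      \<in> pers_hom K (zero_pmod :: ('n,'k,'v) pmod) (zero_pmod :: ('n,'k,'v) pmod)"
    by (rule pers_homI) simp_all
  then show h: "iota_Pers_map \<phi> i \<in> pers_hom K (ob (iota_Pers M) i) (ob (iota_Pers N) i)" for i
    using \<phi> by (simp add: iota_Pers_map_def)
  show "iota_Pers_map \<phi> (i + 1) t (df (iota_Pers M) i t x) = df (iota_Pers N) i t (iota_Pers_map \<phi> i t x)"
    if "x \<in> carrier (sp (ob (iota_Pers M) i) t)" for i t x
    using that pers_homD(1)[OF h that] pers_hom_zero[OF h cpx_pmod[OF X] cpx_pmod[OF Y], of "i + 1" t]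
    unfolding iota_Pers_simps(2) by (simp add: pers_zero_def del: iota_Pers_simps)
qed

lemma iota_Pers_map_comp:
  "chain_comp (iota_Pers M) (iota_Pers_map \<psi>) (iota_Pers_map \<phi>) = iota_Pers_map (pers_comp M \<psi> \<phi>)"
  by (auto simp: chain_comp_def pers_comp_def iota_Pers_map_def compose_def fun_eq_iff)

lemma iota_Pers_map_shift: "chain_shift \<epsilon> (iota_Pers_map \<phi>) = iota_Pers_map (pers_shift_map \<epsilon> \<phi>)"
  by (auto simp: chain_shift_def pers_shift_map_def iota_Pers_map_def fun_eq_iff)

text \<open>Away from degree 0 both sides are constantly \<open>undefined\<close>, like the
  structure maps of \<open>zero_pmod\<close>.\<close>

lemma smoothing_iota_Pers: "(\<lambda>i. smoothing \<epsilon> (ob (iota_Pers M) i)) = iota_Pers_map (smoothing \<epsilon> M)"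
  by (auto simp: smoothing_def iota_Pers_map_def fun_eq_iff)

text \<open>The interleaving equations of modules become equalities of chain maps, and these remain
  true for homotopy classes.\<close>

lemma interleaved_Pers_imp_K:
  fixes M N :: "('n::finite,'k,'v) pmod"
  assumes K: "field K" and M: "persistence_module K M" and N: "persistence_module K N"
    and "interleaved_Pers K \<epsilon> M N"
  shows "interleaved_K K \<epsilon> (iota_Pers M) (iota_Pers N)"
proof -
  note sh = persistence_module_shift[where \<epsilon> = \<epsilon>] and cx = iota_Pers_complex[OF K]
  note ch = iota_Pers_map_chain[OF K]
  from assms(4) obtain f g where f: "f \<in> pers_hom K M (pers_shift \<epsilon> N)" and g: "g \<in> pers_hom K N (pers_shift \<epsilon> M)"
    and e: "pers_comp M (pers_shift_map \<epsilon> g) f = smoothing (2 * \<epsilon>) M"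
      "pers_comp N (pers_shift_map \<epsilon> f) g = smoothing (2 * \<epsilon>) N"
    unfolding interleaved_Pers_def by blast
  \<comment> \<open>One half of the interleaving for a general pair of modules; exchanging the roles
    of M and N gives the other half.\<close>
  have comp: "K_comp K (iota_Pers L) (iota_Pers (pers_shift \<epsilon> (pers_shift \<epsilon> L)))
      (K_shift K \<epsilon> (iota_Pers L') (iota_Pers (pers_shift \<epsilon> L))
        (K_class K (iota_Pers L') (iota_Pers (pers_shift \<epsilon> L)) (iota_Pers_map \<psi>)))
      (K_class K (iota_Pers L) (iota_Pers (pers_shift \<epsilon> L')) (iota_Pers_map \<phi>))
    = K_smoothing K (2 * \<epsilon>) (iota_Pers L)"
    if L: "persistence_module K L" and L': "persistence_module K L'"
      and \<phi>: "\<phi> \<in> pers_hom K L (pers_shift \<epsilon> L')" and \<psi>: "\<psi> \<in> pers_hom K L' (pers_shift \<epsilon> L)"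
      and e: "pers_comp L (pers_shift_map \<epsilon> \<psi>) \<phi> = smoothing (2 * \<epsilon>) L"
    for L L' :: "('n,'k,'v) pmod" and \<phi> \<psi>
    unfolding K_shift_class[OF cx[OF L'] cx[OF sh[OF L]] ch[OF L' sh[OF L] \<psi>]] iota_Pers_map_shift
      iota_Pers_shift
      K_comp_class[OF cx[OF L] cx[OF sh[OF L']] cx[OF sh[OF sh[OF L]]] ch[OF L sh[OF L'] \<phi>]
        ch[OF sh[OF L'] sh[OF sh[OF L]] pers_hom_shift[OF \<psi>]]]
      iota_Pers_map_comp e K_smoothing_def smoothing_iota_Pers
    by (simp add: pers_shift_twice)
  show ?thesis
    unfolding interleaved_K_def iota_Pers_shift
    using comp[OF M N f g e(1)] comp[OF N M g f e(2)]
      K_hom_class[OF ch[OF M sh[OF N] f]] K_hom_class[OF ch[OF N sh[OF M] g]] by blast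
qed

theorem theorem5p15:
  fixes K :: "('k,'m) ring_scheme"
  assumes "field K"
  shows
    "(\<forall>(X :: ('n::finite,'k,'v::infinite) cpx) (Y :: ('n,'k,'v) cpx) \<epsilon>.
        cochain_complex K X \<longrightarrow> cochain_complex K Y \<longrightarrow> 0 \<le> \<epsilon> \<longrightarrow>
        interleaved_K K \<epsilon> X Y \<longrightarrow> interleaved_D K \<epsilon> X Y) \<and>
     (\<forall>(M :: ('n,'k,'v) pmod) (N :: ('n,'k,'v) pmod) \<epsilon>.
        persistence_module K M \<longrightarrow> persistence_module K N \<longrightarrow> 0 \<le> \<epsilon> \<longrightarrow>
        interleaved_Pers K \<epsilon> M N \<longrightarrow> interleaved_D K \<epsilon> (iota_Pers M) (iota_Pers N))"
proof (intro conjI allI impI)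
  fix X Y :: "('n,'k,'v) cpx" and \<epsilon>
  assume "cochain_complex K X" "cochain_complex K Y" "interleaved_K K \<epsilon> X Y"
  then show "interleaved_D K \<epsilon> X Y" by (rule interleaved_K_imp_D)
next
  fix M N :: "('n,'k,'v) pmod" and \<epsilon>
  assume M: "persistence_module K M" and N: "persistence_module K N" and "interleaved_Pers K \<epsilon> M N"
  then have "interleaved_K K \<epsilon> (iota_Pers M) (iota_Pers N)"
    by (rule interleaved_Pers_imp_K[OF assms])
  then show "interleaved_D K \<epsilon> (iota_Pers M) (iota_Pers N)"
    by (rule interleaved_K_imp_D[OF iota_Pers_complex[OF assms M] iota_Pers_complex[OF assms N]])
qed

end
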